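(* Let $p$ be a prime not dividing $MN$, let $q\in GL_n(A)$ with $q^t=\pm q$, let $\phi_p$ be the Frobenius lift of the Chern connection attached to $q$ (indexed by the single prime $p$), and let $\phi_{\bar p}$ be the Frobenius lift of the trivial connection. Let $\varphi_{p\bar p}:=\frac1p(\phi_p\circ\phi_{\bar p}-\phi_{\bar p}\circ\phi_p):\mathcal O(G)^{\widehat p}\to\mathcal O(G)^{\widehat p}$ be the $(1,1)$-curvature, let $\Phi_{p\bar p}:=\varphi_{p\bar p}(x)$ (an $n\times n$ matrix over $\mathcal O(G)^{\widehat p}$), and let $\Phi_{p\bar p}(1)$ be its value at $x=1$ (a matrix over $A^{\widehat p}$). Then: 1) $\Phi_{p\bar p}(1)=-\delta_{\bar p}\Big(\big(1+p(q^{(p)})^{-1}\delta_p q\big)^{-1/2}\Big)$. 2) If $n=1$, then $\Phi_{p\bar p}=\Phi_{p\bar p}(1)\cdot x^{p^2}$. 3) $\Phi_{p\bar p}(1)=0$ if and only if each entry of $q$ is either $0$ or a root of unity. Moreover, if $n=1$, then $\varphi_{p\bar p}=0$ if and only if $q$ is a root of unity.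
   Context: Let $M$ be an even positive integer, $N\geq1$, $\zeta_N$ a primitive $N$-th root of unity, $A=\mathbb{Z}[1/M,\zeta_N]$, and $A^{\widehat p}$, $\mathcal O(G)^{\widehat p}$ the $p$-adic completions. There is a unique ring endomorphism $\phi_p$ of $A$ (and of $A^{\widehat p}$) lifting the $p$-power Frobenius ($\zeta_N\mapsto\zeta_N^p$); the associated $p$-derivation is $\delta_p(a)=(\phi_p(a)-a^p)/p$, and on $A^{\widehat p}$ one also writes $\delta_{\bar p}$ for this same $p$-derivation. A $p$-derivation on a $p$-torsion free ring $B$ is a map $\delta:B\to B$ with $b\mapsto b^p+p\delta(b)$ a ring homomorphism (its Frobenius lift). Let $G=GL_n$ over $A$, $\mathcal O(G)=A[x,\det(x)^{-1}]$, $x$ an $n\times n$ matrix of indeterminates; for matrices, $u^t$ is the transpose, $u^{(p)}$ the entrywise $p$-th power, and $\delta_p u$, $\delta_{\bar p}u$ are applied entrywise. The Chern connection attached to $q$ is the $p$-derivation $\delta_p$ of $\mathcal O(G)^{\widehat p}$ whose Frobenius lift $\phi_p$ extends $\phi_p$ on $A^{\widehat p}$ with $\phi_p(x)=x^{(p)}\{(x^{(p)t}\phi_p(q)x^{(p)})^{-1}(x^tqx)^{(p)}\}^{1/2}$, and the trivial connection is the $p$-derivation $\delta_{\bar p}$ of $\mathcal O(G)^{\widehat p}$ with $\delta_{\bar p}x=0$, whose Frobenius lift $\phi_{\bar p}$ extends $\phi_p$ on $A^{\widehat p}$ and sends $x\mapsto x^{(p)}$. Matrix square roots and $(\cdot)^{-1/2}$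 are computed by the binomial series $(1+u)^{s}=1+\sum_{i\ge1}\binom{s}{i}u^i$, convergent $p$-adically for $u$ with entries in $p$ times the ring. *)

theory Defs
  imports
    "Jordan_Normal_Form.VS_Connect"
    "HOL-Algebra.QuotRing"
    "HOL-Algebra.Generated_Rings"
    "HOL-Library.Poly_Mapping"
    "HOL-Library.Product_Lexorder"
begin

section \<open>Matrices over a ring\<close>

text \<open>
  The carrier-based analogue of \<^const>\<open>ring_mat\<close>: square matrices with entries in an
  arbitrary ring record. Thus $GL_n(R)$ is \<open>Units (matrix_ring n R)\<close>, and inverses, powers
  and multiples of matrices are those of the ring \<open>matrix_ring n R\<close>.
\<close>

definition matrix_ring :: "nat \<Rightarrow> ('a, 'm) ring_scheme \<Rightarrow> 'a mat ring" where
  "matrix_ring n R =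
     \<lparr> carrier = {U \<in> carrier_mat n n. \<forall>i<n. \<forall>j<n. U $$ (i, j) \<in> carrier R},
       monoid.mult = (\<lambda>U V. mat n n (\<lambda>(i, j). \<Oplus>\<^bsub>R\<^esub>k\<in>{..<n}. U $$ (i, k) \<otimes>\<^bsub>R\<^esub> V $$ (k, j))),
       one = mat n n (\<lambda>(i, j). if i = j then \<one>\<^bsub>R\<^esub> else \<zero>\<^bsub>R\<^esub>),
       zero = mat n n (\<lambda>_. \<zero>\<^bsub>R\<^esub>),
       add = (\<lambda>U V. mat n n (\<lambda>(i, j). U $$ (i, j) \<oplus>\<^bsub>R\<^esub> V $$ (i, j))) \<rparr>"

definition entrywise_power :: "('a, 'm) ring_scheme \<Rightarrow> nat \<Rightarrow> 'a mat \<Rightarrow> 'a mat" where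
  "entrywise_power R p U = map_mat (\<lambda>a. a [^]\<^bsub>R\<^esub> p) U"


section \<open>The p-adic completion\<close>

definition p_power_ideal :: "nat \<Rightarrow> ('a, 'm) ring_scheme \<Rightarrow> nat \<Rightarrow> 'a set" where
  "p_power_ideal p R k = PIdl\<^bsub>R\<^esub> ([(p ^ k)] \<cdot>\<^bsub>R\<^esub> \<one>\<^bsub>R\<^esub>)"

text \<open>
  The inverse limit of the rings $R/p^kR$. An element is a sequence of cosets; the coset
  \<open>f (Suc k)\<close> maps to \<open>f k\<close> under $R/p^{k+1}R \to R/p^kR$ iff it is contained in \<open>f k\<close>.
\<close>

definition p_completion :: "nat \<Rightarrow> ('a, 'm) ring_scheme \<Rightarrow> (nat \<Rightarrow> 'a set) ring" where
  "p_completion p R =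
     (let Q = (\<lambda>k. R Quot p_power_ideal p R k) in
     \<lparr> carrier = {f. \<forall>k. f k \<in> carrier (Q k) \<and> f (Suc k) \<subseteq> f k},
       monoid.mult = (\<lambda>f g k. f k \<otimes>\<^bsub>Q k\<^esub> g k),
       one = (\<lambda>k. \<one>\<^bsub>Q k\<^esub>),
       zero = (\<lambda>k. \<zero>\<^bsub>Q k\<^esub>),
       add = (\<lambda>f g k. f k \<oplus>\<^bsub>Q k\<^esub> g k) \<rparr>)"

definition to_completion :: "nat \<Rightarrow> ('a, 'm) ring_scheme \<Rightarrow> 'a \<Rightarrow> nat \<Rightarrow> 'a set" where
  "to_completion p R a = (\<lambda>k. p_power_ideal p R k +>\<^bsub>R\<^esub> a)"

text \<open>
  Functoriality: the image of a coset $a + p^kR$ is $h(a) + p^kS$.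
\<close>

definition completion_map ::
    "nat \<Rightarrow> ('b, 'm) ring_scheme \<Rightarrow> ('a \<Rightarrow> 'b) \<Rightarrow> (nat \<Rightarrow> 'a set) \<Rightarrow> nat \<Rightarrow> 'b set" where
  "completion_map p S h f = (\<lambda>k. p_power_ideal p S k <+>\<^bsub>S\<^esub> h ` f k)"


section \<open>The base ring and the coordinate ring of the general linear group\<close>

definition primitive_root_of_unity :: "nat \<Rightarrow> complex \<Rightarrow> bool" where
  "primitive_root_of_unity N \<zeta> \<longleftrightarrow> \<zeta> ^ N = 1 \<and> (\<forall>k. 0 < k \<and> k < N \<longrightarrow> \<zeta> ^ k \<noteq> 1)"

definition is_root_of_unity :: "complex \<Rightarrow> bool" where
  "is_root_of_unity z \<longleftrightarrow> (\<exists>k>0. z ^ k = 1)"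

definition base_ring :: "nat \<Rightarrow> complex \<Rightarrow> complex ring" where
  "base_ring M \<zeta> = class_ring \<lparr> carrier := generate_ring class_ring {1 / of_nat M, \<zeta>} \<rparr>"

text \<open>
  The coordinate ring $A[x, \det(x)^{-1}]$ is realised inside the field of fractions of the
  complex polynomial ring in variables indexed by pairs of natural numbers; only the variables
  with both indices below \<open>n\<close> are used. (The lexicographic order on pairs serves only to have the
  type of these polynomials recognised as an integral domain.)
\<close>

type_synonym ratfun = "(((nat \<times> nat) \<Rightarrow>\<^sub>0 nat) \<Rightarrow>\<^sub>0 complex) fract"

definition const_fun :: "complex \<Rightarrow> ratfun" where
  "const_fun a = to_fract (Poly_Mapping.single 0 a)"

definition coord_fun :: "nat \<Rightarrow> nat \<Rightarrow> ratfun" where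
  "coord_fun i j = to_fract (Poly_Mapping.single (Poly_Mapping.single (i, j) 1) 1)"

definition generic_matrix :: "nat \<Rightarrow> ratfun mat" where
  "generic_matrix n = mat n n (\<lambda>(i, j). coord_fun i j)"

definition GL_ring :: "complex ring \<Rightarrow> nat \<Rightarrow> ratfun ring" where
  "GL_ring A n = class_ring \<lparr> carrier := generate_ring class_ring
     (const_fun ` carrier A \<union> {coord_fun i j | i j. i < n \<and> j < n}
       \<union> {inverse (det (generic_matrix n))}) \<rparr>"

type_synonym A_hat = "nat \<Rightarrow> complex set"
type_synonym GL_hat = "nat \<Rightarrow> ratfun set"

definition GL_completion :: "nat \<Rightarrow> complex ring \<Rightarrow> nat \<Rightarrow> GL_hat ring" where
  "GL_completion p A n = p_completion p (GL_ring A n)"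

definition structure_map :: "nat \<Rightarrow> complex ring \<Rightarrow> nat \<Rightarrow> A_hat \<Rightarrow> GL_hat" where
  "structure_map p A n = completion_map p (GL_ring A n) const_fun"

definition x_matrix :: "nat \<Rightarrow> complex ring \<Rightarrow> nat \<Rightarrow> GL_hat mat" where
  "x_matrix p A n = map_mat (to_completion p (GL_ring A n)) (generic_matrix n)"

text \<open>
  Evaluation at the identity matrix: the (unique) homomorphism of algebras over the completed
  base ring sending \<open>x\<close> to \<open>1\<close>.
\<close>

definition evaluation_at_one :: "nat \<Rightarrow> complex ring \<Rightarrow> nat \<Rightarrow> (GL_hat \<Rightarrow> A_hat) \<Rightarrow> bool" where
  "evaluation_at_one p A n ev \<longleftrightarrow>
     ev \<in> Ring.ring_hom (GL_completion p A n) (p_completion p A) \<and>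
     (\<forall>a\<in>carrier (p_completion p A). ev (structure_map p A n a) = a) \<and>
     map_mat ev (x_matrix p A n) = \<one>\<^bsub>matrix_ring n (p_completion p A)\<^esub>"


section \<open>Binomial series of matrices\<close>

definition p_adic_limit ::
    "nat \<Rightarrow> ('a, 'm) ring_scheme \<Rightarrow> nat \<Rightarrow> (nat \<Rightarrow> 'a mat) \<Rightarrow> 'a mat \<Rightarrow> bool" where
  "p_adic_limit p R n S L \<longleftrightarrow>
     L \<in> carrier (matrix_ring n R) \<and>
     (\<forall>m. \<exists>K. \<forall>k\<ge>K. \<forall>i<n. \<forall>j<n. L $$ (i, j) \<ominus>\<^bsub>R\<^esub> S k $$ (i, j) \<in> p_power_ideal p R m)"

text \<open>
  The value $V^s = \sum_{i \ge 0} \binom{s}{i} (V - 1)^i$. It is used for $s = \pm 1/2$ only,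
  where the coefficients lie in $\mathbb{Z}[1/2]$, hence in the base ring, since \<open>M\<close> is even;
  \<open>c\<close> is the map from the base ring to the ring \<open>R\<close> of matrix entries.
\<close>

definition matrix_binomial_power ::
    "nat \<Rightarrow> ('a, 'm) ring_scheme \<Rightarrow> nat \<Rightarrow> (complex \<Rightarrow> 'a) \<Rightarrow> complex \<Rightarrow> 'a mat \<Rightarrow> 'a mat" where
  "matrix_binomial_power p R n c s V =
     (let E = matrix_ring n R in
      THE L. p_adic_limit p R n
        (\<lambda>k. \<Oplus>\<^bsub>E\<^esub>i\<in>{..k}. map_mat (\<lambda>a. c (s gchoose i) \<otimes>\<^bsub>R\<^esub> a) ((V \<ominus>\<^bsub>E\<^esub> \<one>\<^bsub>E\<^esub>) [^]\<^bsub>E\<^esub> i)) L)"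


section \<open>p-derivations, Chern and trivial connections, curvature\<close>

text \<open>
  \<open>p_derivation\<close> is used for the \<open>p\<close>-torsion free completions only, so torsion-freeness is
  not part of it. Each of the predicates \<open>base_derivation\<close>, \<open>trivial_connection\<close> and
  \<open>chern_connection\<close> determines the p-derivation on the carrier, since ring homomorphisms
  between p-adic completions are p-adically continuous.
\<close>

definition frobenius_lift :: "nat \<Rightarrow> ('a, 'm) ring_scheme \<Rightarrow> ('a \<Rightarrow> 'a) \<Rightarrow> 'a \<Rightarrow> 'a" where
  "frobenius_lift p R \<delta> b = b [^]\<^bsub>R\<^esub> p \<oplus>\<^bsub>R\<^esub> [p] \<cdot>\<^bsub>R\<^esub> \<delta> b"

definition p_derivation :: "nat \<Rightarrow> ('a, 'm) ring_scheme \<Rightarrow> ('a \<Rightarrow> 'a) \<Rightarrow> bool" where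
  "p_derivation p R \<delta> \<longleftrightarrow> \<delta> \<in> carrier R \<rightarrow> carrier R \<and> frobenius_lift p R \<delta> \<in> Ring.ring_hom R R"

definition base_derivation :: "nat \<Rightarrow> complex ring \<Rightarrow> complex \<Rightarrow> (A_hat \<Rightarrow> A_hat) \<Rightarrow> bool" where
  "base_derivation p A \<zeta> \<delta> \<longleftrightarrow>
     p_derivation p (p_completion p A) \<delta> \<and>
     frobenius_lift p (p_completion p A) \<delta> (to_completion p A \<zeta>) = to_completion p A (\<zeta> ^ p)"

definition extends_base_frobenius ::
    "nat \<Rightarrow> complex ring \<Rightarrow> nat \<Rightarrow> (A_hat \<Rightarrow> A_hat) \<Rightarrow> (GL_hat \<Rightarrow> GL_hat) \<Rightarrow> bool" where
  "extends_base_frobenius p A n \<delta>A \<delta> \<longleftrightarrow>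
     (\<forall>a\<in>carrier (p_completion p A).
        frobenius_lift p (GL_completion p A n) \<delta> (structure_map p A n a) =
        structure_map p A n (frobenius_lift p (p_completion p A) \<delta>A a))"

definition trivial_connection ::
    "nat \<Rightarrow> complex ring \<Rightarrow> nat \<Rightarrow> (A_hat \<Rightarrow> A_hat) \<Rightarrow> (GL_hat \<Rightarrow> GL_hat) \<Rightarrow> bool" where
  "trivial_connection p A n \<delta>A \<delta> \<longleftrightarrow>
     p_derivation p (GL_completion p A n) \<delta> \<and>
     extends_base_frobenius p A n \<delta>A \<delta> \<and>
     map_mat \<delta> (x_matrix p A n) = \<zero>\<^bsub>matrix_ring n (GL_completion p A n)\<^esub>"

definition chern_connection ::
    "nat \<Rightarrow> complex ring \<Rightarrow> nat \<Rightarrow> (A_hat \<Rightarrow> A_hat) \<Rightarrow> complex mat \<Rightarrow> (GL_hat \<Rightarrow> GL_hat) \<Rightarrow> bool" where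
  "chern_connection p A n \<delta>A q \<delta> \<longleftrightarrow>
     (let B = GL_completion p A n;
          E = matrix_ring n B;
          x = x_matrix p A n;
          xp = entrywise_power B p x;
          c = structure_map p A n \<circ> to_completion p A;
          qB = map_mat c q;
          \<phi>q = map_mat (structure_map p A n \<circ> frobenius_lift p (p_completion p A) \<delta>A
                        \<circ> to_completion p A) q
      in p_derivation p B \<delta> \<and>
         extends_base_frobenius p A n \<delta>A \<delta> \<and>
         map_mat (frobenius_lift p B \<delta>) x =
           xp \<otimes>\<^bsub>E\<^esub> matrix_binomial_power p B n c (1/2)
             (inv\<^bsub>E\<^esub> (transpose_mat xp \<otimes>\<^bsub>E\<^esub> \<phi>q \<otimes>\<^bsub>E\<^esub> xp) \<otimes>\<^bsub>E\<^esub>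
              entrywise_power B p (transpose_mat x \<otimes>\<^bsub>E\<^esub> qB \<otimes>\<^bsub>E\<^esub> x)))"

text \<open>
  \<open>curvature p R \<phi> \<psi>\<close> is $\frac1p(\phi\psi - \psi\phi)$; the quotient by \<open>p\<close> is well defined when
  \<open>R\<close> is \<open>p\<close>-torsion free and \<open>\<phi>\<close>, \<open>\<psi>\<close> are Frobenius lifts.
\<close>

definition curvature ::
    "nat \<Rightarrow> ('a, 'm) ring_scheme \<Rightarrow> ('a \<Rightarrow> 'a) \<Rightarrow> ('a \<Rightarrow> 'a) \<Rightarrow> 'a \<Rightarrow> 'a" where
  "curvature p R \<phi> \<psi> b =
     (THE c. c \<in> carrier R \<and> [p] \<cdot>\<^bsub>R\<^esub> c = \<phi> (\<psi> b) \<ominus>\<^bsub>R\<^esub> \<psi> (\<phi> b))"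

end

theory Submission
  imports
    Defs
    "HOL-Algebra.UnivPoly"
    "HOL-Computational_Algebra.Formal_Power_Series"
    "HOL-Number_Theory.Residues"
begin

text \<open>
  Since $\delta_{\bar p} x = 0$, the curvature satisfies $\Phi_{p\bar p} = -\delta_{\bar p}(\phi_p(x))$. Evaluation
  at $x = 1$ intertwines $\phi_{\bar p}$ with the Frobenius lift $\phi$ of $A^{\widehat p}$, hence
  $\Phi_{p\bar p}(1) = -\delta(W)$, where $W$ is the value of $\phi_p(x)$ at $1$. Both $W$ and
  $(1 + p (q^{(p)})^{-1} \delta q)^{-1/2}$ are square roots of $\phi(q)^{-1} q^{(p)}$ that are congruent to $1$
  modulo $p$, and there is only one such root. This uniqueness, together with Vandermonde's identity for the
  squares of the binomial series, replaces all other computations with power series.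

  The Frobenius lift has finite order, so it reflects divisibility by powers of $p$. If $\delta(W) = 0$, then
  each entry $w$ of $W$ satisfies $\phi(w) = w^p$ and is congruent to $0$ or to $1$ modulo $p$; comparing orders of
  divisibility gives $w = 0$ or $w = 1$, so $W = 1$, that is, $\phi(a) = a^p$ for each entry $a$ of $q$. Iterating
  up to the order $m$ of $\phi$ gives $a^{p^m} = a$ in $A^{\widehat p}$, hence in $A$, which is $p$-adically
  separated. Conversely, if $a$ is a root of unity, then $\phi(a) a^{-p}$ is a root of unity congruent to $1$
  modulo $p$, and therefore equal to $1$.
\<close>

section \<open>Multiples of powers of $p$\<close>

text \<open>Square roots in a non-commutative ring are far from unique, so every root is carried
  together with its congruence to 1 modulo p; and p is odd because M is even, which allows 2 to be
  cancelled when two such roots are compared. The matrix 1 + p (q^{(p)})^{-1} \<delta>q equals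
  (q^{(p)})^{-1} \<phi>(q), the inverse of the matrix whose root is W; this is the origin of the
  exponent -1/2 in the first assertion.

  For n = 1 the factors x cancel under the root in the Chern connection. Hence \<phi>_p(x) = x^p w
  with w constant, and the derivation of the trivial connection sends x^p w to x^{p^2} \<delta>(w),
  which is the second assertion. If moreover w = 1, both Frobenius lifts agree on constants and on
  x, so they coincide and in particular commute.

  Homomorphisms out of a completion need no continuity assumption: any ring homomorphism maps
  multiples of p^k to multiples of p^k. This is what makes maps on the completed coordinate ring
  determined by their values on constants and on x.\<close>

text \<open>
  Matrix rings are not commutative, so for them these sets take the place of the principal ideals
  \<^const>\<open>p_power_ideal\<close>.
\<close>

definition p_multiples :: "nat \<Rightarrow> ('a, 'm) ring_scheme \<Rightarrow> nat \<Rightarrow> 'a set" where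
  "p_multiples p R k = (\<lambda>a. [(p ^ k)] \<cdot>\<^bsub>R\<^esub> a) ` carrier R"

lemma p_multiples_mult_mem:
  "a \<in> carrier R \<Longrightarrow> [(p ^ k)] \<cdot>\<^bsub>R\<^esub> a \<in> p_multiples p R k"
  by (simp add: p_multiples_def)

lemma (in cring) p_power_ideal_eq_p_multiples: "p_power_ideal p R k = p_multiples p R k"
proof -
  have "x \<otimes> [(p ^ k)] \<cdot> \<one> = [(p ^ k)] \<cdot> x" if "x \<in> carrier R" for x
    using that by (simp add: add_pow_rdistr)
  then show ?thesis
    unfolding p_power_ideal_def p_multiples_def cgenideal_def by force
qed

lemma (in ring) add_pow_minus:
  assumes "a \<in> carrier R" "b \<in> carrier R"
  shows "[(k::nat)] \<cdot> (a \<ominus> b) = [k] \<cdot> a \<ominus> [k] \<cdot> b"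
  using assms by (simp add: minus_eq add.nat_pow_distrib add.nat_pow_inv)

context ring
begin

lemma p_multiples_carrier: "a \<in> p_multiples p R k \<Longrightarrow> a \<in> carrier R"
  by (auto simp: p_multiples_def)

lemma p_multiples_0: "p_multiples p R 0 = carrier R"
  by (auto simp: p_multiples_def image_iff)

lemma p_multiples_zero [simp]: "\<zero> \<in> p_multiples p R k"
  using p_multiples_mult_mem[of \<zero> R p k] by simp

lemma p_multiples_add:
  assumes "a \<in> p_multiples p R k" "b \<in> p_multiples p R k"
  shows "a \<oplus> b \<in> p_multiples p R k"
  using assms by (auto simp: p_multiples_def add.nat_pow_distrib[symmetric])

lemma p_multiples_uminus:
  assumes "a \<in> p_multiples p R k"
  shows "\<ominus> a \<in> p_multiples p R k"
  using assms by (auto simp: p_multiples_def add.nat_pow_inv[symmetric])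

lemma p_multiples_minus:
  assumes "a \<in> p_multiples p R k" "b \<in> p_multiples p R k"
  shows "a \<ominus> b \<in> p_multiples p R k"
  using assms by (simp add: minus_eq p_multiples_add p_multiples_uminus)

lemma p_multiples_minus_trans:
  assumes "a \<ominus> b \<in> p_multiples p R k" "b \<ominus> c \<in> p_multiples p R k"
    and "a \<in> carrier R" "b \<in> carrier R" "c \<in> carrier R"
  shows "a \<ominus> c \<in> p_multiples p R k"
proof -
  have "a \<ominus> c = (a \<ominus> b) \<oplus> (b \<ominus> c)" using assms(3-5) by algebra
  then show ?thesis using p_multiples_add[OF assms(1,2)] by simp
qed

lemma p_multiples_minus_commute:
  assumes "a \<ominus> b \<in> p_multiples p R k" "a \<in> carrier R" "b \<in> carrier R"
  shows "b \<ominus> a \<in> p_multiples p R k"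
proof -
  have "b \<ominus> a = \<ominus> (a \<ominus> b)" using assms(2,3) by algebra
  then show ?thesis using p_multiples_uminus[OF assms(1)] by simp
qed

lemma p_multiples_mult:
  assumes "a \<in> p_multiples p R i" "b \<in> p_multiples p R j"
  shows "a \<otimes> b \<in> p_multiples p R (i + j)"
proof -
  obtain u v where "u \<in> carrier R" "a = [(p ^ i)] \<cdot> u" "v \<in> carrier R" "b = [(p ^ j)] \<cdot> v"
    using assms by (auto simp: p_multiples_def)
  then have "a \<otimes> b = [(p ^ (i + j))] \<cdot> (u \<otimes> v)" and "u \<otimes> v \<in> carrier R"
    by (simp_all add: add_pow_ldistr add_pow_rdistr add.nat_pow_pow power_add mult.commute)
  then show ?thesis by (simp add: p_multiples_mult_mem)
qed

lemma p_multiples_lmult: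
  "a \<in> carrier R \<Longrightarrow> b \<in> p_multiples p R k \<Longrightarrow> a \<otimes> b \<in> p_multiples p R k"
  using p_multiples_mult[of a p 0 b k] by (simp add: p_multiples_0)

lemma p_multiples_rmult:
  "a \<in> p_multiples p R k \<Longrightarrow> b \<in> carrier R \<Longrightarrow> a \<otimes> b \<in> p_multiples p R k"
  using p_multiples_mult[of a p k b 0] by (simp add: p_multiples_0)

lemma p_multiples_add_pow:
  assumes "a \<in> p_multiples p R k"
  shows "[(p ^ i)] \<cdot> a \<in> p_multiples p R (i + k)"
  using assms by (auto simp: p_multiples_def add.nat_pow_pow power_add mult.commute)

lemma p_multiples_add_pow':
  assumes "a \<in> p_multiples p R k"
  shows "[(m::nat)] \<cdot> a \<in> p_multiples p R k"
  using assms by (auto simp: p_multiples_def add.nat_pow_pow mult.commute[of _ m])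
    (metis add.nat_pow_closed add.nat_pow_pow mult.commute image_eqI)

lemma p_multiples_antimono:
  assumes "j \<le> k" "a \<in> p_multiples p R k"
  shows "a \<in> p_multiples p R j"
proof -
  obtain u where u: "u \<in> carrier R" "a = [(p ^ k)] \<cdot> u" using assms by (auto simp: p_multiples_def)
  have "a = [(p ^ j)] \<cdot> ([(p ^ (k - j))] \<cdot> u)"
    using u assms(1) by (simp add: add.nat_pow_pow power_add[symmetric])
  then show ?thesis using u p_multiples_mult_mem by (metis add.nat_pow_closed)
qed

lemma p_multiples_pow:
  assumes "a \<in> p_multiples p R 1"
  shows "a [^] (i::nat) \<in> p_multiples p R i"
proof (induction i)
  case (Suc i)
  then show ?case using p_multiples_mult[OF Suc assms] by simp
qed (simp add: p_multiples_0)

lemma p_multiples_finsum: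
  assumes "\<And>i. i \<in> I \<Longrightarrow> f i \<in> p_multiples p R k"
  shows "(\<Oplus>i\<in>I. f i) \<in> p_multiples p R k"
  using assms
proof (induction I rule: infinite_finite_induct)
  case (insert x F)
  then have "f \<in> F \<rightarrow> carrier R" "f x \<in> carrier R" by (auto intro: p_multiples_carrier)
  with insert show ?case by (simp add: p_multiples_add)
qed auto

lemma p_multiples_mult_diff:
  assumes "a \<ominus> a' \<in> p_multiples p R k" "b \<ominus> b' \<in> p_multiples p R k"
    and "a \<in> carrier R" "a' \<in> carrier R" "b \<in> carrier R" "b' \<in> carrier R"
  shows "a \<otimes> b \<ominus> a' \<otimes> b' \<in> p_multiples p R k"
proof -
  have "a \<otimes> b \<ominus> a' \<otimes> b' = a \<otimes> (b \<ominus> b') \<oplus> (a \<ominus> a') \<otimes> b'"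
    using assms(3-6) by algebra
  then show ?thesis using assms by (simp add: p_multiples_add p_multiples_lmult p_multiples_rmult)
qed

text \<open>By Bezout there are \<open>m'\<close> and \<open>l\<close> with m' m = 1 + l p^k, so
  multiplication by \<open>m'\<close> recovers \<open>a\<close> up to a multiple of p^k. Applied to
  m = 2 when p is odd, and to primes m different from p.\<close>

lemma p_multiples_coprime_cancel:
  assumes "coprime m p" "a \<in> carrier R" "[(m::nat)] \<cdot> a \<in> p_multiples p R k"
  shows "a \<in> p_multiples p R k"
proof (cases "m = 0")
  case True
  \<comment> \<open>Coprimality with 0 leaves only p = 1, and then every element is a multiple of
    p^k.\<close>
  with assms(1) have "p = 1" by simp
  with assms(2) show ?thesis by (auto simp: p_multiples_def image_iff)
next
  case False
  have "coprime m (p ^ k)" using assms(1) by simp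
  then obtain m' l where ml: "m' * m = Suc (l * p ^ k)"
    using bezout_nat[OF False, of "p ^ k"] by (auto simp: mult.commute)
  have "[m'] \<cdot> ([m] \<cdot> a) = a \<oplus> [(p ^ k)] \<cdot> ([l] \<cdot> a)"
    using assms(2) ml by (simp add: add.nat_pow_pow mult.commute add.m_comm)
  moreover have "[m'] \<cdot> ([m] \<cdot> a) \<in> p_multiples p R k" using assms by (simp add: p_multiples_add_pow')
  moreover have "a = (a \<oplus> [(p ^ k)] \<cdot> ([l] \<cdot> a)) \<ominus> [(p ^ k)] \<cdot> ([l] \<cdot> a)"
    using assms(2) add.nat_pow_closed by (simp add: minus_eq a_assoc r_neg)
  ultimately show ?thesis
    using assms(2) p_multiples_mult_mem by (metis add.nat_pow_closed p_multiples_minus)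
qed

end

lemma (in monoid) UnitsI:
  "a \<in> carrier G \<Longrightarrow> b \<in> carrier G \<Longrightarrow> a \<otimes> b = \<one> \<Longrightarrow> b \<otimes> a = \<one> \<Longrightarrow> a \<in> Units G"
  by (auto simp: Units_def)

section \<open>Ring homomorphisms, divisibility by powers of p, and units\<close>

lemma (in ring_hom_ring) hom_a_minus [simp]:
  "a \<in> carrier R \<Longrightarrow> b \<in> carrier R \<Longrightarrow> h (a \<ominus> b) = h a \<ominus>\<^bsub>S\<^esub> h b"
  by (simp add: R.minus_eq S.minus_eq)

lemma (in ring_hom_ring) hom_add_pow [simp]:
  "a \<in> carrier R \<Longrightarrow> h ([(k::nat)] \<cdot> a) = [k] \<cdot>\<^bsub>S\<^esub> h a"
  by (induction k) (simp_all)

lemma (in ring_hom_ring) hom_nat_pow [simp]: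
  "a \<in> carrier R \<Longrightarrow> h (a [^] (k::nat)) = h a [^]\<^bsub>S\<^esub> k"
  by (induction k) (simp_all)

lemma (in ring_hom_ring) hom_p_multiples:
  "a \<in> p_multiples p R k \<Longrightarrow> h a \<in> p_multiples p S k"
  by (auto simp: p_multiples_def)

lemma (in ring_hom_ring) hom_Units:
  assumes "a \<in> Units R"
  shows "h a \<in> Units S" "h (inv a) = inv\<^bsub>S\<^esub> h a"
proof -
  have *: "h a \<otimes>\<^bsub>S\<^esub> h (inv a) = \<one>\<^bsub>S\<^esub>" "h (inv a) \<otimes>\<^bsub>S\<^esub> h a = \<one>\<^bsub>S\<^esub>"
    using assms hom_mult hom_one by (metis R.Units_closed R.Units_inv_closed R.Units_r_inv R.Units_l_inv)+
  show "h a \<in> Units S" using * assms by (intro S.UnitsI[of _ "h (inv a)"]) auto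
  show "h (inv a) = inv\<^bsub>S\<^esub> h a" using * assms by (intro S.inv_char[symmetric]) auto
qed

section \<open>Power series in $p$-adically complete rings\<close>

text \<open>Commutativity is not assumed, since the locale is also applied to rings of
  matrices.\<close>

locale p_torsion_free_ring = ring R for R (structure) and p :: nat +
  assumes p_gt_1: "1 < p"
    and p_torsion_free: "a \<in> carrier R \<Longrightarrow> [p] \<cdot> a = \<zero> \<Longrightarrow> a = \<zero>"
begin

lemma p_pow_torsion_free: "a \<in> carrier R \<Longrightarrow> [(p ^ k)] \<cdot> a = \<zero> \<Longrightarrow> a = \<zero>"
proof (induction k)
  case (Suc k)
  then have "[p] \<cdot> ([(p ^ k)] \<cdot> a) = \<zero>" "[(p ^ k)] \<cdot> a \<in> carrier R"
    by (simp_all add: add.nat_pow_pow mult.commute)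
  with Suc p_torsion_free[of "[(p ^ k)] \<cdot> a"] show ?case by blast
qed simp

lemma p_pow_cancel:
  assumes "a \<in> carrier R" "b \<in> carrier R" "[(p ^ k)] \<cdot> a = [(p ^ k)] \<cdot> b"
  shows "a = b"
proof -
  have "[(p ^ k)] \<cdot> (a \<ominus> b) = \<zero>" using assms by (simp add: add_pow_minus)
  then have "a \<ominus> b = \<zero>" using assms p_pow_torsion_free by simp
  then show ?thesis using assms by simp
qed

lemma p_cancel:
  assumes "a \<in> carrier R" "b \<in> carrier R" "[p] \<cdot> a = [p] \<cdot> b"
  shows "a = b"
  using p_pow_cancel[of a b 1] assms by simp

lemma p_multiples_cancel:
  assumes "a \<in> carrier R" "[(p ^ i)] \<cdot> a \<in> p_multiples p R (i + k)"
  shows "a \<in> p_multiples p R k"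
proof -
  obtain b where b: "b \<in> carrier R" "[(p ^ i)] \<cdot> a = [(p ^ (i + k))] \<cdot> b"
    using assms(2) by (auto simp: p_multiples_def)
  then have "[(p ^ i)] \<cdot> a = [(p ^ i)] \<cdot> ([(p ^ k)] \<cdot> b)"
    by (simp add: add.nat_pow_pow power_add mult.commute)
  then have "a = [(p ^ k)] \<cdot> b" using assms(1) b(1) p_pow_cancel by simp
  then show ?thesis using b(1) p_multiples_mult_mem by simp
qed

end

text \<open>Completeness is stated with a fixed rate: the terms k and k+1 agree modulo p^k, and the
  limit agrees with the k-th term modulo p^k. This form passes to matrices entry by entry and avoids
  moduli of convergence.\<close>

locale p_complete_ring = p_torsion_free_ring +
  assumes p_separated: "(\<And>k. a \<in> p_multiples p R k) \<Longrightarrow> a = \<zero>"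
    and p_complete: "(\<And>k. s k \<in> carrier R) \<Longrightarrow> (\<And>k. s (Suc k) \<ominus> s k \<in> p_multiples p R k)
      \<Longrightarrow> \<exists>l\<in>carrier R. \<forall>k. l \<ominus> s k \<in> p_multiples p R k"
begin

lemma p_separated_eq:
  assumes "a \<in> carrier R" "b \<in> carrier R" "\<And>k. a \<ominus> b \<in> p_multiples p R k"
  shows "a = b"
  using p_separated[of "a \<ominus> b"] assms by simp

text \<open>
  Writing the roots as $1 + X$ and $1 + Y$ with $X, Y$ divisible by $p$, the equation
  $2(X - Y) = -X(X - Y) - (X - Y)Y$ improves the divisibility of $X - Y$ by one power of $p$.
\<close>

lemma square_root_unique:
  assumes "odd p" "S \<in> carrier R" "T \<in> carrier R"
    and "S \<ominus> \<one> \<in> p_multiples p R 1" "T \<ominus> \<one> \<in> p_multiples p R 1" "S \<otimes> S = T \<otimes> T"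
  shows "S = T"
proof (rule p_separated_eq)
  fix k show "S \<ominus> T \<in> p_multiples p R k"
  proof (induction k)
    case (Suc k)
    let ?X = "S \<ominus> \<one>" and ?Y = "T \<ominus> \<one>" and ?D = "S \<ominus> T"
    have "[(2::nat)] \<cdot> ?D = ?D \<oplus> ?D" using assms(2,3) by (simp add: numeral_2_eq_2)
    also have "\<dots> = (S \<otimes> S \<ominus> T \<otimes> T) \<ominus> (?X \<otimes> ?D \<oplus> ?D \<otimes> ?Y)"
      using assms(2,3) by (algebra, simp)
    also have "\<dots> = \<ominus> (?X \<otimes> ?D \<oplus> ?D \<otimes> ?Y)"
      using assms(2,3,6) by (simp add: minus_eq r_neg)
    also have "\<dots> \<in> p_multiples p R (Suc k)"
      using p_multiples_mult[OF assms(4) Suc] p_multiples_mult[OF Suc assms(5)]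
      by (intro p_multiples_uminus p_multiples_add) simp_all
    finally show ?case
      using assms(1-3) by (simp add: p_multiples_coprime_cancel[of 2])
  qed (use assms(2,3) in \<open>simp add: p_multiples_0\<close>)
qed (use assms in auto)

end

text \<open>Models power series in a single matrix: \<open>R\<close> stands for the matrix ring and
  \<open>c\<close> for the embedding of scalars. Centrality of the coefficients is what lets power
  series in one element of a non-commutative ring be multiplied by the Cauchy product.\<close>

locale central_coefficients = p_complete_ring +
  fixes S :: "'c :: comm_ring_1 set" and c :: "'c \<Rightarrow> 'a"
  assumes S_subring: "subring S class_ring"
    and c_hom: "c \<in> Ring.ring_hom (class_ring\<lparr>carrier := S\<rparr>) R"
    and c_central: "\<And>s a. s \<in> S \<Longrightarrow> a \<in> carrier R \<Longrightarrow> c s \<otimes> a = a \<otimes> c s"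
begin

lemma coeff_ring: "ring (class_ring\<lparr>carrier := S\<rparr>)"
  using ring.subring_is_ring[OF class_ring.ring_axioms S_subring] .

interpretation c: ring_hom_ring "class_ring\<lparr>carrier := S\<rparr>" R c
  using coeff_ring ring_axioms c_hom
  by (simp add: ring_hom_ring_def ring_hom_ring_axioms_def)

lemma coeff_simps:
  "s \<in> S \<Longrightarrow> c s \<in> carrier R"
  "s \<in> S \<Longrightarrow> t \<in> S \<Longrightarrow> c (s * t) = c s \<otimes> c t"
  "s \<in> S \<Longrightarrow> t \<in> S \<Longrightarrow> c (s + t) = c s \<oplus> c t"
  "c 1 = \<one>" "c 0 = \<zero>"
  using c.hom_closed c.hom_mult c.R.ring_axioms c.hom_add c.hom_one c.hom_zero by simp_all

lemma S_closed:
  "0 \<in> S" "1 \<in> S" "s \<in> S \<Longrightarrow> t \<in> S \<Longrightarrow> s + t \<in> S" "s \<in> S \<Longrightarrow> t \<in> S \<Longrightarrow> s * t \<in> S"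
  using subringE(2,3,6,7)[OF S_subring] by simp_all

lemma S_sum: "(\<And>i. i \<in> I \<Longrightarrow> f i \<in> S) \<Longrightarrow> sum f I \<in> S"
  by (induction I rule: infinite_finite_induct) (auto intro: S_closed)

lemma coeff_sum:
  "finite I \<Longrightarrow> (\<And>i. i \<in> I \<Longrightarrow> f i \<in> S) \<Longrightarrow> c (sum f I) = (\<Oplus>i\<in>I. c (f i))"
proof (induction I rule: finite_induct)
  case (insert x F)
  then have "(\<lambda>i. c (f i)) \<in> F \<rightarrow> carrier R" "c (f x) \<in> carrier R" by (auto simp: coeff_simps)
  with insert show ?case by (simp add: coeff_simps S_sum)
qed (simp add: coeff_simps)

definition series_sum :: "(nat \<Rightarrow> 'c) \<Rightarrow> 'a \<Rightarrow> nat \<Rightarrow> 'a" where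
  "series_sum f U k = (\<Oplus>i\<in>{..k}. c (f i) \<otimes> U [^] i)"

text \<open>The rate is part of the definition: if \<open>U\<close> is a multiple of p, the terms
  after the k-th are multiples of p^(k+1). Values can then be multiplied by working modulo p^(k+1)
  with the k-th partial sums.\<close>

definition series_value :: "(nat \<Rightarrow> 'c) \<Rightarrow> 'a \<Rightarrow> 'a \<Rightarrow> bool" where
  "series_value f U L \<longleftrightarrow>
     L \<in> carrier R \<and> (\<forall>k. L \<ominus> series_sum f U k \<in> p_multiples p R (Suc k))"

context
  fixes U assumes U: "U \<in> p_multiples p R 1"
begin

lemma U_closed: "U \<in> carrier R" using U by (rule p_multiples_carrier)

lemma term_closed: "f (i::nat) \<in> S \<Longrightarrow> c (f i) \<otimes> U [^] i \<in> carrier R"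
  by (simp add: U_closed coeff_simps)

lemma term_p_multiples: "f (i::nat) \<in> S \<Longrightarrow> c (f i) \<otimes> U [^] i \<in> p_multiples p R i"
  by (simp add: coeff_simps p_multiples_lmult p_multiples_pow[OF U])

lemma series_sum_closed: "range f \<subseteq> S \<Longrightarrow> series_sum f U k \<in> carrier R"
  unfolding series_sum_def by (auto intro!: finsum_closed term_closed)

lemma series_sum_Suc:
  "range f \<subseteq> S \<Longrightarrow> series_sum f U (Suc k) = c (f (Suc k)) \<otimes> U [^] Suc k \<oplus> series_sum f U k"
  unfolding series_sum_def
  by (rule finsum_Suc) (auto intro!: term_closed simp del: nat_pow_Suc)

lemma series_sum_0: "range f \<subseteq> S \<Longrightarrow> series_sum f U 0 = c (f 0)"
  using coeff_simps(1)[of "f 0"] by (simp add: series_sum_def atMost_0 image_subset_iff)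

lemma series_sum_diff:
  assumes "range f \<subseteq> S"
  shows "series_sum f U (Suc k) \<ominus> series_sum f U k \<in> p_multiples p R (Suc k)"
proof -
  have t: "c (f (Suc k)) \<otimes> U [^] Suc k \<in> p_multiples p R (Suc k)"
    using assms by (intro term_p_multiples) auto
  have "series_sum f U (Suc k) \<ominus> series_sum f U k = c (f (Suc k)) \<otimes> U [^] Suc k"
    unfolding series_sum_Suc[OF assms] minus_eq
    using p_multiples_carrier[OF t] series_sum_closed[OF assms, of k] by (simp add: a_assoc r_neg)
  with t show ?thesis by simp
qed

lemma series_value_exists:
  assumes "range f \<subseteq> S"
  shows "\<exists>L. series_value f U L"
proof -
  have "\<exists>l\<in>carrier R. \<forall>k. l \<ominus> series_sum f U k \<in> p_multiples p R k"
    using p_multiples_antimono[OF le_SucI[OF order_refl] series_sum_diff[OF assms]]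
    by (intro p_complete series_sum_closed assms)
  then obtain l where l: "l \<in> carrier R" "\<And>k. l \<ominus> series_sum f U k \<in> p_multiples p R k" by blast
  \<comment> \<open>Completeness gives only p^k at index k; going through the partial sum of index
    k+1 gains the missing power.\<close>
  have "l \<ominus> series_sum f U k \<in> p_multiples p R (Suc k)" for k
    using p_multiples_minus_trans[OF l(2) series_sum_diff[OF assms] l(1)]
      series_sum_closed[OF assms] by blast
  with l(1) show ?thesis unfolding series_value_def by blast
qed

text \<open>The limit in \<open>matrix_binomial_power\<close> comes without a rate of convergence.
  Comparing both candidates with the partial sum of index max K m identifies it with the value that
  has one.\<close>

lemma series_value_limit_unique:
  assumes "range f \<subseteq> S" "series_value f U L" "L' \<in> carrier R"
    and "\<And>m. \<exists>K. \<forall>k\<ge>K. L' \<ominus> series_sum f U k \<in> p_multiples p R m"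
  shows "L' = L"
proof (rule p_separated_eq)
  show L: "L \<in> carrier R" using assms(2) by (simp add: series_value_def)
  show "L' \<ominus> L \<in> p_multiples p R m" for m
  proof -
    obtain K where K: "\<And>k. k \<ge> K \<Longrightarrow> L' \<ominus> series_sum f U k \<in> p_multiples p R m"
      using assms(4) by blast
    let ?s = "series_sum f U (max K m)"
    have "L \<ominus> ?s \<in> p_multiples p R (Suc (max K m))"
      using assms(2) by (simp add: series_value_def)
    then have "L \<ominus> ?s \<in> p_multiples p R m"
      by (rule p_multiples_antimono[rotated]) simp
    then have "?s \<ominus> L \<in> p_multiples p R m"
      using p_multiples_minus_commute L series_sum_closed[OF assms(1)] by blast
    moreover have "L' \<ominus> ?s \<in> p_multiples p R m" by (simp add: K)
    ultimately show ?thesis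
      using p_multiples_minus_trans assms(3) series_sum_closed[OF assms(1)] L by blast
  qed
qed fact

lemma series_value_limit:
  assumes "series_value f U L"
  shows "\<exists>K. \<forall>k\<ge>K. L \<ominus> series_sum f U k \<in> p_multiples p R m"
  using assms p_multiples_antimono unfolding series_value_def by (meson le_SucI)

lemma series_value_cong_coeff_0:
  assumes "range f \<subseteq> S" "series_value f U L"
  shows "L \<ominus> c (f 0) \<in> p_multiples p R 1"
  using assms(2) series_sum_0[OF assms(1)] by (metis One_nat_def series_value_def)

text \<open>Serves the exponents 0 and 1, whose binomial series stop: from index 1 on, every partial
  sum is already the claimed value.\<close>

lemma series_value_linear:
  assumes "range f \<subseteq> S" "\<And>i. i \<ge> 2 \<Longrightarrow> f i = 0" "series_value f U L"
  shows "L = c (f 0) \<oplus> c (f 1) \<otimes> U"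
proof (rule series_value_limit_unique[OF assms(1,3), symmetric])
  have c01: "c (f 0) \<in> carrier R" "c (f 1) \<in> carrier R" using assms(1) by (simp_all add: coeff_simps image_subset_iff)
  then show closed: "c (f 0) \<oplus> c (f 1) \<otimes> U \<in> carrier R" using U_closed by simp
  have "series_sum f U (Suc k) = c (f 0) \<oplus> c (f 1) \<otimes> U" for k
  proof (induction k)
    case 0
    then show ?case
      using series_sum_Suc[OF assms(1), of 0] series_sum_0[OF assms(1)] c01 U_closed
      by (simp add: a_comm)
  next
    case (Suc k)
    then show ?case
      using series_sum_Suc[OF assms(1), of "Suc k"] assms(2)[of "Suc (Suc k)"] U_closed closed
      by (simp add: coeff_simps del: nat_pow_Suc)
  qed
  then have "\<forall>k\<ge>1. (c (f 0) \<oplus> c (f 1) \<otimes> U) \<ominus> series_sum f U k \<in> p_multiples p R m" for m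
    using closed by (metis One_nat_def Suc_le_D minus_eq p_multiples_zero r_neg)
  then show "\<exists>K. \<forall>k\<ge>K. (c (f 0) \<oplus> c (f 1) \<otimes> U) \<ominus> series_sum f U k \<in> p_multiples p R m" for m
    by blast
qed

text \<open>The product of the two partial sums is a sum of Cauchy terms of degree up to 2k. In
  degrees m up to k these are exactly the terms of the product series; in higher degrees each
  summand has the factor p^m and is absorbed by p^(k+1).\<close>

lemma series_sum_mult:
  assumes f: "range f \<subseteq> S" and g: "range g \<subseteq> S"
  shows "series_sum f U k \<otimes> series_sum g U k \<ominus> series_sum (\<lambda>m. \<Sum>i\<le>m. f i * g (m - i)) U k
    \<in> p_multiples p R (Suc k)"
proof -
  define h where "h = (\<lambda>m. \<Sum>i\<le>m. f i * g (m - i))"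
  \<comment> \<open>Cutting the sequences off at k makes the partial sums full sums of bounded
    sequences, as \<open>cauchy_product\<close> requires.\<close>
  define F where "F i = (if i \<le> k then c (f i) \<otimes> U [^] i else \<zero>)" for i
  define G where "G i = (if i \<le> k then c (g i) \<otimes> U [^] i else \<zero>)" for i
  define H where "H m = (\<Oplus>i\<in>{..m}. F i \<otimes> G (m - i))" for m
  have fS: "f i \<in> S" and gS: "g i \<in> S" for i using f g by auto
  have h: "range h \<subseteq> S" by (auto simp: h_def intro!: S_sum S_closed fS gS)
  have Fp: "F i \<in> p_multiples p R i" and Gp: "G i \<in> p_multiples p R i" for i
    using term_p_multiples[of f i, OF fS] term_p_multiples[of g i, OF gS] by (auto simp: F_def G_def)
  have FG: "F i \<in> carrier R" "G i \<in> carrier R" for i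
    using Fp Gp p_multiples_carrier by blast+
  have "series_sum f U k \<otimes> series_sum g U k = (\<Oplus>i\<in>{..k}. F i) \<otimes> (\<Oplus>i\<in>{..k}. G i)"
    unfolding series_sum_def F_def G_def
    by (intro arg_cong2[of _ _ _ _ "(\<otimes>)"] finsum_cong') (auto intro!: term_closed fS gS)
  also have "\<dots> = (\<Oplus>m\<in>{..k+k}. H m)"
    unfolding H_def
    by (rule cauchy_product[symmetric]) (auto simp: F_def G_def intro!: bound.intro term_closed fS gS)
  also have "\<dots> = (\<Oplus>m\<in>{..k} \<union> {k<..k+k}. H m)"
    by (simp add: ivl_disj_un_one)
  also have "\<dots> = (\<Oplus>m\<in>{..k}. H m) \<oplus> (\<Oplus>m\<in>{k<..k+k}. H m)"
    by (rule finsum_Un_disjoint) (auto simp: H_def intro!: finsum_closed FG m_closed)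
  also have "(\<Oplus>m\<in>{..k}. H m) = series_sum h U k"
    unfolding series_sum_def
  proof (rule finsum_cong')
    fix m assume m: "m \<in> {..k}"
    have "H m = (\<Oplus>i\<in>{..m}. c (f i * g (m - i)) \<otimes> U [^] m)"
      unfolding H_def
    proof (rule finsum_cong')
      fix i assume i: "i \<in> {..m}"
      have "F i \<otimes> G (m - i) = (c (f i) \<otimes> U [^] i) \<otimes> (c (g (m - i)) \<otimes> U [^] (m - i))"
        using i m diff_le_self[of m i] by (simp add: F_def G_def del: diff_le_self)
      also have "\<dots> = c (f i) \<otimes> (U [^] i \<otimes> c (g (m - i))) \<otimes> U [^] (m - i)"
        using fS gS U_closed by (simp add: m_assoc coeff_simps)
      \<comment> \<open>Centrality moves the coefficient \<open>c (g (m - i))\<close> to the left of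
        the power of \<open>U\<close>.\<close>
      also have "\<dots> = (c (f i) \<otimes> c (g (m - i))) \<otimes> (U [^] i \<otimes> U [^] (m - i))"
        unfolding c_central[OF gS nat_pow_closed[OF U_closed], symmetric]
        using fS gS U_closed by (simp add: m_assoc coeff_simps)
      also have "\<dots> = c (f i * g (m - i)) \<otimes> U [^] m"
        using i U_closed by (simp add: nat_pow_mult coeff_simps fS gS)
      finally show "F i \<otimes> G (m - i) = c (f i * g (m - i)) \<otimes> U [^] m" .
    qed (auto intro!: m_closed coeff_simps S_closed fS gS nat_pow_closed U_closed)
    also have "\<dots> = c (h m) \<otimes> U [^] m"
      unfolding h_def using U_closed
      by (subst finsum_ldistr[symmetric])
        (auto intro!: arg_cong2[of _ _ _ _ "(\<otimes>)"] coeff_sum[symmetric] coeff_simps(1) S_closed fS gS)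
    finally show "H m = c (h m) \<otimes> U [^] m" .
  qed (use h in \<open>auto intro!: term_closed\<close>)
  finally have "series_sum f U k \<otimes> series_sum g U k \<ominus> series_sum h U k = (\<Oplus>m\<in>{k<..k+k}. H m)"
  proof -
    assume "series_sum f U k \<otimes> series_sum g U k = series_sum h U k \<oplus> (\<Oplus>m\<in>{k<..k+k}. H m)"
    moreover have "(\<Oplus>m\<in>{k<..k+k}. H m) \<in> carrier R"
      by (auto simp: H_def intro!: finsum_closed FG m_closed)
    ultimately show ?thesis using series_sum_closed[OF h, of k]
      by (simp add: minus_eq a_comm[of "series_sum h U k"] a_assoc r_neg)
  qed
  also have "\<dots> \<in> p_multiples p R (Suc k)"
  proof (intro p_multiples_finsum)
    fix m assume m: "m \<in> {k<..k+k}"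
    have "H m \<in> p_multiples p R m"
      unfolding H_def
    proof (intro p_multiples_finsum)
      fix i assume "i \<in> {..m}"
      then show "F i \<otimes> G (m - i) \<in> p_multiples p R m"
        using p_multiples_mult[OF Fp Gp, of i "m - i"] by simp
    qed
    then show "H m \<in> p_multiples p R (Suc k)"
      using m by (intro p_multiples_antimono[of "Suc k" m]) auto
  qed
  finally show ?thesis unfolding h_def .
qed

lemma series_value_mult:
  assumes f: "range f \<subseteq> S" and g: "range g \<subseteq> S"
    and L: "series_value f U L" and M: "series_value g U M"
  shows "series_value (\<lambda>m. \<Sum>i\<le>m. f i * g (m - i)) U (L \<otimes> M)"
proof -
  let ?h = "\<lambda>m. \<Sum>i\<le>m. f i * g (m - i)"
  have h: "range ?h \<subseteq> S" using f g by (auto intro!: S_sum S_closed)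
  have LM: "L \<in> carrier R" "M \<in> carrier R" using L M by (auto simp: series_value_def)
  have "L \<otimes> M \<ominus> series_sum ?h U k \<in> p_multiples p R (Suc k)" for k
  proof -
    have "L \<otimes> M \<ominus> series_sum f U k \<otimes> series_sum g U k \<in> p_multiples p R (Suc k)"
      using L M LM f g by (intro p_multiples_mult_diff series_sum_closed) (auto simp: series_value_def)
    from p_multiples_minus_trans[OF this series_sum_mult[OF f g]] show ?thesis
      using LM series_sum_closed[OF f] series_sum_closed[OF g] series_sum_closed[OF h] by simp
  qed
  with LM show ?thesis by (simp add: series_value_def)
qed

end

end

section \<open>Matrix rings\<close>

lemma matrix_ring_simps:
  "carrier (matrix_ring n R) = {U \<in> carrier_mat n n. \<forall>i<n. \<forall>j<n. U $$ (i, j) \<in> carrier R}"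
  "U \<otimes>\<^bsub>matrix_ring n R\<^esub> V =
     mat n n (\<lambda>(i, j). \<Oplus>\<^bsub>R\<^esub>k\<in>{..<n}. U $$ (i, k) \<otimes>\<^bsub>R\<^esub> V $$ (k, j))"
  "\<one>\<^bsub>matrix_ring n R\<^esub> = mat n n (\<lambda>(i, j). if i = j then \<one>\<^bsub>R\<^esub> else \<zero>\<^bsub>R\<^esub>)"
  "\<zero>\<^bsub>matrix_ring n R\<^esub> = mat n n (\<lambda>_. \<zero>\<^bsub>R\<^esub>)"
  "U \<oplus>\<^bsub>matrix_ring n R\<^esub> V = mat n n (\<lambda>(i, j). U $$ (i, j) \<oplus>\<^bsub>R\<^esub> V $$ (i, j))"
  by (simp_all add: matrix_ring_def)

lemma matrix_ring_carrierI:
  "U \<in> carrier_mat n n \<Longrightarrow> (\<And>i j. i < n \<Longrightarrow> j < n \<Longrightarrow> U $$ (i, j) \<in> carrier R)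
    \<Longrightarrow> U \<in> carrier (matrix_ring n R)"
  by (simp add: matrix_ring_simps)

lemma matrix_ring_carrierD:
  assumes "U \<in> carrier (matrix_ring n R)"
  shows "U \<in> carrier_mat n n" "dim_row U = n" "dim_col U = n"
    "i < n \<Longrightarrow> j < n \<Longrightarrow> U $$ (i, j) \<in> carrier R"
  using assms by (auto simp: matrix_ring_simps)

lemma matrix_ring_eqI:
  assumes "U \<in> carrier (matrix_ring n R)" "V \<in> carrier (matrix_ring n R)"
    and "\<And>i j. i < n \<Longrightarrow> j < n \<Longrightarrow> U $$ (i, j) = V $$ (i, j)"
  shows "U = V"
  using assms by (intro eq_matI) (auto simp: matrix_ring_simps)

context ring
begin

lemma finsum_if_eq:
  assumes "i < n" "f i \<in> carrier R"
  shows "(\<Oplus>k\<in>{..<n::nat}. if i = k then f k else \<zero>) = f i"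
proof -
  have "(\<Oplus>k\<in>{..<n}. if i = k then f k else \<zero>) = (\<Oplus>k\<in>{..<n}. if i = k then f i else \<zero>)"
    using assms by (intro finsum_cong') auto
  then show ?thesis using finsum_singleton[of i "{..<n}" "\<lambda>_. f i"] assms by simp
qed

lemma matrix_mult_closed:
  assumes "U \<in> carrier (matrix_ring n R)" "V \<in> carrier (matrix_ring n R)" "i < n" "j < n"
  shows "(\<Oplus>k\<in>{..<n}. U $$ (i, k) \<otimes> V $$ (k, j)) \<in> carrier R"
  using assms by (intro finsum_closed) (auto simp: matrix_ring_simps)

lemma matrix_mult_assoc:
  assumes "U \<in> carrier (matrix_ring n R)" "V \<in> carrier (matrix_ring n R)"
    "W \<in> carrier (matrix_ring n R)" "i < n" "j < n"
  shows "(\<Oplus>k\<in>{..<n}. (\<Oplus>l\<in>{..<n}. U $$ (i, l) \<otimes> V $$ (l, k)) \<otimes> W $$ (k, j)) =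
    (\<Oplus>l\<in>{..<n}. U $$ (i, l) \<otimes> (\<Oplus>k\<in>{..<n}. V $$ (l, k) \<otimes> W $$ (k, j)))" (is "?L = ?R")
proof -
  note [simp] = assms(4,5) assms(1-3)[THEN matrix_ring_carrierD(4)]
  have "?L = (\<Oplus>k\<in>{..<n}. \<Oplus>l\<in>{..<n}. U $$ (i, l) \<otimes> (V $$ (l, k) \<otimes> W $$ (k, j)))"
    by (intro finsum_cong') (auto simp: finsum_ldistr m_assoc Pi_def cong: finsum_cong)
  also have "\<dots> = (\<Oplus>l\<in>{..<n}. \<Oplus>k\<in>{..<n}. U $$ (i, l) \<otimes> (V $$ (l, k) \<otimes> W $$ (k, j)))"
    by (rule finsum_finsum_swap) auto
  also have "\<dots> = ?R"
    by (intro finsum_cong') (auto simp: finsum_rdistr Pi_def cong: finsum_cong)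
  finally show ?thesis .
qed

lemma matrix_ring_ring: "ring (matrix_ring n R)"
proof (intro ringI abelian_groupI monoidI)
  fix U V W assume UVW: "U \<in> carrier (matrix_ring n R)" "V \<in> carrier (matrix_ring n R)"
    "W \<in> carrier (matrix_ring n R)"
  note [simp] = UVW[THEN matrix_ring_carrierD(4)]
  show "U \<oplus>\<^bsub>matrix_ring n R\<^esub> V \<oplus>\<^bsub>matrix_ring n R\<^esub> W =
      U \<oplus>\<^bsub>matrix_ring n R\<^esub> (V \<oplus>\<^bsub>matrix_ring n R\<^esub> W)"
    by (intro eq_matI) (auto simp: matrix_ring_simps(2-) a_assoc)
  show "U \<otimes>\<^bsub>matrix_ring n R\<^esub> V \<otimes>\<^bsub>matrix_ring n R\<^esub> W =
      U \<otimes>\<^bsub>matrix_ring n R\<^esub> (V \<otimes>\<^bsub>matrix_ring n R\<^esub> W)"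
    using matrix_mult_assoc[OF UVW]
    by (intro eq_matI) (auto simp: matrix_ring_simps(2-) matrix_mult_closed[OF UVW(1,2)]
        matrix_mult_closed[OF UVW(2,3)] Pi_def cong: finsum_cong)
  show "(U \<oplus>\<^bsub>matrix_ring n R\<^esub> V) \<otimes>\<^bsub>matrix_ring n R\<^esub> W =
      U \<otimes>\<^bsub>matrix_ring n R\<^esub> W \<oplus>\<^bsub>matrix_ring n R\<^esub> V \<otimes>\<^bsub>matrix_ring n R\<^esub> W"
    by (intro eq_matI) (auto simp: matrix_ring_simps(2-) l_distr finsum_addf Pi_def cong: finsum_cong)
  show "W \<otimes>\<^bsub>matrix_ring n R\<^esub> (U \<oplus>\<^bsub>matrix_ring n R\<^esub> V) =
      W \<otimes>\<^bsub>matrix_ring n R\<^esub> U \<oplus>\<^bsub>matrix_ring n R\<^esub> W \<otimes>\<^bsub>matrix_ring n R\<^esub> V"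
    by (intro eq_matI) (auto simp: matrix_ring_simps(2-) r_distr finsum_addf Pi_def cong: finsum_cong)
next
  fix U V assume UV: "U \<in> carrier (matrix_ring n R)" "V \<in> carrier (matrix_ring n R)"
  note [simp] = UV[THEN matrix_ring_carrierD(4)]
  show "U \<oplus>\<^bsub>matrix_ring n R\<^esub> V \<in> carrier (matrix_ring n R)"
    by (auto simp: matrix_ring_simps)
  show "U \<oplus>\<^bsub>matrix_ring n R\<^esub> V = V \<oplus>\<^bsub>matrix_ring n R\<^esub> U"
    by (intro eq_matI) (auto simp: matrix_ring_simps(2-) a_comm)
  show "U \<otimes>\<^bsub>matrix_ring n R\<^esub> V \<in> carrier (matrix_ring n R)"
    using matrix_mult_closed[OF UV] by (auto simp: matrix_ring_simps)
next
  fix U assume U: "U \<in> carrier (matrix_ring n R)"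
  note [simp] = U[THEN matrix_ring_carrierD(4)]
  show "\<zero>\<^bsub>matrix_ring n R\<^esub> \<oplus>\<^bsub>matrix_ring n R\<^esub> U = U"
    using U by (intro eq_matI) (auto simp: matrix_ring_simps)
  show "\<exists>V\<in>carrier (matrix_ring n R). V \<oplus>\<^bsub>matrix_ring n R\<^esub> U = \<zero>\<^bsub>matrix_ring n R\<^esub>"
    using U by (intro bexI[of _ "map_mat (\<lambda>a. \<ominus> a) U"] eq_matI) (auto simp: matrix_ring_simps l_neg)
  show "\<one>\<^bsub>matrix_ring n R\<^esub> \<otimes>\<^bsub>matrix_ring n R\<^esub> U = U"
  proof (intro eq_matI)
    fix i j assume "i < dim_row U" "j < dim_col U"
    then have ij: "i < n" "j < n" using U by (auto simp: matrix_ring_simps)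
    have "(\<Oplus>k\<in>{..<n}. \<one>\<^bsub>matrix_ring n R\<^esub> $$ (i, k) \<otimes> U $$ (k, j)) =
        (\<Oplus>k\<in>{..<n}. if i = k then U $$ (k, j) else \<zero>)"
      using ij by (intro finsum_cong') (auto simp: matrix_ring_simps)
    then show "(\<one>\<^bsub>matrix_ring n R\<^esub> \<otimes>\<^bsub>matrix_ring n R\<^esub> U) $$ (i, j) = U $$ (i, j)"
      using ij finsum_if_eq[of i n "\<lambda>k. U $$ (k, j)"] by (simp add: matrix_ring_simps(2))
  qed (use U in \<open>auto simp: matrix_ring_simps\<close>)
  show "U \<otimes>\<^bsub>matrix_ring n R\<^esub> \<one>\<^bsub>matrix_ring n R\<^esub> = U"
  proof (intro eq_matI)
    fix i j assume "i < dim_row U" "j < dim_col U"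
    then have ij: "i < n" "j < n" using U by (auto simp: matrix_ring_simps)
    have "(\<Oplus>k\<in>{..<n}. U $$ (i, k) \<otimes> \<one>\<^bsub>matrix_ring n R\<^esub> $$ (k, j)) =
        (\<Oplus>k\<in>{..<n}. if j = k then U $$ (i, k) else \<zero>)"
      using ij by (intro finsum_cong') (auto simp: matrix_ring_simps)
    then show "(U \<otimes>\<^bsub>matrix_ring n R\<^esub> \<one>\<^bsub>matrix_ring n R\<^esub>) $$ (i, j) = U $$ (i, j)"
      using ij finsum_if_eq[of j n "\<lambda>k. U $$ (i, k)"] by (simp add: matrix_ring_simps(2))
  qed (use U in \<open>auto simp: matrix_ring_simps\<close>)
qed (auto simp: matrix_ring_simps)

lemma matrix_a_inv_index:
  assumes "U \<in> carrier (matrix_ring n R)" "i < n" "j < n"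
  shows "(\<ominus>\<^bsub>matrix_ring n R\<^esub> U) $$ (i, j) = \<ominus> (U $$ (i, j))"
proof -
  interpret E: ring "matrix_ring n R" by (rule matrix_ring_ring)
  have "map_mat (\<lambda>a. \<ominus> a) U \<in> carrier (matrix_ring n R)"
    using assms(1) by (auto simp: matrix_ring_simps)
  moreover have "map_mat (\<lambda>a. \<ominus> a) U \<oplus>\<^bsub>matrix_ring n R\<^esub> U = \<zero>\<^bsub>matrix_ring n R\<^esub>"
    using assms(1) by (intro eq_matI) (auto simp: matrix_ring_simps l_neg)
  ultimately have "\<ominus>\<^bsub>matrix_ring n R\<^esub> U = map_mat (\<lambda>a. \<ominus> a) U"
    using assms(1) E.minus_equality by blast
  then show ?thesis using assms matrix_ring_carrierD(2,3)[OF assms(1)] by simp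
qed

lemma matrix_minus_index:
  assumes "U \<in> carrier (matrix_ring n R)" "V \<in> carrier (matrix_ring n R)" "i < n" "j < n"
  shows "(U \<ominus>\<^bsub>matrix_ring n R\<^esub> V) $$ (i, j) = U $$ (i, j) \<ominus> V $$ (i, j)"
proof -
  interpret E: ring "matrix_ring n R" by (rule matrix_ring_ring)
  show ?thesis
    using assms matrix_a_inv_index by (simp add: E.minus_eq minus_eq matrix_ring_simps(5))
qed

lemma matrix_add_pow_index:
  assumes "U \<in> carrier (matrix_ring n R)" "i < n" "j < n"
  shows "([(k::nat)] \<cdot>\<^bsub>matrix_ring n R\<^esub> U) $$ (i, j) = [k] \<cdot> (U $$ (i, j))"
proof -
  interpret E: ring "matrix_ring n R" by (rule matrix_ring_ring)
  show ?thesis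
    using assms by (induction k) (simp_all add: matrix_ring_simps(4,5))
qed

text \<open>The quotient matrix is assembled by choice from quotients of the entries. All p-adic
  questions about matrices thereby become questions about entries.\<close>

lemma p_multiples_matrix_ring:
  "U \<in> p_multiples p (matrix_ring n R) k \<longleftrightarrow>
     U \<in> carrier_mat n n \<and> (\<forall>i<n. \<forall>j<n. U $$ (i, j) \<in> p_multiples p R k)"
proof -
  interpret E: ring "matrix_ring n R" by (rule matrix_ring_ring)
  show ?thesis
  proof
    assume "U \<in> p_multiples p (matrix_ring n R) k"
    then obtain V where V: "V \<in> carrier (matrix_ring n R)" "U = [(p ^ k)] \<cdot>\<^bsub>matrix_ring n R\<^esub> V"
      by (auto simp: p_multiples_def)
    then have "U \<in> carrier (matrix_ring n R)" by simp
    from matrix_ring_carrierD(1)[OF this]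
    show "U \<in> carrier_mat n n \<and> (\<forall>i<n. \<forall>j<n. U $$ (i, j) \<in> p_multiples p R k)"
      using V matrix_ring_carrierD(4)[OF V(1)]
      by (auto simp: matrix_add_pow_index p_multiples_mult_mem)
  next
    assume U: "U \<in> carrier_mat n n \<and> (\<forall>i<n. \<forall>j<n. U $$ (i, j) \<in> p_multiples p R k)"
    then have "\<forall>i j. \<exists>v. i < n \<and> j < n \<longrightarrow> v \<in> carrier R \<and> U $$ (i, j) = [(p ^ k)] \<cdot> v"
      by (auto simp: p_multiples_def)
    then obtain v where v: "\<And>i j. i < n \<Longrightarrow> j < n \<Longrightarrow> v i j \<in> carrier R \<and> U $$ (i, j) = [(p ^ k)] \<cdot> v i j"
      by metis
    define V where "V = mat n n (\<lambda>(i, j). v i j)"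
    have V: "V \<in> carrier (matrix_ring n R)" using v by (auto simp: V_def matrix_ring_simps)
    have "[(p ^ k)] \<cdot>\<^bsub>matrix_ring n R\<^esub> V = U"
    proof (rule matrix_ring_eqI)
      show "U \<in> carrier (matrix_ring n R)"
        using U by (auto intro!: matrix_ring_carrierI p_multiples_carrier)
      show "([(p ^ k)] \<cdot>\<^bsub>matrix_ring n R\<^esub> V) $$ (i, j) = U $$ (i, j)" if "i < n" "j < n" for i j
        using matrix_add_pow_index[OF V that] v[OF that] that by (simp add: V_def)
    qed (use V in simp)
    then show "U \<in> p_multiples p (matrix_ring n R) k" using V p_multiples_mult_mem by metis
  qed
qed

end

lemma (in p_complete_ring) matrix_ring_p_complete: "p_complete_ring (matrix_ring n R) p"
proof -
  interpret E: ring "matrix_ring n R" by (rule matrix_ring_ring)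
  show ?thesis
  proof
    show "1 < p" by (rule p_gt_1)
  next
    fix U assume U: "U \<in> carrier (matrix_ring n R)"
      and z: "[p] \<cdot>\<^bsub>matrix_ring n R\<^esub> U = \<zero>\<^bsub>matrix_ring n R\<^esub>"
    show "U = \<zero>\<^bsub>matrix_ring n R\<^esub>"
    proof (rule matrix_ring_eqI[OF U E.zero_closed])
      fix i j assume ij: "i < n" "j < n"
      then have "[p] \<cdot> (U $$ (i, j)) = \<zero>"
        using matrix_add_pow_index[OF U ij, of p] z by (simp add: matrix_ring_simps(4))
      then have "U $$ (i, j) = \<zero>"
        using p_torsion_free[of "U $$ (i, j)"] matrix_ring_carrierD(4)[OF U ij] by blast
      then show "U $$ (i, j) = \<zero>\<^bsub>matrix_ring n R\<^esub> $$ (i, j)" using ij by (simp add: matrix_ring_simps(4))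
    qed
  next
    fix U assume U: "\<And>k. U \<in> p_multiples p (matrix_ring n R) k"
    show "U = \<zero>\<^bsub>matrix_ring n R\<^esub>"
    proof (rule matrix_ring_eqI[OF E.p_multiples_carrier[OF U] E.zero_closed])
      fix i j assume ij: "i < n" "j < n"
      have "U $$ (i, j) = \<zero>"
        using U ij by (intro p_separated) (auto simp: p_multiples_matrix_ring)
      then show "U $$ (i, j) = \<zero>\<^bsub>matrix_ring n R\<^esub> $$ (i, j)" using ij by (simp add: matrix_ring_simps(4))
    qed
  next
    fix s assume s: "\<And>k::nat. s k \<in> carrier (matrix_ring n R)"
      and d: "\<And>k. s (Suc k) \<ominus>\<^bsub>matrix_ring n R\<^esub> s k \<in> p_multiples p (matrix_ring n R) k"
    have "\<exists>l\<in>carrier R. \<forall>k. l \<ominus> s k $$ (i, j) \<in> p_multiples p R k" if ij: "i < n" "j < n" for i j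
    proof (rule p_complete)
      show "s k $$ (i, j) \<in> carrier R" for k using matrix_ring_carrierD(4)[OF s ij] .
      show "s (Suc k) $$ (i, j) \<ominus> s k $$ (i, j) \<in> p_multiples p R k" for k
        unfolding matrix_minus_index[OF s s ij, symmetric]
        using d[of k] ij by (simp add: p_multiples_matrix_ring)
    qed
    then obtain l where l: "\<And>i j. i < n \<Longrightarrow> j < n \<Longrightarrow>
        l i j \<in> carrier R \<and> (\<forall>k. l i j \<ominus> s k $$ (i, j) \<in> p_multiples p R k)" by metis
    define L where "L = mat n n (\<lambda>(i, j). l i j)"
    have L: "L \<in> carrier (matrix_ring n R)" using l by (auto simp: L_def matrix_ring_simps)
    have "L \<ominus>\<^bsub>matrix_ring n R\<^esub> s k \<in> p_multiples p (matrix_ring n R) k" for k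
      using l E.minus_closed[OF L s[of k]] matrix_minus_index[OF L s[of k]]
      by (auto simp: p_multiples_matrix_ring L_def dest: matrix_ring_carrierD(1))
    with L show "\<exists>L\<in>carrier (matrix_ring n R).
        \<forall>k. L \<ominus>\<^bsub>matrix_ring n R\<^esub> s k \<in> p_multiples p (matrix_ring n R) k" by blast
  qed
qed

lemma (in ring_hom_ring) hom_finsum':
  "f \<in> A \<rightarrow> carrier R \<Longrightarrow> h (\<Oplus>i\<in>A. f i) = (\<Oplus>\<^bsub>S\<^esub>i\<in>A. h (f i))"
  by (induction A rule: infinite_finite_induct) (auto simp: Pi_def)

lemma (in ring_hom_ring) matrix_hom:
  "map_mat h \<in> Ring.ring_hom (matrix_ring n R) (matrix_ring n S)"
proof (rule ring_hom_memI)
  fix U V assume UV: "U \<in> carrier (matrix_ring n R)" "V \<in> carrier (matrix_ring n R)"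
  note [simp] = UV[THEN matrix_ring_carrierD(4)] UV[THEN matrix_ring_carrierD(2)]
    UV[THEN matrix_ring_carrierD(3)]
  show "map_mat h (U \<otimes>\<^bsub>matrix_ring n R\<^esub> V) = map_mat h U \<otimes>\<^bsub>matrix_ring n S\<^esub> map_mat h V"
    by (intro eq_matI) (auto simp: matrix_ring_simps hom_finsum' Pi_def intro!: S.finsum_cong')
  show "map_mat h (U \<oplus>\<^bsub>matrix_ring n R\<^esub> V) = map_mat h U \<oplus>\<^bsub>matrix_ring n S\<^esub> map_mat h V"
    by (intro eq_matI) (auto simp: matrix_ring_simps)
next
  show "map_mat h \<one>\<^bsub>matrix_ring n R\<^esub> = \<one>\<^bsub>matrix_ring n S\<^esub>"
    by (intro eq_matI) (auto simp: matrix_ring_simps)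
qed (auto simp: matrix_ring_simps)

lemma (in ring_hom_ring) matrix_hom_ring:
  "ring_hom_ring (matrix_ring n R) (matrix_ring n S) (map_mat h)"
  using R.matrix_ring_ring S.matrix_ring_ring matrix_hom
  by (simp add: ring_hom_ring_def ring_hom_ring_axioms_def)

context cring
begin

lemma matrix_transpose_mult:
  assumes UV: "U \<in> carrier (matrix_ring n R)" "V \<in> carrier (matrix_ring n R)"
  shows "transpose_mat (U \<otimes>\<^bsub>matrix_ring n R\<^esub> V) =
    transpose_mat V \<otimes>\<^bsub>matrix_ring n R\<^esub> transpose_mat U"
proof -
  note [simp] = UV[THEN matrix_ring_carrierD(4)] UV[THEN matrix_ring_carrierD(2)]
    UV[THEN matrix_ring_carrierD(3)]
  show ?thesis
    by (intro eq_matI) (auto simp: matrix_ring_simps m_comm intro!: finsum_cong')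
qed

lemma matrix_transpose_closed:
  "U \<in> carrier (matrix_ring n R) \<Longrightarrow> transpose_mat U \<in> carrier (matrix_ring n R)"
  by (auto simp: matrix_ring_simps)

lemma matrix_transpose_Units:
  assumes "U \<in> Units (matrix_ring n R)"
  shows "transpose_mat U \<in> Units (matrix_ring n R)"
proof -
  interpret E: ring "matrix_ring n R" by (rule matrix_ring_ring)
  have 1: "transpose_mat \<one>\<^bsub>matrix_ring n R\<^esub> = \<one>\<^bsub>matrix_ring n R\<^esub>"
    by (intro eq_matI) (auto simp: matrix_ring_simps)
  have V: "inv\<^bsub>matrix_ring n R\<^esub> U \<in> carrier (matrix_ring n R)" and U: "U \<in> carrier (matrix_ring n R)"
    using assms by auto
  show ?thesis
    using matrix_transpose_mult[OF U V] matrix_transpose_mult[OF V U]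
      E.Units_l_inv[OF assms] E.Units_r_inv[OF assms] 1
    by (intro E.UnitsI[OF matrix_transpose_closed[OF U] matrix_transpose_closed[OF V]]) metis+
qed

end

text \<open>Turns the entrywise scaling in \<open>matrix_binomial_power\<close> into multiplication
  by a central element of the matrix ring.\<close>

definition scalar_matrix :: "nat \<Rightarrow> ('a, 'm) ring_scheme \<Rightarrow> 'a \<Rightarrow> 'a mat" where
  "scalar_matrix n R a = mat n n (\<lambda>(i, j). if i = j then a else \<zero>\<^bsub>R\<^esub>)"

lemma (in ring) scalar_matrix_mult:
  assumes a: "a \<in> carrier R" and U: "U \<in> carrier (matrix_ring n R)"
  shows "scalar_matrix n R a \<otimes>\<^bsub>matrix_ring n R\<^esub> U = map_mat (\<lambda>b. a \<otimes> b) U"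
proof (intro eq_matI)
  note [simp] = matrix_ring_carrierD(4)[OF U]
  fix i j assume "i < dim_row (map_mat (\<lambda>b. a \<otimes> b) U)" "j < dim_col (map_mat (\<lambda>b. a \<otimes> b) U)"
  then have ij: "i < n" "j < n" using U by (auto simp: matrix_ring_simps)
  have "(\<Oplus>k\<in>{..<n}. scalar_matrix n R a $$ (i, k) \<otimes> U $$ (k, j)) =
      (\<Oplus>k\<in>{..<n}. if i = k then a \<otimes> U $$ (k, j) else \<zero>)"
    using ij a by (intro finsum_cong') (auto simp: scalar_matrix_def)
  then show "(scalar_matrix n R a \<otimes>\<^bsub>matrix_ring n R\<^esub> U) $$ (i, j) = map_mat (\<lambda>b. a \<otimes> b) U $$ (i, j)"
    using ij U finsum_if_eq[of i n "\<lambda>k. a \<otimes> U $$ (k, j)"] a by (simp add: matrix_ring_simps)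
qed (use U in \<open>auto simp: matrix_ring_simps\<close>)

lemma (in cring) scalar_matrix_commute:
  assumes a: "a \<in> carrier R" and U: "U \<in> carrier (matrix_ring n R)"
  shows "scalar_matrix n R a \<otimes>\<^bsub>matrix_ring n R\<^esub> U = U \<otimes>\<^bsub>matrix_ring n R\<^esub> scalar_matrix n R a"
proof -
  note [simp] = matrix_ring_carrierD(4)[OF U]
  have "(U \<otimes>\<^bsub>matrix_ring n R\<^esub> scalar_matrix n R a) $$ (i, j) = a \<otimes> U $$ (i, j)"
    if ij: "i < n" "j < n" for i j
  proof -
    have "(\<Oplus>k\<in>{..<n}. U $$ (i, k) \<otimes> scalar_matrix n R a $$ (k, j)) =
        (\<Oplus>k\<in>{..<n}. if j = k then a \<otimes> U $$ (i, k) else \<zero>)"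
      using ij a by (intro finsum_cong') (auto simp: scalar_matrix_def m_comm)
    then show ?thesis
      using ij finsum_if_eq[of j n "\<lambda>k. a \<otimes> U $$ (i, k)"] a by (simp add: matrix_ring_simps)
  qed
  then show ?thesis
    unfolding scalar_matrix_mult[OF assms] using U by (intro eq_matI) (auto simp: matrix_ring_simps)
qed

lemma (in ring) scalar_matrix_hom: "scalar_matrix n R \<in> Ring.ring_hom R (matrix_ring n R)"
proof (rule ring_hom_memI)
  fix a b assume ab: "a \<in> carrier R" "b \<in> carrier R"
  have "scalar_matrix n R b \<in> carrier (matrix_ring n R)"
    using ab by (auto simp: scalar_matrix_def matrix_ring_simps)
  from scalar_matrix_mult[OF ab(1) this]
  show "scalar_matrix n R (a \<otimes> b) = scalar_matrix n R a \<otimes>\<^bsub>matrix_ring n R\<^esub> scalar_matrix n R b"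
    using ab by (auto simp: scalar_matrix_def intro!: eq_matI)
qed (auto simp: scalar_matrix_def matrix_ring_simps intro!: eq_matI)

section \<open>The $p$-adic completion\<close>

text \<open>A sequence of representatives of a compatible system of cosets. Elements of the
  completion are computed with through such sequences, which are unique only up to multiples of p^k
  in place k.\<close>

definition (in ring) p_coherent :: "nat \<Rightarrow> (nat \<Rightarrow> 'a) \<Rightarrow> bool" where
  "p_coherent p a \<longleftrightarrow> (\<forall>k. a k \<in> carrier R \<and> a (Suc k) \<ominus> a k \<in> p_multiples p R k)"

definition coset_seq :: "nat \<Rightarrow> ('a, 'm) ring_scheme \<Rightarrow> (nat \<Rightarrow> 'a) \<Rightarrow> nat \<Rightarrow> 'a set" where
  "coset_seq p R a = (\<lambda>k. p_power_ideal p R k +>\<^bsub>R\<^esub> a k)"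

lemma to_completion_eq_coset_seq: "to_completion p R a = coset_seq p R (\<lambda>_. a)"
  by (simp add: to_completion_def coset_seq_def)

context ring
begin

lemma p_coherentD:
  "p_coherent p a \<Longrightarrow> a k \<in> carrier R"
  "p_coherent p a \<Longrightarrow> a (Suc k) \<ominus> a k \<in> p_multiples p R k"
  by (simp_all add: p_coherent_def)

lemma p_coherent_const: "a \<in> carrier R \<Longrightarrow> p_coherent p (\<lambda>_. a)"
  by (simp add: p_coherent_def minus_eq r_neg)

lemma p_coherent_add:
  assumes "p_coherent p a" "p_coherent p b"
  shows "p_coherent p (\<lambda>k. a k \<oplus> b k)"
  unfolding p_coherent_def
proof (intro allI conjI)
  fix k
  note [simp] = assms[THEN p_coherentD(1)]
  have "a (Suc k) \<oplus> b (Suc k) \<ominus> (a k \<oplus> b k) = (a (Suc k) \<ominus> a k) \<oplus> (b (Suc k) \<ominus> b k)"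
    using p_coherentD(1)[OF assms(1), of "Suc k"] p_coherentD(1)[OF assms(1), of k]
      p_coherentD(1)[OF assms(2), of "Suc k"] p_coherentD(1)[OF assms(2), of k] by algebra
  then show "a (Suc k) \<oplus> b (Suc k) \<ominus> (a k \<oplus> b k) \<in> p_multiples p R k"
    using assms[THEN p_coherentD(2)] by (simp add: p_multiples_add)
qed (use assms[THEN p_coherentD(1)] in simp)

lemma p_coherent_mult:
  assumes "p_coherent p a" "p_coherent p b"
  shows "p_coherent p (\<lambda>k. a k \<otimes> b k)"
  using assms[THEN p_coherentD(1)] assms[THEN p_coherentD(2)]
  by (simp add: p_coherent_def p_multiples_mult_diff)

lemma p_coherent_uminus:
  assumes "p_coherent p a"
  shows "p_coherent p (\<lambda>k. \<ominus> a k)"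
  unfolding p_coherent_def
proof (intro allI conjI)
  fix k
  have "\<ominus> a (Suc k) \<ominus> (\<ominus> a k) = \<ominus> (a (Suc k) \<ominus> a k)"
    using p_coherentD(1)[OF assms, of "Suc k"] p_coherentD(1)[OF assms, of k] by algebra
  then show "\<ominus> a (Suc k) \<ominus> (\<ominus> a k) \<in> p_multiples p R k"
    using p_coherentD(2)[OF assms] by (simp add: p_multiples_uminus)
qed (use p_coherentD(1)[OF assms] in simp)

lemma p_coherent_add_pow:
  assumes "p_coherent p a"
  shows "p_coherent p (\<lambda>k. [(m::nat)] \<cdot> a k)"
  using p_coherentD[OF assms]
  by (simp add: p_coherent_def add_pow_minus[symmetric] p_multiples_add_pow')

lemma p_coherent_le:
  assumes "p_coherent p a" "i \<le> j"
  shows "a j \<ominus> a i \<in> p_multiples p R i"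
  using assms(2)
proof (induction j rule: dec_induct)
  case base
  then show ?case using p_coherentD(1)[OF assms(1)] by (simp add: minus_eq r_neg)
next
  case (step j)
  have "a (Suc j) \<ominus> a j \<in> p_multiples p R i"
    using p_multiples_antimono[OF step(1) p_coherentD(2)[OF assms(1)]] .
  from p_multiples_minus_trans[OF this step(3)] show ?case
    using p_coherentD(1)[OF assms(1)] by blast
qed

end

context cring
begin

lemma p_power_ideal_ideal: "ideal (p_power_ideal p R k) R"
  unfolding p_power_ideal_def by (intro cgenideal_ideal) simp

lemma coset_eq_iff:
  assumes "a \<in> carrier R" "b \<in> carrier R"
  shows "p_power_ideal p R k +> a = p_power_ideal p R k +> b \<longleftrightarrow> a \<ominus> b \<in> p_multiples p R k"
  using quotient_eq_iff_same_a_r_cos[OF p_power_ideal_ideal assms, of p k]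
  by (simp add: p_power_ideal_eq_p_multiples)

lemma coset_seq_eq_iff:
  assumes "p_coherent p a" "p_coherent p b"
  shows "coset_seq p R a = coset_seq p R b \<longleftrightarrow> (\<forall>k. a k \<ominus> b k \<in> p_multiples p R k)"
  using assms by (simp add: coset_seq_def fun_eq_iff coset_eq_iff p_coherentD)

text \<open>Choose a representative of each coset. The inclusion
  \<open>f (Suc k) \<subseteq> f k\<close> puts the representative \<open>a (Suc k)\<close> into the
  coset of \<open>a k\<close>, which is coherence; conversely, coherence makes the cosets
  nested.\<close>

lemma p_completion_carrier:
  "f \<in> carrier (p_completion p R) \<longleftrightarrow> (\<exists>a. p_coherent p a \<and> f = coset_seq p R a)"
proof
  assume f: "f \<in> carrier (p_completion p R)"
  have "\<exists>a\<in>carrier R. f k = p_power_ideal p R k +> a" for k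
    using f by (auto simp: p_completion_def FactRing_def A_RCOSETS_defs a_r_coset_def)
  then obtain a where a: "\<And>k. a k \<in> carrier R" "\<And>k. f k = p_power_ideal p R k +> a k" by metis
  have "a (Suc k) \<ominus> a k \<in> p_multiples p R k" for k
  proof -
    interpret I: ideal "p_power_ideal p R k" R by (rule p_power_ideal_ideal)
    interpret J: ideal "p_power_ideal p R (Suc k)" R by (rule p_power_ideal_ideal)
    have "a (Suc k) \<in> f (Suc k)" using a J.a_rcos_self by simp
    then have "a (Suc k) \<in> p_power_ideal p R k +> a k"
      using f a(2)[of k] by (auto simp: p_completion_def)
    then show ?thesis using a I.a_rcos_module_minus[OF ring_axioms]
      by (simp add: p_power_ideal_eq_p_multiples)
  qed
  then have "p_coherent p a" using a(1) by (simp add: p_coherent_def)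
  moreover have "f = coset_seq p R a" using a(2) by (auto simp: coset_seq_def)
  ultimately show "\<exists>a. p_coherent p a \<and> f = coset_seq p R a" by blast
next
  assume "\<exists>a. p_coherent p a \<and> f = coset_seq p R a"
  then obtain a where a: "p_coherent p a" and f: "f = coset_seq p R a" by blast
  have "f k \<in> carrier (R Quot p_power_ideal p R k)" for k
    using p_coherentD(1)[OF a, of k] f
    by (auto simp: coset_seq_def FactRing_def A_RCOSETS_defs a_r_coset_def)
  moreover have "f (Suc k) \<subseteq> f k" for k
  proof -
    have "p_power_ideal p R (Suc k) \<subseteq> p_power_ideal p R k"
      using p_multiples_antimono[of k "Suc k"] by (auto simp: p_power_ideal_eq_p_multiples)
    then have "f (Suc k) \<subseteq> p_power_ideal p R k +> a (Suc k)"
      by (auto simp: f coset_seq_def a_r_coset_def')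
    also have "\<dots> = f k"
      using p_coherentD[OF a] by (simp add: f coset_seq_def coset_eq_iff)
    finally show ?thesis .
  qed
  ultimately show "f \<in> carrier (p_completion p R)" by (simp add: p_completion_def)
qed

lemma coset_seq_closed: "p_coherent p a \<Longrightarrow> coset_seq p R a \<in> carrier (p_completion p R)"
  using p_completion_carrier by blast

lemma p_completionE:
  assumes "f \<in> carrier (p_completion p R)"
  obtains a where "p_coherent p a" "f = coset_seq p R a"
  using assms p_completion_carrier by blast

lemma coset_seq_add:
  assumes "p_coherent p a" "p_coherent p b"
  shows "coset_seq p R a \<oplus>\<^bsub>p_completion p R\<^esub> coset_seq p R b = coset_seq p R (\<lambda>k. a k \<oplus> b k)"
  using assms ideal.a_rcos_sum[OF p_power_ideal_ideal]
  by (simp add: p_completion_def coset_seq_def fun_eq_iff FactRing_def p_coherentD)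

lemma coset_seq_mult:
  assumes "p_coherent p a" "p_coherent p b"
  shows "coset_seq p R a \<otimes>\<^bsub>p_completion p R\<^esub> coset_seq p R b = coset_seq p R (\<lambda>k. a k \<otimes> b k)"
  using assms ideal.rcoset_mult_add[OF p_power_ideal_ideal]
  by (simp add: p_completion_def coset_seq_def fun_eq_iff FactRing_def p_coherentD)

lemma coset_seq_one: "\<one>\<^bsub>p_completion p R\<^esub> = coset_seq p R (\<lambda>_. \<one>)"
  by (simp add: p_completion_def coset_seq_def FactRing_def)

lemma coset_seq_zero: "\<zero>\<^bsub>p_completion p R\<^esub> = coset_seq p R (\<lambda>_. \<zero>)"
  using ideal.Icarr[OF p_power_ideal_ideal]
  by (simp add: p_completion_def coset_seq_def FactRing_def fun_eq_iff a_coset_add_zero subsetI)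

lemma p_completion_cring: "cring (p_completion p R)"
proof (intro cringI abelian_groupI comm_monoidI)
  let ?C = "p_completion p R"
  fix f g h assume "f \<in> carrier ?C" "g \<in> carrier ?C" "h \<in> carrier ?C"
  then obtain a b c where a: "p_coherent p a" "f = coset_seq p R a"
    and b: "p_coherent p b" "g = coset_seq p R b" and c: "p_coherent p c" "h = coset_seq p R c"
    by (metis p_completionE)
  note [simp] = a b c coset_seq_add coset_seq_mult p_coherent_add p_coherent_mult
    a(1)[THEN p_coherentD(1)] b(1)[THEN p_coherentD(1)] c(1)[THEN p_coherentD(1)]
  show "f \<oplus>\<^bsub>?C\<^esub> g \<oplus>\<^bsub>?C\<^esub> h = f \<oplus>\<^bsub>?C\<^esub> (g \<oplus>\<^bsub>?C\<^esub> h)" by (simp add: a_assoc)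
  show "f \<otimes>\<^bsub>?C\<^esub> g \<otimes>\<^bsub>?C\<^esub> h = f \<otimes>\<^bsub>?C\<^esub> (g \<otimes>\<^bsub>?C\<^esub> h)" by (simp add: m_assoc)
  show "(f \<oplus>\<^bsub>?C\<^esub> g) \<otimes>\<^bsub>?C\<^esub> h = f \<otimes>\<^bsub>?C\<^esub> h \<oplus>\<^bsub>?C\<^esub> g \<otimes>\<^bsub>?C\<^esub> h" by (simp add: l_distr)
next
  let ?C = "p_completion p R"
  fix f g assume "f \<in> carrier ?C" "g \<in> carrier ?C"
  then obtain a b where a: "p_coherent p a" "f = coset_seq p R a"
    and b: "p_coherent p b" "g = coset_seq p R b" by (metis p_completionE)
  note [simp] = a b coset_seq_add coset_seq_mult p_coherent_add p_coherent_mult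
    a(1)[THEN p_coherentD(1)] b(1)[THEN p_coherentD(1)] coset_seq_closed
  show "f \<oplus>\<^bsub>?C\<^esub> g = g \<oplus>\<^bsub>?C\<^esub> f" by (simp add: a_comm)
  show "f \<otimes>\<^bsub>?C\<^esub> g = g \<otimes>\<^bsub>?C\<^esub> f" by (simp add: m_comm)
  show "f \<oplus>\<^bsub>?C\<^esub> g \<in> carrier ?C" "f \<otimes>\<^bsub>?C\<^esub> g \<in> carrier ?C" by simp_all
next
  let ?C = "p_completion p R"
  fix f assume "f \<in> carrier ?C"
  then obtain a where a: "p_coherent p a" "f = coset_seq p R a" by (metis p_completionE)
  note [simp] = a coset_seq_add coset_seq_mult coset_seq_one coset_seq_zero p_coherent_const
    p_coherentD(1)[OF a(1)]
  show "\<one>\<^bsub>?C\<^esub> \<otimes>\<^bsub>?C\<^esub> f = f" "\<zero>\<^bsub>?C\<^esub> \<oplus>\<^bsub>?C\<^esub> f = f" by simp_all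
  show "\<exists>g\<in>carrier ?C. g \<oplus>\<^bsub>?C\<^esub> f = \<zero>\<^bsub>?C\<^esub>"
    using p_coherent_uminus[OF a(1)]
    by (intro bexI[of _ "coset_seq p R (\<lambda>k. \<ominus> a k)"] coset_seq_closed) (simp_all add: l_neg)
next
  show "\<one>\<^bsub>p_completion p R\<^esub> \<in> carrier (p_completion p R)"
    "\<zero>\<^bsub>p_completion p R\<^esub> \<in> carrier (p_completion p R)"
    by (simp_all add: coset_seq_one coset_seq_zero coset_seq_closed p_coherent_const)
qed

lemma coset_seq_uminus:
  assumes "p_coherent p a"
  shows "\<ominus>\<^bsub>p_completion p R\<^esub> coset_seq p R a = coset_seq p R (\<lambda>k. \<ominus> a k)"
proof -
  interpret C: cring "p_completion p R" by (rule p_completion_cring)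
  show ?thesis
    using assms p_coherent_uminus[OF assms] p_coherentD(1)[OF assms]
    by (intro C.minus_equality) (simp_all add: coset_seq_closed coset_seq_add coset_seq_zero l_neg)
qed

lemma coset_seq_minus:
  assumes "p_coherent p a" "p_coherent p b"
  shows "coset_seq p R a \<ominus>\<^bsub>p_completion p R\<^esub> coset_seq p R b = coset_seq p R (\<lambda>k. a k \<ominus> b k)"
  using assms by (simp add: a_minus_def coset_seq_uminus coset_seq_add p_coherent_uminus)

lemma coset_seq_add_pow:
  assumes "p_coherent p a"
  shows "[(m::nat)] \<cdot>\<^bsub>p_completion p R\<^esub> coset_seq p R a = coset_seq p R (\<lambda>k. [m] \<cdot> a k)"
proof -
  interpret C: cring "p_completion p R" by (rule p_completion_cring)
  show ?thesis
    using assms by (induction m)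
      (simp_all add: coset_seq_zero coset_seq_add p_coherent_add_pow)
qed

lemma to_completion_hom: "to_completion p R \<in> Ring.ring_hom R (p_completion p R)"
  by (rule ring_hom_memI)
    (simp_all add: to_completion_eq_coset_seq coset_seq_closed p_coherent_const coset_seq_one
      coset_seq_add coset_seq_mult)

lemma to_completion_eq_iff:
  "a \<in> carrier R \<Longrightarrow> b \<in> carrier R \<Longrightarrow>
    to_completion p R a = to_completion p R b \<longleftrightarrow> (\<forall>k. a \<ominus> b \<in> p_multiples p R k)"
  by (simp add: to_completion_eq_coset_seq coset_seq_eq_iff p_coherent_const)

end

locale p_torsion_free_cring = p_torsion_free_ring + cring
begin

text \<open>Divisibility by p^k in the completion is decided by the k-th representative alone. If
  \<open>a k\<close> is divisible by p^k, so are all later representatives, and their quotients form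
  a coherent sequence because p is not a zero divisor.\<close>

lemma coset_seq_p_multiples:
  assumes a: "p_coherent p a"
  shows "coset_seq p R a \<in> p_multiples p (p_completion p R) k \<longleftrightarrow> a k \<in> p_multiples p R k"
proof
  assume "coset_seq p R a \<in> p_multiples p (p_completion p R) k"
  then obtain b where b: "p_coherent p b"
    "coset_seq p R a = [(p ^ k)] \<cdot>\<^bsub>p_completion p R\<^esub> coset_seq p R b"
    unfolding p_multiples_def image_iff using p_completionE by metis
  then have d: "a k \<ominus> [(p ^ k)] \<cdot> b k \<in> p_multiples p R k"
    using coset_seq_eq_iff[OF a p_coherent_add_pow[OF b(1)]] by (simp add: coset_seq_add_pow)
  have c: "a k \<in> carrier R" "b k \<in> carrier R" using p_coherentD(1) a b(1) by auto
  have "a k = (a k \<ominus> [(p ^ k)] \<cdot> b k) \<oplus> [(p ^ k)] \<cdot> b k"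
    using c by (simp add: minus_eq a_assoc l_neg)
  then show "a k \<in> p_multiples p R k"
    using p_multiples_add[OF d p_multiples_mult_mem[OF c(2)]] by simp
next
  assume ak: "a k \<in> p_multiples p R k"
  have "a (k + j) \<in> p_multiples p R k" for j
  proof -
    have "a (k + j) = (a (k + j) \<ominus> a k) \<oplus> a k"
      using p_coherentD(1)[OF a] by (simp add: minus_eq a_assoc l_neg)
    then show ?thesis using p_multiples_add[OF p_coherent_le[OF a, of k "k + j"] ak] by simp
  qed
  then have "\<forall>j. \<exists>b\<in>carrier R. a (k + j) = [(p ^ k)] \<cdot> b"
    unfolding p_multiples_def by blast
  \<comment> \<open>Division by p^k weakens a congruence by k powers of p, so place j of the
    quotient has to come from place k + j of \<open>a\<close>.\<close>
  then obtain b where b: "\<And>j. b j \<in> carrier R" "\<And>j. a (k + j) = [(p ^ k)] \<cdot> b j" by metis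
  have coh: "p_coherent p b"
    unfolding p_coherent_def
  proof (intro allI conjI b(1))
    fix j
    have "[(p ^ k)] \<cdot> (b (Suc j) \<ominus> b j) = a (Suc (k + j)) \<ominus> a (k + j)"
      using b(2)[of j] b(2)[of "Suc j"] add_pow_minus[OF b(1)[of "Suc j"] b(1)[of j], of "p ^ k"]
      by (simp only: add_Suc_right)
    then show "b (Suc j) \<ominus> b j \<in> p_multiples p R j"
      using p_coherentD(2)[OF a, of "k + j"] b(1)
        p_multiples_cancel[of "b (Suc j) \<ominus> b j" k j]
      by simp
  qed
  \<comment> \<open>Multiplying back gives the shifted sequence, which defines the same element
    since places k + j and j of \<open>a\<close> agree modulo p^j.\<close>
  have "[(p ^ k)] \<cdot>\<^bsub>p_completion p R\<^esub> coset_seq p R b = coset_seq p R a"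
    unfolding coset_seq_add_pow[OF coh] coset_seq_eq_iff[OF p_coherent_add_pow[OF coh] a]
    using p_coherent_le[OF a] by (simp add: b(2)[symmetric])
  then show "coset_seq p R a \<in> p_multiples p (p_completion p R) k"
    using p_multiples_mult_mem[OF coset_seq_closed[OF coh], of p k] by simp
qed

lemma coset_seq_eq_zero_iff:
  assumes "p_coherent p a"
  shows "coset_seq p R a = \<zero>\<^bsub>p_completion p R\<^esub> \<longleftrightarrow> (\<forall>k. a k \<in> p_multiples p R k)"
  using assms p_coherentD(1)[OF assms]
  by (simp add: coset_seq_zero coset_seq_eq_iff p_coherent_const minus_eq)

lemma p_completion_p_complete: "p_complete_ring (p_completion p R) p"
proof -
  interpret C: cring "p_completion p R" by (rule p_completion_cring)
  show ?thesis
  proof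
    show "1 < p" by (rule p_gt_1)
  next
    fix f assume f: "f \<in> carrier (p_completion p R)" and z: "[p] \<cdot>\<^bsub>p_completion p R\<^esub> f = \<zero>\<^bsub>p_completion p R\<^esub>"
    obtain a where a: "p_coherent p a" "f = coset_seq p R a" using f by (rule p_completionE)
    have *: "[p] \<cdot> a k \<in> p_multiples p R k" for k
      using z coset_seq_eq_zero_iff[OF p_coherent_add_pow[OF a(1)]] a
      by (simp add: coset_seq_add_pow)
    \<comment> \<open>Cancelling p costs one power, so the argument runs at place k+1 and returns to
      place k by coherence.\<close>
    have "a k \<in> p_multiples p R k" for k
    proof -
      have "a (Suc k) \<in> p_multiples p R k"
        using *[of "Suc k"] p_coherentD(1)[OF a(1)] p_multiples_cancel[of "a (Suc k)" 1 k]
        by simp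
      moreover have "a k = a (Suc k) \<ominus> (a (Suc k) \<ominus> a k)"
        using p_coherentD(1)[OF a(1), of k] p_coherentD(1)[OF a(1), of "Suc k"] by algebra
      ultimately show ?thesis
        using p_multiples_minus[of "a (Suc k)" p k, OF _ p_coherentD(2)[OF a(1), of k]] by simp
    qed
    then show "f = \<zero>\<^bsub>p_completion p R\<^esub>" using a coset_seq_eq_zero_iff by blast
  next
    fix f assume f: "\<And>k. f \<in> p_multiples p (p_completion p R) k"
    obtain a where a: "p_coherent p a" "f = coset_seq p R a"
      using C.p_multiples_carrier[OF f] by (rule p_completionE)
    then show "f = \<zero>\<^bsub>p_completion p R\<^esub>"
      using f coset_seq_p_multiples coset_seq_eq_zero_iff by blast
  next
    fix s assume s: "\<And>k. s k \<in> carrier (p_completion p R)"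
      and d: "\<And>k. s (Suc k) \<ominus>\<^bsub>p_completion p R\<^esub> s k \<in> p_multiples p (p_completion p R) k"
    have "\<forall>k. \<exists>a. p_coherent p a \<and> s k = coset_seq p R a"
      using s p_completion_carrier by blast
    then obtain a where a: "\<And>k. p_coherent p (a k)" "\<And>k. s k = coset_seq p R (a k)" by metis
    have m: "p_coherent p (\<lambda>i. a j i \<ominus> a k i)" for j k
      using p_coherent_add[OF a(1) p_coherent_uminus[OF a(1)]] by (simp add: minus_eq)
    \<comment> \<open>The limit is the diagonal of the representatives: place k of the k-th term is
      all that matters modulo p^k.\<close>
    define l where "l k = a k k" for k
    have l: "p_coherent p l"
      unfolding p_coherent_def
    proof (intro allI conjI)
      fix k
      have "a (Suc k) k \<ominus> a k k \<in> p_multiples p R k"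
        using d[of k] coset_seq_p_multiples[OF m] by (simp add: a coset_seq_minus)
      then have "a (Suc k) (Suc k) \<ominus> a k k \<in> p_multiples p R k"
        using p_multiples_minus_trans[OF p_coherentD(2)[OF a(1)]] p_coherentD(1)[OF a(1)] by blast
      then show "l (Suc k) \<ominus> l k \<in> p_multiples p R k" by (simp add: l_def)
    qed (simp add: l_def p_coherentD(1)[OF a(1)])
    have "coset_seq p R l \<ominus>\<^bsub>p_completion p R\<^esub> s k \<in> p_multiples p (p_completion p R) k" for k
    proof -
      have c: "p_coherent p (\<lambda>i. l i \<ominus> a k i)"
        using p_coherent_add[OF l p_coherent_uminus[OF a(1)]] by (simp add: minus_eq)
      have "l k \<ominus> a k k = \<zero>" using p_coherentD(1)[OF a(1)] by (simp add: l_def minus_eq r_neg)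
      then show ?thesis using coset_seq_p_multiples[OF c, of k] l a by (simp add: coset_seq_minus)
    qed
    then show "\<exists>f\<in>carrier (p_completion p R). \<forall>k. f \<ominus>\<^bsub>p_completion p R\<^esub> s k
        \<in> p_multiples p (p_completion p R) k"
      using coset_seq_closed[OF l] by blast
  qed
qed

lemma to_completion_dense:
  assumes "f \<in> carrier (p_completion p R)"
  shows "\<exists>a\<in>carrier R. f \<ominus>\<^bsub>p_completion p R\<^esub> to_completion p R a \<in> p_multiples p (p_completion p R) k"
proof -
  obtain a where a: "p_coherent p a" "f = coset_seq p R a" using assms by (rule p_completionE)
  have ak: "a k \<in> carrier R" using p_coherentD(1)[OF a(1)] .
  have c: "p_coherent p (\<lambda>i. a i \<ominus> a k)"
    using p_coherent_add[OF a(1) p_coherent_uminus[OF p_coherent_const[OF ak]]] by (simp add: minus_eq)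
  have "f \<ominus>\<^bsub>p_completion p R\<^esub> to_completion p R (a k) \<in> p_multiples p (p_completion p R) k"
    using coset_seq_p_multiples[OF c, of k] ak a
    by (simp add: to_completion_eq_coset_seq coset_seq_minus p_coherent_const minus_eq r_neg)
  with ak show ?thesis by blast
qed

text \<open>The image of \<open>R\<close> is dense, homomorphisms preserve multiples of p^k, and the
  target is separated. Thus the two values differ by a multiple of every p^k.\<close>

lemma completion_hom_eqI:
  assumes "h \<in> Ring.ring_hom (p_completion p R) T" "h' \<in> Ring.ring_hom (p_completion p R) T"
    and "p_complete_ring T p"
    and eq: "\<And>a. a \<in> carrier R \<Longrightarrow> h (to_completion p R a) = h' (to_completion p R a)"
    and f: "f \<in> carrier (p_completion p R)"
  shows "h f = h' f"
proof -
  interpret C: cring "p_completion p R" by (rule p_completion_cring)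
  interpret T: p_complete_ring T p by fact
  interpret h: ring_hom_ring "p_completion p R" T h
    using C.ring_axioms T.ring_axioms assms(1) by (simp add: ring_hom_ring_def ring_hom_ring_axioms_def)
  interpret h': ring_hom_ring "p_completion p R" T h'
    using C.ring_axioms T.ring_axioms assms(2) by (simp add: ring_hom_ring_def ring_hom_ring_axioms_def)
  show ?thesis
  proof (rule T.p_separated_eq)
    fix k
    obtain a where a: "a \<in> carrier R"
      "f \<ominus>\<^bsub>p_completion p R\<^esub> to_completion p R a \<in> p_multiples p (p_completion p R) k"
      using to_completion_dense[OF f] by blast
    let ?a = "to_completion p R a"
    have c: "?a \<in> carrier (p_completion p R)" using ring_hom_closed[OF to_completion_hom a(1)] .
    have "h f \<ominus>\<^bsub>T\<^esub> h ?a \<in> p_multiples p T k" "h' f \<ominus>\<^bsub>T\<^esub> h' ?a \<in> p_multiples p T k"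
      using h.hom_p_multiples[OF a(2)] h'.hom_p_multiples[OF a(2)] f c by simp_all
    then show "h f \<ominus>\<^bsub>T\<^esub> h' f \<in> p_multiples p T k"
      using T.p_multiples_minus_trans T.p_multiples_minus_commute h.hom_closed h'.hom_closed f c
        eq[OF a(1)] by metis
  qed (use f in auto)
qed

end

section \<open>Functoriality of the completion\<close>

lemma (in ring_hom_cring) completion_map_coset_seq:
  assumes "R.p_coherent p a"
  shows "S.p_coherent p (\<lambda>k. h (a k))"
    "completion_map p S h (coset_seq p R a) = coset_seq p S (\<lambda>k. h (a k))"
proof -
  have a: "a k \<in> carrier R" for k using R.p_coherentD(1)[OF assms] .
  show "S.p_coherent p (\<lambda>k. h (a k))"
    unfolding S.p_coherent_def
    using a ring.hom_p_multiples[OF R.p_coherentD(2)[OF assms]] by simp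
  show "completion_map p S h (coset_seq p R a) = coset_seq p S (\<lambda>k. h (a k))"
  proof
    fix k
    have "p_multiples p S k <+>\<^bsub>S\<^esub> h ` (p_multiples p R k +> a k) = p_multiples p S k +>\<^bsub>S\<^esub> h (a k)"
    proof (intro equalityI subsetI)
      fix x assume "x \<in> p_multiples p S k <+>\<^bsub>S\<^esub> h ` (p_multiples p R k +> a k)"
      then obtain i j where i: "i \<in> p_multiples p S k" and j: "j \<in> p_multiples p R k"
        and x: "x = i \<oplus>\<^bsub>S\<^esub> h (j \<oplus> a k)"
        by (auto simp: set_add_defs a_r_coset_def')
      have "x = (i \<oplus>\<^bsub>S\<^esub> h j) \<oplus>\<^bsub>S\<^esub> h (a k)"
        using x a S.p_multiples_carrier[OF i] R.p_multiples_carrier[OF j] by (simp add: S.a_assoc)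
      then show "x \<in> p_multiples p S k +>\<^bsub>S\<^esub> h (a k)"
        using S.p_multiples_add[OF i ring.hom_p_multiples[OF j]] by (auto simp: a_r_coset_def')
    next
      fix x assume "x \<in> p_multiples p S k +>\<^bsub>S\<^esub> h (a k)"
      then obtain i where i: "i \<in> p_multiples p S k" and x: "x = i \<oplus>\<^bsub>S\<^esub> h (a k)"
        by (auto simp: a_r_coset_def')
      have "a k \<in> p_multiples p R k +> a k"
        using a by (auto simp: a_r_coset_def' intro!: bexI[of _ "\<zero>"])
      then show "x \<in> p_multiples p S k <+>\<^bsub>S\<^esub> h ` (p_multiples p R k +> a k)"
        using i x by (auto simp: set_add_defs)
    qed
    then show "completion_map p S h (coset_seq p R a) k = coset_seq p S (\<lambda>k. h (a k)) k"
      by (simp add: completion_map_def coset_seq_def R.p_power_ideal_eq_p_multiples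
          S.p_power_ideal_eq_p_multiples)
  qed
qed

lemma (in ring_hom_cring) completion_map_hom:
  "completion_map p S h \<in> Ring.ring_hom (p_completion p R) (p_completion p S)"
proof (rule ring_hom_memI)
  fix f g assume "f \<in> carrier (p_completion p R)" "g \<in> carrier (p_completion p R)"
  then obtain a b where a: "R.p_coherent p a" "f = coset_seq p R a"
    and b: "R.p_coherent p b" "g = coset_seq p R b" by (metis R.p_completionE)
  note [simp] = a b R.coset_seq_add R.coset_seq_mult R.p_coherent_add R.p_coherent_mult
    completion_map_coset_seq S.coset_seq_add S.coset_seq_mult
    R.p_coherentD(1)[OF a(1)] R.p_coherentD(1)[OF b(1)]
  show "completion_map p S h (f \<otimes>\<^bsub>p_completion p R\<^esub> g) =
      completion_map p S h f \<otimes>\<^bsub>p_completion p S\<^esub> completion_map p S h g" by simp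
  show "completion_map p S h (f \<oplus>\<^bsub>p_completion p R\<^esub> g) =
      completion_map p S h f \<oplus>\<^bsub>p_completion p S\<^esub> completion_map p S h g" by simp
next
  fix f assume "f \<in> carrier (p_completion p R)"
  then obtain a where "R.p_coherent p a" "f = coset_seq p R a" by (rule R.p_completionE)
  then show "completion_map p S h f \<in> carrier (p_completion p S)"
    by (simp add: completion_map_coset_seq S.coset_seq_closed)
next
  show "completion_map p S h \<one>\<^bsub>p_completion p R\<^esub> = \<one>\<^bsub>p_completion p S\<^esub>"
    by (simp add: R.coset_seq_one S.coset_seq_one completion_map_coset_seq R.p_coherent_const)
qed

lemma (in ring_hom_cring) completion_map_to_completion:
  "a \<in> carrier R \<Longrightarrow> completion_map p S h (to_completion p R a) = to_completion p S (h a)"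
  by (simp add: to_completion_eq_coset_seq completion_map_coset_seq R.p_coherent_const)

section \<open>Square roots of matrices\<close>

text \<open>Shows that the coefficients for the exponent -1/2 lie in Z[1/2], since central binomial
  coefficients are integers.\<close>

lemma gbinomial_minus_half:
  "((-1/2 :: 'a :: field_char_0) gchoose k) = (-1/4) ^ k * of_nat ((2 * k) choose k)"
proof (induction k)
  case (Suc k)
  let ?a = "-1/2 :: 'a"
  \<comment> \<open>Two applications of the absorption identity lead to (k+1) C(2k+2, k+1) = 2
    (2k+1) C(2k, k); the extra factor \<open>Suc k\<close> keeps the computation in the natural
    numbers and is cancelled afterwards.\<close>
  have "((2 * Suc k) choose Suc k) * Suc k * Suc k = 2 * Suc k * (((2 * k + 1) choose k) * Suc k)"
    using Suc_times_binomial_eq[of "2 * k + 1" k] by (simp add: algebra_simps)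
  also have "((2 * k + 1) choose k) * Suc k = Suc (2 * k) * ((2 * k) choose k)"
    using Suc_times_binomial_eq[of "2 * k" k] binomial_symmetric[of k "2 * k + 1"]
    by (simp add: mult_2)
  finally have "(((2 * Suc k) choose Suc k) * Suc k) * Suc k = (2 * (Suc (2 * k) * ((2 * k) choose k))) * Suc k"
    by (simp only: mult_ac)
  then have "((2 * Suc k) choose Suc k) * Suc k = 2 * (Suc (2 * k) * ((2 * k) choose k))"
    unfolding mult_cancel2 by simp
  from arg_cong[OF this, of "of_nat :: nat \<Rightarrow> 'a"]
  have c: "of_nat ((2 * Suc k) choose Suc k) * of_nat (Suc k) =
      (2 * (2 * of_nat k + 1) * of_nat ((2 * k) choose k) :: 'a)"
    by (simp only: of_nat_mult of_nat_Suc of_nat_numeral mult_ac add_ac)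
  have "of_nat (Suc k) * (?a gchoose Suc k) = (?a - of_nat k) * (?a gchoose k)"
    using gbinomial_mult_1[of ?a k] by (simp add: algebra_simps)
  also have "\<dots> = (-1/4) ^ Suc k * (2 * (2 * of_nat k + 1) * of_nat ((2 * k) choose k))"
    unfolding Suc by (simp add: field_simps)
  also have "\<dots> = of_nat (Suc k) * ((-1/4) ^ Suc k * of_nat ((2 * Suc k) choose Suc k))"
    by (subst c[symmetric]) (simp only: mult_ac)
  finally show ?case by (metis mult_left_cancel of_nat_neq_0)
qed simp

text \<open>\<open>S\<close> is the ring of complex coefficients and \<open>c\<close> carries them
  into the ring of matrix entries. The instances are the completed base ring and the completed
  coordinate ring.\<close>

locale matrix_binomial = p_complete_ring R p + cring R for R (structure) and p +
  fixes S :: "complex set" and c :: "complex \<Rightarrow> 'a" and n :: nat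
  assumes S_subring: "subring S class_ring" and half_S: "1/2 \<in> S"
    and c_hom: "c \<in> Ring.ring_hom (class_ring\<lparr>carrier := S\<rparr>) R"
begin

sublocale E: central_coefficients "matrix_ring n R" p S "\<lambda>s. scalar_matrix n R (c s)"
proof -
  interpret E: p_complete_ring "matrix_ring n R" p by (rule matrix_ring_p_complete)
  have "scalar_matrix n R \<circ> c \<in> Ring.ring_hom (class_ring\<lparr>carrier := S\<rparr>) (matrix_ring n R)"
    by (rule ring_hom_trans[OF c_hom scalar_matrix_hom])
  then show "central_coefficients (matrix_ring n R) p S (\<lambda>s. scalar_matrix n R (c s))"
  proof (intro central_coefficients.intro central_coefficients_axioms.intro)
    show "scalar_matrix n R (c s) \<otimes>\<^bsub>matrix_ring n R\<^esub> U =
        U \<otimes>\<^bsub>matrix_ring n R\<^esub> scalar_matrix n R (c s)"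
      if "s \<in> S" "U \<in> carrier (matrix_ring n R)" for s U
      using that ring_hom_closed[OF c_hom, of s] by (simp add: scalar_matrix_commute)
  qed (use S_subring E.p_complete_ring_axioms in \<open>simp_all add: o_def\<close>)
qed

lemma minus_half_gbinomial_S: "(-1/2 gchoose k) \<in> S"
proof -
  have S: "a \<in> S \<Longrightarrow> b \<in> S \<Longrightarrow> a * b \<in> S" "a \<in> S \<Longrightarrow> b \<in> S \<Longrightarrow> a + b \<in> S"
    "a \<in> S \<Longrightarrow> - a \<in> S" "0 \<in> S" "1 \<in> S" for a b
    using E.S_closed subringE(5)[OF S_subring, of a] by (simp_all add: class_ring_simps)
  have "of_nat m \<in> S" for m by (induction m) (auto intro: S)
  moreover have "-1/4 \<in> S" using S(1)[OF half_S S(3)[OF half_S]] by simp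
  then have "(-1/4) ^ m \<in> S" for m
    by (induction m) (simp_all only: power_Suc power_0 S)
  ultimately show ?thesis unfolding gbinomial_minus_half by (intro S)
qed

text \<open>The exponent 1/2 is reduced to -1/2 by Pascal's rule, and the integral exponents are
  sums of two of these, hence covered by Vandermonde's identity. The five exponents are -1/2 and 1/2
  together with their pairwise sums.\<close>

lemma gbinomial_S:
  assumes "s \<in> {-1, -1/2, 0, 1/2, 1}"
  shows "range ((gchoose) s) \<subseteq> S"
proof -
  have half: "(1/2 gchoose k) \<in> S" for k
  proof (cases k)
    case (Suc m)
    have "(1/2 gchoose Suc m) = (-1/2 gchoose m) + (-1/2 gchoose Suc m :: complex)"
      using gbinomial_Suc_Suc[of "-1/2 :: complex" m] by simp
    then show ?thesis using Suc minus_half_gbinomial_S E.S_closed(3) by metis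
  qed (simp add: E.S_closed)
  have sum: "range ((gchoose) (a + b)) \<subseteq> S"
    if "\<And>k. (a gchoose k) \<in> S" "\<And>k. (b gchoose k) \<in> S" for a b
    using that gbinomial_Vandermonde[of a b]
    by (auto simp flip: gbinomial_Vandermonde intro!: E.S_sum E.S_closed(4))
  have "range ((gchoose) (-1)) \<subseteq> S" "range ((gchoose) 0) \<subseteq> S" "range ((gchoose) 1) \<subseteq> S"
    using sum[OF minus_half_gbinomial_S minus_half_gbinomial_S] sum[OF minus_half_gbinomial_S half]
      sum[OF half half] by simp_all
  moreover have "range ((gchoose) (1/2)) \<subseteq> S" "range ((gchoose) (-1/2)) \<subseteq> S"
    using half minus_half_gbinomial_S by auto
  ultimately show ?thesis using assms by blast
qed

context
  fixes V assumes V: "V \<in> carrier (matrix_ring n R)"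
    and V1: "V \<ominus>\<^bsub>matrix_ring n R\<^esub> \<one>\<^bsub>matrix_ring n R\<^esub> \<in> p_multiples p (matrix_ring n R) 1"
begin

abbreviation "binomial_value s \<equiv> E.series_value ((gchoose) s) (V \<ominus>\<^bsub>matrix_ring n R\<^esub> \<one>\<^bsub>matrix_ring n R\<^esub>)"

lemma p_adic_limit_iff:
  assumes "\<And>k. s k \<in> carrier (matrix_ring n R)"
  shows "p_adic_limit p R n s L \<longleftrightarrow> L \<in> carrier (matrix_ring n R) \<and>
    (\<forall>m. \<exists>K. \<forall>k\<ge>K. L \<ominus>\<^bsub>matrix_ring n R\<^esub> s k \<in> p_multiples p (matrix_ring n R) m)"
proof (cases "L \<in> carrier (matrix_ring n R)")
  case L: True
  have "L \<ominus>\<^bsub>matrix_ring n R\<^esub> s k \<in> p_multiples p (matrix_ring n R) m \<longleftrightarrow>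
      (\<forall>i<n. \<forall>j<n. L $$ (i, j) \<ominus> s k $$ (i, j) \<in> p_multiples p R m)" for k m
    unfolding p_multiples_matrix_ring
    using matrix_ring_carrierD(1)[OF E.minus_closed[OF L assms]] matrix_minus_index[OF L assms] by simp
  then show ?thesis using L by (simp add: p_adic_limit_def p_power_ideal_eq_p_multiples)
qed (simp add: p_adic_limit_def)

text \<open>Justifies the definite description in \<open>matrix_binomial_power\<close>: a limit
  exists by completeness and is unique by separatedness. From here on only the properties of
  \<open>binomial_value\<close> matter.\<close>

lemma matrix_binomial_power_value:
  assumes "s \<in> {-1, -1/2, 0, 1/2, 1}"
  shows "binomial_value s (matrix_binomial_power p R n c s V)"
proof -
  let ?E = "matrix_ring n R"
  let ?U = "V \<ominus>\<^bsub>?E\<^esub> \<one>\<^bsub>?E\<^esub>"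
  note r = gbinomial_S[OF assms]
  have "(\<Oplus>\<^bsub>?E\<^esub>i\<in>{..k}. map_mat (\<lambda>a. c (s gchoose i) \<otimes> a) (?U [^]\<^bsub>?E\<^esub> i)) =
      E.series_sum ((gchoose) s) ?U k" for k
    unfolding E.series_sum_def
  proof (rule E.finsum_cong')
    fix i
    have "c (s gchoose i) \<in> carrier R" using ring_hom_closed[OF c_hom, of "s gchoose i"] r by auto
    then show "map_mat (\<lambda>a. c (s gchoose i) \<otimes> a) (?U [^]\<^bsub>?E\<^esub> i) =
        scalar_matrix n R (c (s gchoose i)) \<otimes>\<^bsub>?E\<^esub> ?U [^]\<^bsub>?E\<^esub> i"
      using scalar_matrix_mult E.nat_pow_closed[OF E.p_multiples_carrier[OF V1]] by simp
  qed (use r in \<open>auto intro!: E.term_closed[OF V1]\<close>)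
  then have eq: "matrix_binomial_power p R n c s V = (THE L. p_adic_limit p R n (E.series_sum ((gchoose) s) ?U) L)"
    by (simp add: matrix_binomial_power_def Let_def)
  obtain L where L: "binomial_value s L" using E.series_value_exists[OF V1 r] by blast
  have "(THE L. p_adic_limit p R n (E.series_sum ((gchoose) s) ?U) L) = L"
  proof (rule the_equality)
    show "p_adic_limit p R n (E.series_sum ((gchoose) s) ?U) L"
      using L E.series_value_limit[OF V1 L] p_adic_limit_iff[OF E.series_sum_closed[OF V1 r]]
      by (simp add: E.series_value_def)
    show "L' = L" if "p_adic_limit p R n (E.series_sum ((gchoose) s) ?U) L'" for L'
      using that unfolding p_adic_limit_iff[OF E.series_sum_closed[OF V1 r]]
      by (intro E.series_value_limit_unique[OF V1 r L]) simp_all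
  qed
  with L eq show ?thesis by simp
qed

lemma binomial_value_mult:
  assumes "s \<in> {-1, -1/2, 0, 1/2, 1}" "t \<in> {-1, -1/2, 0, 1/2, 1}"
    and "binomial_value s L" "binomial_value t M"
  shows "binomial_value (s + t) (L \<otimes>\<^bsub>matrix_ring n R\<^esub> M)"
proof -
  have "(\<lambda>m. \<Sum>i\<le>m. (s gchoose i) * (t gchoose (m - i))) = (gchoose) (s + t)"
    using gbinomial_Vandermonde[of s t] by (simp add: fun_eq_iff atMost_atLeast0)
  then show ?thesis
    using E.series_value_mult[OF V1 gbinomial_S[OF assms(1)] gbinomial_S[OF assms(2)] assms(3,4)] by simp
qed

lemma binomial_value_closed: "binomial_value s L \<Longrightarrow> L \<in> carrier (matrix_ring n R)"
  by (simp add: E.series_value_def)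

lemma binomial_value_0_1:
  "binomial_value 0 L \<Longrightarrow> L = \<one>\<^bsub>matrix_ring n R\<^esub>" "binomial_value 1 L \<Longrightarrow> L = V"
proof -
  have r: "range ((gchoose) 0) \<subseteq> S" "range ((gchoose) 1) \<subseteq> S" using gbinomial_S by simp_all
  have z: "(0 gchoose i) = (0 :: complex)" "(1 gchoose i) = (0 :: complex)" if "2 \<le> i" for i
    using that binomial_gbinomial[of 1 i, where 'a = complex] by (auto simp: gbinomial_0_left binomial_eq_0)
  note U = E.p_multiples_carrier[OF V1]
  show "L = \<one>\<^bsub>matrix_ring n R\<^esub>" if "binomial_value 0 L"
    using E.series_value_linear[OF V1 r(1) z(1) that] U by (simp add: E.coeff_simps gbinomial_0_left)
  show "L = V" if "binomial_value 1 L"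
  proof -
    have "L = \<one>\<^bsub>matrix_ring n R\<^esub> \<oplus>\<^bsub>matrix_ring n R\<^esub> (V \<ominus>\<^bsub>matrix_ring n R\<^esub> \<one>\<^bsub>matrix_ring n R\<^esub>)"
      using E.series_value_linear[OF V1 r(2) z(2) that] U by (simp add: E.coeff_simps)
    also have "\<dots> = V" using V E.one_closed by algebra
    finally show ?thesis .
  qed
qed

lemma matrix_binomial_power_closed:
  assumes "s \<in> {-1, -1/2, 0, 1/2, 1}"
  shows "matrix_binomial_power p R n c s V \<in> carrier (matrix_ring n R)"
    "matrix_binomial_power p R n c s V \<ominus>\<^bsub>matrix_ring n R\<^esub> \<one>\<^bsub>matrix_ring n R\<^esub>
      \<in> p_multiples p (matrix_ring n R) 1"
  using matrix_binomial_power_value[OF assms] binomial_value_closed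
    E.series_value_cong_coeff_0[OF V1 gbinomial_S[OF assms]] by (simp_all add: E.coeff_simps)

lemma matrix_binomial_power_half:
  "matrix_binomial_power p R n c (1/2) V \<otimes>\<^bsub>matrix_ring n R\<^esub> matrix_binomial_power p R n c (1/2) V = V"
proof -
  have h: "1/2 \<in> {-1, -1/2, 0, 1/2, 1 :: complex}" by simp
  from binomial_value_mult[OF h h matrix_binomial_power_value[OF h] matrix_binomial_power_value[OF h]]
  show ?thesis using binomial_value_0_1(2) by simp
qed

text \<open>The exponents -1/2, -1/2 and 1 add up to 0, and the power with exponent 0 is the
  identity.\<close>

lemma V_inverse_square:
  fixes W defines "W \<equiv> matrix_binomial_power p R n c (-1/2) V"
  shows "W \<otimes>\<^bsub>matrix_ring n R\<^esub> W \<otimes>\<^bsub>matrix_ring n R\<^esub> V = \<one>\<^bsub>matrix_ring n R\<^esub>"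
    "V \<otimes>\<^bsub>matrix_ring n R\<^esub> (W \<otimes>\<^bsub>matrix_ring n R\<^esub> W) = \<one>\<^bsub>matrix_ring n R\<^esub>"
proof -
  have h: "-1/2 \<in> {-1, -1/2, 0, 1/2, 1 :: complex}" "-1 \<in> {-1, -1/2, 0, 1/2, 1 :: complex}"
    "1 \<in> {-1, -1/2, 0, 1/2, 1 :: complex}" by simp_all
  have W2: "binomial_value (-1) (W \<otimes>\<^bsub>matrix_ring n R\<^esub> W)"
    using binomial_value_mult[OF h(1,1) matrix_binomial_power_value[OF h(1)] matrix_binomial_power_value[OF h(1)]]
    by (simp add: W_def)
  have V: "binomial_value 1 V"
    using matrix_binomial_power_value[OF h(3)] binomial_value_0_1(2) by metis
  show "W \<otimes>\<^bsub>matrix_ring n R\<^esub> W \<otimes>\<^bsub>matrix_ring n R\<^esub> V = \<one>\<^bsub>matrix_ring n R\<^esub>"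
    using binomial_value_mult[OF h(2,3) W2 V] by (intro binomial_value_0_1(1)) simp
  show "V \<otimes>\<^bsub>matrix_ring n R\<^esub> (W \<otimes>\<^bsub>matrix_ring n R\<^esub> W) = \<one>\<^bsub>matrix_ring n R\<^esub>"
    using binomial_value_mult[OF h(3,2) V W2] by (intro binomial_value_0_1(1)) simp
qed

text \<open>A matrix congruent to 1 modulo p is invertible; the square of its power with exponent
  -1/2 replaces the geometric series.\<close>

lemma V_Units: "V \<in> Units (matrix_ring n R)"
  using V_inverse_square V matrix_binomial_power_closed(1)[of "-1/2"]
  by (intro E.UnitsI[where b = "matrix_binomial_power p R n c (-1/2) V \<otimes>\<^bsub>matrix_ring n R\<^esub>
    matrix_binomial_power p R n c (-1/2) V"]) simp_all

end

end

section \<open>Subrings of fields\<close>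

text \<open>The common shape of \<open>base_ring\<close> and \<open>GL_ring\<close>, so that both
  are treated by the same lemmas.\<close>

definition subring_of :: "'a :: comm_ring_1 set \<Rightarrow> 'a ring" where
  "subring_of S = class_ring\<lparr>carrier := S\<rparr>"

lemma subring_of_simps:
  "carrier (subring_of S) = S" "\<zero>\<^bsub>subring_of S\<^esub> = 0" "\<one>\<^bsub>subring_of S\<^esub> = 1"
  "a \<otimes>\<^bsub>subring_of S\<^esub> b = a * b" "a \<oplus>\<^bsub>subring_of S\<^esub> b = a + b"
  by (simp_all add: subring_of_def)

lemma subring_of_pow: "a [^]\<^bsub>subring_of S\<^esub> (k::nat) = a ^ k"
  by (induction k) (simp_all add: nat_pow_def subring_of_simps mult.commute)

lemma subring_of_add_pow: "[(k::nat)] \<cdot>\<^bsub>subring_of S\<^esub> a = of_nat k * a"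
  by (induction k) (simp_all add: add_pow_def nat_pow_def subring_of_simps algebra_simps)

locale class_subring =
  fixes S :: "'a :: comm_ring_1 set"
  assumes S_subring: "subring S class_ring"
begin

lemma S_closed:
  "0 \<in> S" "1 \<in> S" "a \<in> S \<Longrightarrow> - a \<in> S" "a \<in> S \<Longrightarrow> b \<in> S \<Longrightarrow> a + b \<in> S"
  "a \<in> S \<Longrightarrow> b \<in> S \<Longrightarrow> a * b \<in> S"
  using subringE(2,3,5-7)[OF S_subring] by (simp_all add: class_ring_simps)

lemma S_minus: "a \<in> S \<Longrightarrow> b \<in> S \<Longrightarrow> a - b \<in> S"
  using S_closed(4)[of a "- b"] S_closed(3) by simp

lemma S_of_int: "of_int m \<in> S"
proof -
  have n: "of_nat k \<in> S" for k by (induction k) (simp_all add: S_closed)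
  show ?thesis by (cases m) (simp_all add: n S_closed S_minus)
qed

lemma S_sum: "(\<And>i. i \<in> I \<Longrightarrow> f i \<in> S) \<Longrightarrow> sum f I \<in> S"
  by (induction I rule: infinite_finite_induct) (simp_all add: S_closed)

lemma S_prod: "(\<And>i. i \<in> I \<Longrightarrow> f i \<in> S) \<Longrightarrow> prod f I \<in> S"
  by (induction I rule: infinite_finite_induct) (simp_all add: S_closed)

lemma S_power: "a \<in> S \<Longrightarrow> a ^ k \<in> S"
  by (induction k) (simp_all add: S_closed)

lemma S_det:
  assumes "U \<in> carrier_mat n n" "\<And>i j. i < n \<Longrightarrow> j < n \<Longrightarrow> U $$ (i, j) \<in> S"
  shows "det U \<in> S"
proof -
  have "(\<Prod>i = 0..<n. U $$ (i, \<pi> i)) \<in> S" if "\<pi> permutes {0..<n}" for \<pi>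
    using permutes_in_image[OF that] by (intro S_prod assms(2)) simp_all
  then show ?thesis
    unfolding det_def'[OF assms(1)] by (auto intro!: S_sum S_closed S_of_int)
qed

sublocale K: cring "subring_of S"
  unfolding subring_of_def
  using ring.subcring_iff[OF class_ring.ring_axioms, of S] cring.subcringI'[OF class_cring.cring_axioms S_subring] by simp

lemma K_uminus: "a \<in> S \<Longrightarrow> \<ominus>\<^bsub>subring_of S\<^esub> a = - a"
  by (rule K.minus_equality) (simp_all add: subring_of_simps S_closed)

lemma K_minus: "a \<in> S \<Longrightarrow> b \<in> S \<Longrightarrow> a \<ominus>\<^bsub>subring_of S\<^esub> b = a - b"
  by (simp add: K.minus_eq K_uminus subring_of_simps)

lemma K_finsum: "(\<And>i. i \<in> I \<Longrightarrow> f i \<in> S) \<Longrightarrow> finsum (subring_of S) f I = sum f I"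
proof (induction I rule: infinite_finite_induct)
  case (insert x F)
  then show ?case by (subst K.finsum_insert) (auto simp: subring_of_simps)
qed (simp_all add: subring_of_simps)

lemma K_matrix_mult:
  assumes "U \<in> carrier (matrix_ring n (subring_of S))" "V \<in> carrier (matrix_ring n (subring_of S))"
  shows "U \<otimes>\<^bsub>matrix_ring n (subring_of S)\<^esub> V = U * V"
proof (rule eq_matI)
  note e = matrix_ring_carrierD[OF assms(1), unfolded subring_of_simps]
    matrix_ring_carrierD[OF assms(2), unfolded subring_of_simps]
  fix i j assume "i < dim_row (U * V)" "j < dim_col (U * V)"
  then have ij: "i < n" "j < n" using e by simp_all
  have "(\<Oplus>\<^bsub>subring_of S\<^esub>k\<in>{..<n}. U $$ (i, k) * V $$ (k, j)) = (\<Sum>k<n. U $$ (i, k) * V $$ (k, j))"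
    using ij e by (intro K_finsum S_closed) auto
  then show "(U \<otimes>\<^bsub>matrix_ring n (subring_of S)\<^esub> V) $$ (i, j) = (U * V) $$ (i, j)"
    using ij e by (simp add: matrix_ring_simps subring_of_simps scalar_prod_def atLeast0LessThan)
qed (use matrix_ring_carrierD[OF assms(1)] matrix_ring_carrierD[OF assms(2)] in \<open>simp_all add: matrix_ring_simps\<close>)

lemma K_matrix_one: "\<one>\<^bsub>matrix_ring n (subring_of S)\<^esub> = 1\<^sub>m n"
  by (rule eq_matI) (simp_all add: matrix_ring_simps subring_of_simps)

text \<open>The inverse is \<open>d\<close> times the adjugate. Up to sign, the entries of the
  adjugate are minors of \<open>U\<close>, so they stay in the subring.\<close>

lemma K_matrix_Units:
  fixes d :: 'a
  assumes U: "U \<in> carrier_mat n n" "\<And>i j. i < n \<Longrightarrow> j < n \<Longrightarrow> U $$ (i, j) \<in> S"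
    and d: "d \<in> S" "d * det U = 1"
  shows "U \<in> Units (matrix_ring n (subring_of S))"
proof -
  interpret E: ring "matrix_ring n (subring_of S)" by (rule K.matrix_ring_ring)
  have UE: "U \<in> carrier (matrix_ring n (subring_of S))"
    using U by (intro matrix_ring_carrierI) (simp_all add: subring_of_simps)
  let ?V = "d \<cdot>\<^sub>m adj_mat U"
  have cof: "cofactor U i j \<in> S" if "i < n" "j < n" for i j
  proof -
    have "U $$ (insert_index i i', insert_index j j') = mat_delete U i j $$ (i', j')"
      if "i' < n - 1" "j' < n - 1" for i' j'
      using mat_delete_index[of U "n - 1" i j i' j'] U(1) \<open>i < n\<close> \<open>j < n\<close> that by simp
    moreover have "insert_index i i' < n" if "i' < n - 1" for i i' using that by (auto simp: insert_index_def)
    ultimately have "mat_delete U i j $$ (i', j') \<in> S" if "i' < n - 1" "j' < n - 1" for i' j'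
      using U(2) that by metis
    then have "det (mat_delete U i j) \<in> S"
      using mat_delete_carrier[OF U(1)] by (intro S_det[of _ "n - 1"]) auto
    then show ?thesis unfolding cofactor_def by (intro S_closed S_power)
  qed
  have V: "?V \<in> carrier (matrix_ring n (subring_of S))"
    using U(1) cof d(1) adj_mat(1)[OF U(1)]
    by (intro matrix_ring_carrierI) (auto simp: subring_of_simps adj_mat_def intro!: S_closed)
  have "U * ?V = 1\<^sub>m n" "?V * U = 1\<^sub>m n"
    unfolding mult_smult_distrib[OF U(1) adj_mat(1)[OF U(1)]] mult_smult_assoc_mat[OF adj_mat(1)[OF U(1)] U(1)]
      adj_mat(2,3)[OF U(1)]
    using d(2) by (auto intro!: eq_matI)
  then show ?thesis
    using K_matrix_mult[OF UE V] K_matrix_mult[OF V UE] UE V K_matrix_one by (intro E.UnitsI) simp_all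
qed

end

lemma (in class_subring) K_p_torsion_free:
  assumes "1 < p" "\<And>a :: 'a. of_nat p * a = 0 \<Longrightarrow> a = 0"
  shows "p_torsion_free_cring (subring_of S) p"
  using assms by unfold_locales (simp_all add: subring_of_simps subring_of_add_pow)

lemma class_subring_generate: "class_subring (generate_ring class_ring X)"
  by (intro class_subring.intro ring.generate_ring_is_subring[OF class_ring.ring_axioms]) simp

lemma generate_ring_hom_eqI:
  assumes T: "ring T" and "h \<in> Ring.ring_hom (subring_of (generate_ring class_ring X)) T"
    "h' \<in> Ring.ring_hom (subring_of (generate_ring class_ring X)) T"
    and X: "\<And>a. a \<in> X \<Longrightarrow> h a = h' a" and a: "a \<in> generate_ring class_ring X"
  shows "h a = h' a"
proof -
  interpret class_subring "generate_ring class_ring X" by (rule class_subring_generate)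
  interpret h: ring_hom_ring "subring_of (generate_ring class_ring X)" T h
    using assms K.ring_axioms by (simp add: ring_hom_ring_def ring_hom_ring_axioms_def)
  interpret h': ring_hom_ring "subring_of (generate_ring class_ring X)" T h'
    using assms K.ring_axioms by (simp add: ring_hom_ring_def ring_hom_ring_axioms_def)
  from a show ?thesis
  proof (induction rule: generate_ring.induct)
    case one
    then show ?case using h.hom_one h'.hom_one by (simp add: subring_of_simps)
  next
    case (incl a)
    then show ?case by (rule X)
  next
    case (a_inv a)
    then show ?case
      using h.hom_a_inv[of a] h'.hom_a_inv[of a] by (simp add: subring_of_simps K_uminus class_ring_simps)
  next
    case (eng_add a b)
    then show ?case using h.hom_add[of a b] h'.hom_add[of a b] by (simp add: subring_of_simps)
  next
    case (eng_mult a b)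
    then show ?case using h.hom_mult[of a b] h'.hom_mult[of a b] by (simp add: subring_of_simps)
  qed
qed

section \<open>Separatedness of the base ring\<close>

lemma common_denominator:
  assumes "finite (F :: rat set)"
  shows "\<exists>c>0. \<forall>x\<in>F. of_nat c * x \<in> \<int>"
  using assms
proof (induction F rule: finite_induct)
  case (insert x F)
  then obtain c where c: "c > 0" "\<forall>y\<in>F. of_nat c * y \<in> \<int>" by blast
  obtain a b where ab: "x = Rat.Fract a b" "b > 0" "coprime a b" by (rule Rat_cases)
  have "of_int b * x = of_int a" using ab by (simp add: Fract_of_int_quotient)
  then have x: "of_nat (nat b) * x = of_int a" using ab(2) by simp
  have "of_nat (c * nat b) * y \<in> \<int>" if "y \<in> insert x F" for y
  proof (cases "y = x")
    case True
    have "of_nat (c * nat b) * y = of_int (int c * a)" using x True by (simp add: mult.assoc)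
    then show ?thesis by (metis Ints_of_int)
  next
    case False
    have eq: "of_nat (c * nat b) * y = of_nat (nat b) * (of_nat c * y)" by (simp add: mult_ac)
    have "of_nat c * y \<in> \<int>" using c that False by auto
    then show ?thesis unfolding eq by (rule Ints_mult[OF Ints_of_nat])
  qed
  then show ?case using c(1) ab(2) by (intro exI[of _ "c * nat b"]) auto
qed auto

text \<open>
  If $a \<noteq> 0$, choose a $\mathbb{Q}$-linear functional $\lambda$ on the complex numbers with $\lambda(a) = 1$. It maps
  $\mathbb{Z}[1/M, \zeta]$ into $\frac1c \mathbb{Z}[1/M]$ for some positive integer $c$, and no element of the
  latter other than $0$ is divisible by all powers of $p$.
\<close>

lemma cyclotomic_p_separated:
  assumes p: "prime p" "\<not> p dvd M" and M: "M > 0" and z: "\<zeta> ^ N = 1" "N > 0"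
    and div: "\<And>k. \<exists>b\<in>generate_ring class_ring {1 / of_nat M, \<zeta>}. a = of_nat p ^ k * b"
  shows "a = (0 :: complex)"
proof (rule ccontr)
  assume "a \<noteq> 0"
  interpret vs: vector_space "\<lambda>(q::rat) (x::complex). of_rat q * x"
    by unfold_locales (simp_all add: algebra_simps of_rat_add of_rat_mult)
  have ind: "vs.independent {a}" using \<open>a \<noteq> 0\<close> by (simp add: vs.dependent_single)
  define B where "B = vs.extend_basis {a}"
  have B: "vs.independent B" "vs.span B = UNIV" "a \<in> B"
    using vs.independent_extend_basis[OF ind] vs.extend_basis_superset[OF ind]
      vs.span_extend_basis[OF ind] by (simp_all add: B_def)
  define f where "f x = vs.representation B x a" for x
  have f_add: "f (x + y) = f x + f y" and f_scale: "f (of_rat q * x) = q * f x"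
    and f_uminus: "f (- x) = - f x" for x y q
    unfolding f_def using vs.representation_add[OF B(1)] vs.representation_scale[OF B(1)]
      vs.representation_neg[OF B(1)] B(2) by simp_all
  have fa: "f a = 1" unfolding f_def using vs.representation_basis[OF B(1,3)] by simp
  have f_nat: "f (of_nat m * x) = of_nat m * f x" for m x
    using f_scale[of "of_nat m" x] by simp
  \<comment> \<open>Only finitely many powers of \<zeta> are distinct, so one denominator serves for
    all of them.\<close>
  obtain c where c: "c > 0" "\<And>i. i < N \<Longrightarrow> of_nat c * f (\<zeta> ^ i) \<in> \<int>"
    using common_denominator[of "(\<lambda>i. f (\<zeta> ^ i)) ` {..<N}"] by auto
  have z_mod: "\<zeta> ^ i = \<zeta> ^ (i mod N)" for i
  proof -
    have "\<zeta> ^ i = \<zeta> ^ (N * (i div N) + i mod N)" by simp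
    then show ?thesis using z by (simp only: power_add power_mult power_one mult_1)
  qed
  have c': "of_nat c * f (\<zeta> ^ i) \<in> \<int>" for i using c(2)[of "i mod N"] z_mod[of i] z(2) by simp
  \<comment> \<open>The multipliers of \<open>G\<close> form a ring that contains $1/M$ and $\zeta$; as $1 \in G$, all elements of that ring lie in \<open>G\<close>.\<close>
  define G where "G = {y. \<forall>i. \<exists>j. of_nat (c * M ^ j) * f (y * \<zeta> ^ i) \<in> \<int>}"
  have G_add: "x + y \<in> G" if xy: "x \<in> G" "y \<in> G" for x y
    unfolding G_def
  proof (intro CollectI allI)
    fix i
    obtain j k where jk: "of_nat (c * M ^ j) * f (x * \<zeta> ^ i) \<in> \<int>" "of_nat (c * M ^ k) * f (y * \<zeta> ^ i) \<in> \<int>"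
      using xy unfolding G_def by blast
    have "of_nat (c * M ^ (j + k)) * f ((x + y) * \<zeta> ^ i) =
        of_nat (M ^ k) * (of_nat (c * M ^ j) * f (x * \<zeta> ^ i)) +
        of_nat (M ^ j) * (of_nat (c * M ^ k) * f (y * \<zeta> ^ i))"
      by (simp add: f_add algebra_simps power_add)
    also have "\<dots> \<in> \<int>" by (intro Ints_add Ints_mult[OF Ints_of_nat] jk)
    finally show "\<exists>j. of_nat (c * M ^ j) * f ((x + y) * \<zeta> ^ i) \<in> \<int>" by blast
  qed
  have G_uminus: "- x \<in> G" if "x \<in> G" for x
    using that by (auto simp: G_def f_uminus)
  have G_1: "1 \<in> G" using c' by (auto simp: G_def intro!: exI[of _ 0])
  have G_z: "\<zeta> * x \<in> G" if "x \<in> G" for x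
    unfolding G_def
  proof (intro CollectI allI)
    fix i
    have eq: "\<zeta> * x * \<zeta> ^ i = x * \<zeta> ^ Suc i" by simp
    show "\<exists>j. of_nat (c * M ^ j) * f (\<zeta> * x * \<zeta> ^ i) \<in> \<int>"
      using that unfolding G_def eq by blast
  qed
  have G_M: "1 / of_nat M * x \<in> G" if x: "x \<in> G" for x
    unfolding G_def
  proof (intro CollectI allI)
    fix i
    obtain j where j: "of_nat (c * M ^ j) * f (x * \<zeta> ^ i) \<in> \<int>" using x unfolding G_def by blast
    have "of_nat (c * M ^ Suc j) * f (1 / of_nat M * x * \<zeta> ^ i) =
        of_nat (c * M ^ j) * f (of_nat M * (1 / of_nat M * x * \<zeta> ^ i))"
      unfolding f_nat by simp
    also have "of_nat M * (1 / of_nat M * x * \<zeta> ^ i) = x * \<zeta> ^ i" using M by simp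
    finally show "\<exists>j. of_nat (c * M ^ j) * f (1 / of_nat M * x * \<zeta> ^ i) \<in> \<int>" using j by metis
  qed
  have "\<forall>x\<in>G. b * x \<in> G" if "b \<in> generate_ring class_ring {1 / of_nat M, \<zeta>}" for b
    using that
  proof (induction rule: generate_ring.induct)
    case (incl h)
    then show ?case using G_z G_M by auto
  next
    case (a_inv h)
    then show ?case using G_uminus by (auto simp: class_ring_simps)
  next
    case (eng_add h1 h2)
    then show ?case using G_add by (auto simp: distrib_right)
  next
    case (eng_mult h1 h2)
    then show ?case by (auto simp: mult.assoc)
  qed simp
  then have A_G: "b \<in> G" if "b \<in> generate_ring class_ring {1 / of_nat M, \<zeta>}" for b
    using that G_1 by force
  \<comment> \<open>The exponent is taken to be \<open>c\<close> itself: p^c divides c M^j and is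
    coprime to M, so it would have to divide \<open>c\<close>, although it is larger.\<close>
  obtain b where b: "b \<in> generate_ring class_ring {1 / of_nat M, \<zeta>}" "a = of_nat p ^ c * b"
    using div by blast
  obtain j where j: "of_nat (c * M ^ j) * f b \<in> \<int>"
    using A_G[OF b(1)] unfolding G_def by (auto dest: spec[of _ 0])
  then obtain m where m: "of_nat (c * M ^ j) * f b = of_int m" by (auto elim: Ints_cases)
  have "1 = of_nat (p ^ c) * f b" using fa b(2) f_nat[of "p ^ c" b] by simp
  then have "of_nat (c * M ^ j) = (of_nat (p ^ c) * of_int m :: rat)"
    by (metis (no_types, lifting) m mult.left_commute mult.right_neutral)
  then have "rat_of_int (int (c * M ^ j)) = of_int (int (p ^ c) * m)" by simp
  then have "int (c * M ^ j) = int (p ^ c) * m" by (simp only: of_int_eq_iff)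
  then have "int (p ^ c) dvd int (c * M ^ j)" by (rule dvdI)
  then have "p ^ c dvd c * M ^ j" by (simp only: int_dvd_int_iff)
  moreover have "coprime (p ^ c) (M ^ j)" using p by (simp add: prime_imp_coprime)
  ultimately have "p ^ c dvd c" by (simp add: coprime_dvd_mult_left_iff)
  then have "p ^ c \<le> c" using c(1) by (simp add: dvd_imp_le)
  moreover have "c < p ^ c" using prime_gt_1_nat[OF p(1)] by (simp add: power_gt_expt)
  ultimately show False by simp
qed

section \<open>Constants and the generic determinant in the field of rational functions\<close>

lemma const_fun_simps:
  "const_fun 0 = 0" "const_fun 1 = 1" "const_fun (a + b) = const_fun a + const_fun b"
  "const_fun (a * b) = const_fun a * const_fun b"
  by (simp_all add: const_fun_def single_add flip: to_fract_add to_fract_mult)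
    (simp add: mult_single)

text \<open>In the Leibniz expansion, the product of the diagonal variables arises from the identity
  permutation only, with coefficient 1. This is what makes
  \<open>inverse (det (generic_matrix n))\<close> a genuine inverse, the inverse of 0 being 0 by
  convention.\<close>

lemma det_generic_matrix_nonzero: "det (generic_matrix n) \<noteq> 0"
proof -
  let ?P = "mat n n (\<lambda>(i, j). Poly_Mapping.single (Poly_Mapping.single (i, j) 1) (1 :: complex))"
  let ?m = "\<lambda>\<pi>. \<Sum>i = 0..<n. Poly_Mapping.single (i, \<pi> i) (1 :: nat)"
  interpret comm_ring_hom "to_fract :: ((nat \<times> nat \<Rightarrow>\<^sub>0 nat) \<Rightarrow>\<^sub>0 complex) \<Rightarrow> ratfun"
    by unfold_locales simp_all
  have "generic_matrix n = map_mat to_fract ?P"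
    by (rule eq_matI) (simp_all add: generic_matrix_def coord_fun_def)
  then have "det (generic_matrix n) = to_fract (det ?P)" by simp
  moreover have "Poly_Mapping.lookup (det ?P) (?m id) = 1"
  proof -
    have prod: "(\<Prod>i = 0..<n. ?P $$ (i, \<pi> i)) = Poly_Mapping.single (?m \<pi>) 1"
      if "\<pi> permutes {0..<n}" for \<pi>
    proof -
      have *: "(\<Prod>i\<in>I. ?P $$ (i, \<pi> i)) = Poly_Mapping.single (\<Sum>i\<in>I. Poly_Mapping.single (i, \<pi> i) 1) 1"
        if "finite I" "I \<subseteq> {0..<n}" for I
        using that
      proof (induction I rule: finite_induct)
        case (insert i I)
        have "\<pi> i < n" using permutes_in_image[OF \<open>\<pi> permutes {0..<n}\<close>, of i] insert by auto
        with insert show ?case by (simp add: mult_single)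
      qed simp
      show ?thesis by (rule *) simp_all
    qed
    \<comment> \<open>If \<pi> moves i, the variable with indices (i, i) is missing from the
      monomial of \<pi>.\<close>
    have ne: "?m \<pi> \<noteq> ?m id" if \<pi>: "\<pi> permutes {0..<n}" "\<pi> \<noteq> id" for \<pi>
    proof
      assume eq: "?m \<pi> = ?m id"
      obtain i where i: "\<pi> i \<noteq> i" using \<pi>(2) by (auto simp: fun_eq_iff)
      then have "i < n" using \<pi>(1) by (auto simp: permutes_def)
      have "Poly_Mapping.lookup (?m \<pi>) (i, i) = 0"
        using i by (auto simp: lookup_sum lookup_single when_def)
      moreover have "Poly_Mapping.lookup (?m id) (i, i) = 1"
        using \<open>i < n\<close> by (simp add: lookup_sum lookup_single when_def sum.delta)
      ultimately show False using eq by simp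
    qed
    have "Poly_Mapping.lookup (of_int (sign \<pi>) * (\<Prod>i = 0..<n. ?P $$ (i, \<pi> i))) (?m id) =
        (if \<pi> = id then 1 else 0)"
      if \<pi>: "\<pi> permutes {0..<n}" for \<pi>
      unfolding prod[OF \<pi>] using ne[OF \<pi>] by (cases "\<pi> = id") (auto simp: lookup_single when_def sign_def)
    then have "Poly_Mapping.lookup (det ?P) (?m id) = (\<Sum>\<pi> | \<pi> permutes {0..<n}. if \<pi> = id then 1 else 0)"
      unfolding det_def'[OF mat_carrier] lookup_sum by (intro sum.cong) simp_all
    then show ?thesis by (simp add: finite_permutations permutes_id sum.delta)
  qed
  ultimately show ?thesis by (auto simp: to_fract_eq_0_iff)
qed

section \<open>Frobenius lifts and roots of unity\<close>

context cring
begin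

text \<open>The expansion has to reach the third order: if \<open>a\<close> is divisible by p
  exactly once, then a^2 contributes only p^2, whereas p-th roots of unity require an error
  divisible by p^3. The quadratic term gains its third factor from the binomial coefficient.\<close>

lemma power_one_plus:
  assumes a: "a \<in> carrier R"
  shows "\<exists>r\<in>carrier R. (\<one> \<oplus> a) [^] (l::nat) =
    \<one> \<oplus> [l] \<cdot> a \<oplus> [(l choose 2)] \<cdot> (a \<otimes> a) \<oplus> a \<otimes> a \<otimes> a \<otimes> r"
proof (induction l)
  case 0
  then show ?case using a by (intro bexI[of _ \<zero>]) (simp_all add: numeral_2_eq_2)
next
  case (Suc l)
  then obtain r where r: "r \<in> carrier R" "(\<one> \<oplus> a) [^] l =
    \<one> \<oplus> [l] \<cdot> a \<oplus> [(l choose 2)] \<cdot> (a \<otimes> a) \<oplus> a \<otimes> a \<otimes> a \<otimes> r" by blast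
  \<comment> \<open>Natural multiples are replaced by ring elements, so that the identity becomes
    one in commutative ring operations.\<close>
  define L C where "L = [l] \<cdot> \<one>" and "C = [(l choose 2)] \<cdot> \<one>"
  have LC: "L \<in> carrier R" "C \<in> carrier R" by (simp_all add: L_def C_def)
  have L: "[l] \<cdot> x = L \<otimes> x" and C: "[(l choose 2)] \<cdot> x = C \<otimes> x" if "x \<in> carrier R" for x
    using that by (simp_all add: L_def C_def add_pow_ldistr)
  have choose: "Suc l choose 2 = l + (l choose 2)"
    by (simp add: numeral_2_eq_2)
  have C': "[(Suc l choose 2)] \<cdot> (a \<otimes> a) = L \<otimes> (a \<otimes> a) \<oplus> C \<otimes> (a \<otimes> a)"
    unfolding choose using a by (simp add: add.nat_pow_mult[symmetric] L C)
  have L': "[Suc l] \<cdot> a = L \<otimes> a \<oplus> a" using a by (simp add: L)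
  have "(\<one> \<oplus> a) [^] Suc l = (\<one> \<oplus> L \<otimes> a \<oplus> C \<otimes> (a \<otimes> a) \<oplus> a \<otimes> a \<otimes> a \<otimes> r) \<otimes> (\<one> \<oplus> a)"
    using r a by (simp add: L C)
  also have "\<dots> = \<one> \<oplus> (L \<otimes> a \<oplus> a) \<oplus> (L \<otimes> (a \<otimes> a) \<oplus> C \<otimes> (a \<otimes> a))
      \<oplus> a \<otimes> a \<otimes> a \<otimes> (r \<oplus> C \<oplus> a \<otimes> r)"
    using LC r a by (simp add: l_distr r_distr a_ac m_ac)
  finally show ?case
    unfolding L' C' using LC r a by (intro bexI[of _ "r \<oplus> C \<oplus> a \<otimes> r"]) simp_all
qed

lemma p_multiples_power_minus_one:
  assumes "c \<in> carrier R" "c \<ominus> \<one> \<in> p_multiples p R k"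
  shows "c [^] (m::nat) \<ominus> \<one> \<in> p_multiples p R k"
proof (induction m)
  case (Suc m)
  then show ?case using p_multiples_mult_diff[OF Suc assms(2)] assms(1) by simp
qed (simp add: minus_eq r_neg)

text \<open>
  In the second claim \<open>p\<close> has to be odd, in order that $p$ divides $\binom{p}{2}$.
\<close>

lemma power_one_plus_p_multiples:
  assumes "a \<in> p_multiples p R (Suc j)"
  shows "(\<one> \<oplus> a) [^] (l::nat) \<ominus> \<one> \<ominus> [l] \<cdot> a \<in> p_multiples p R (Suc (Suc j))"
    and "odd p \<Longrightarrow> (\<one> \<oplus> a) [^] p \<ominus> \<one> \<ominus> [p] \<cdot> a \<in> p_multiples p R (Suc (Suc (Suc j)))"
proof -
  have a: "a \<in> carrier R" using assms by (rule p_multiples_carrier)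
  have aa: "a \<otimes> a \<in> p_multiples p R (Suc (Suc (2 * j)))"
    using p_multiples_mult[OF assms assms] by (simp add: mult_2)
  have aaa: "a \<otimes> a \<otimes> a \<in> p_multiples p R (Suc (Suc (Suc (3 * j))))"
    using p_multiples_mult[OF aa assms] by (simp add: numeral_3_eq_3)
  have eq: "\<exists>r\<in>carrier R. (\<one> \<oplus> a) [^] l \<ominus> \<one> \<ominus> [l] \<cdot> a =
    [(l choose 2)] \<cdot> (a \<otimes> a) \<oplus> a \<otimes> a \<otimes> a \<otimes> r" for l :: nat
  proof -
    obtain r where r: "r \<in> carrier R" "(\<one> \<oplus> a) [^] l =
      \<one> \<oplus> [l] \<cdot> a \<oplus> [(l choose 2)] \<cdot> (a \<otimes> a) \<oplus> a \<otimes> a \<otimes> a \<otimes> r"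
      using power_one_plus[OF a] by blast
    have c: "[l] \<cdot> a \<in> carrier R" "[(l choose 2)] \<cdot> (a \<otimes> a) \<in> carrier R" "a \<otimes> a \<otimes> a \<otimes> r \<in> carrier R"
      using a r(1) by simp_all
    have "\<one> \<oplus> x \<oplus> y \<oplus> z \<ominus> \<one> \<ominus> x = y \<oplus> z"
      if "x \<in> carrier R" "y \<in> carrier R" "z \<in> carrier R" for x y z
      using that one_closed by algebra
    from this[OF c] show ?thesis using r by metis
  qed
  show "(\<one> \<oplus> a) [^] l \<ominus> \<one> \<ominus> [l] \<cdot> a \<in> p_multiples p R (Suc (Suc j))"
  proof -
    obtain r where r: "r \<in> carrier R" "(\<one> \<oplus> a) [^] l \<ominus> \<one> \<ominus> [l] \<cdot> a =
      [(l choose 2)] \<cdot> (a \<otimes> a) \<oplus> a \<otimes> a \<otimes> a \<otimes> r" using eq by blast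
    have "[(l choose 2)] \<cdot> (a \<otimes> a) \<in> p_multiples p R (Suc (Suc j))"
      "a \<otimes> a \<otimes> a \<otimes> r \<in> p_multiples p R (Suc (Suc j))"
      using p_multiples_antimono[OF _ p_multiples_add_pow'[OF aa], of "Suc (Suc j)"]
        p_multiples_antimono[OF _ p_multiples_rmult[OF aaa r(1)], of "Suc (Suc j)"] by simp_all
    then show ?thesis unfolding r(2) by (rule p_multiples_add)
  qed
  show "(\<one> \<oplus> a) [^] p \<ominus> \<one> \<ominus> [p] \<cdot> a \<in> p_multiples p R (Suc (Suc (Suc j)))" if "odd p"
  proof -
    obtain r where r: "r \<in> carrier R" "(\<one> \<oplus> a) [^] p \<ominus> \<one> \<ominus> [p] \<cdot> a =
      [(p choose 2)] \<cdot> (a \<otimes> a) \<oplus> a \<otimes> a \<otimes> a \<otimes> r" using eq by blast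
    obtain m where m: "p = 2 * m + 1" using \<open>odd p\<close> oddE by blast
    then have "(p choose 2) = p ^ 1 * m" by (simp add: choose_two)
    then have "[(p choose 2)] \<cdot> (a \<otimes> a) = [(p ^ 1)] \<cdot> ([m] \<cdot> (a \<otimes> a))"
      using a by (simp add: add.nat_pow_pow mult.commute)
    also have "\<dots> \<in> p_multiples p R (1 + Suc (Suc (2 * j)))"
      by (intro p_multiples_add_pow p_multiples_add_pow' aa)
    finally have "[(p choose 2)] \<cdot> (a \<otimes> a) \<in> p_multiples p R (Suc (Suc (Suc j)))"
      by (rule p_multiples_antimono[rotated]) simp
    moreover have "a \<otimes> a \<otimes> a \<otimes> r \<in> p_multiples p R (Suc (Suc (Suc j)))"
      by (rule p_multiples_antimono[OF _ p_multiples_rmult[OF aaa r(1)]]) simp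
    ultimately show ?thesis unfolding r(2) by (rule p_multiples_add)
  qed
qed

end

locale p_complete_cring = p_complete_ring + cring
begin

lemma one_plus: "c \<in> carrier R \<Longrightarrow> \<one> \<oplus> (c \<ominus> \<one>) = c"
  using one_closed by algebra

lemma p_multiples_all_eqI:
  assumes "a \<in> carrier R" "b \<in> carrier R" "a \<ominus> b \<in> p_multiples p R 1"
    and "\<And>j. a \<ominus> b \<in> p_multiples p R (Suc j) \<Longrightarrow> a \<ominus> b \<in> p_multiples p R (Suc (Suc j))"
  shows "a = b"
proof (rule p_separated_eq[OF assms(1,2)])
  have S: "a \<ominus> b \<in> p_multiples p R (Suc j)" for j
    using assms(3,4) by (induction j) simp_all
  show "a \<ominus> b \<in> p_multiples p R k" for k
    by (rule p_multiples_antimono[OF _ S[of k]]) simp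
qed

text \<open>With a = c - 1, the equation c^l = 1 says that l a is minus the error of the linear
  approximation. For l different from p, l can be cancelled and \<open>a\<close> gains a power of p.
  For l = p the sharper bound is used, since cancelling p consumes one power.\<close>

lemma one_unit_prime_root:
  assumes c: "c \<in> carrier R" "c \<ominus> \<one> \<in> p_multiples p R 1" "c [^] (l::nat) = \<one>"
    and l: "prime l" and p: "prime p" "odd p"
  shows "c = \<one>"
proof (rule p_multiples_all_eqI)
  fix j assume j: "c \<ominus> \<one> \<in> p_multiples p R (Suc j)"
  let ?a = "c \<ominus> \<one>"
  have la: "[l] \<cdot> ?a = \<ominus> ((\<one> \<oplus> ?a) [^] l \<ominus> \<one> \<ominus> [l] \<cdot> ?a)"
  proof -
    have *: "x = \<ominus> (\<one> \<ominus> \<one> \<ominus> x)" if "x \<in> carrier R" for x using that one_closed by algebra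
    show ?thesis unfolding one_plus[OF c(1)] c(3) by (rule *) (simp add: c(1))
  qed
  show "?a \<in> p_multiples p R (Suc (Suc j))"
  proof (cases "l = p")
    case True
    have "[p] \<cdot> ?a \<in> p_multiples p R (Suc (Suc (Suc j)))"
      using p_multiples_uminus[OF power_one_plus_p_multiples(2)[OF j p(2)]] True
      by (subst la[unfolded True]) simp
    then show ?thesis using p_multiples_cancel[of ?a 1 "Suc (Suc j)"] c(1) by simp
  next
    case False
    have "[l] \<cdot> ?a \<in> p_multiples p R (Suc (Suc j))"
      using p_multiples_uminus[OF power_one_plus_p_multiples(1)[OF j, of l]] by (subst la)
    then show ?thesis
      using p_multiples_coprime_cancel[OF primes_coprime[OF l p(1) False]] c(1) by blast
  qed
qed (use c in auto)

text \<open>Prime factors are stripped from the exponent: if l divides k, then c^(k/l) is congruent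
  to 1 modulo p and its l-th power is 1, hence it equals 1.\<close>

lemma one_unit_root_of_unity:
  assumes c: "c \<in> carrier R" "c \<ominus> \<one> \<in> p_multiples p R 1" "c [^] (k::nat) = \<one>" "k > 0"
    and p: "prime p" "odd p"
  shows "c = \<one>"
  using c
proof (induction k rule: less_induct)
  case (less k)
  show ?case
  proof (cases "k = 1")
    case True
    then show ?thesis using less by simp
  next
    case False
    then obtain l where l: "prime l" "l dvd k" using prime_factor_nat by blast
    then obtain m where m: "k = m * l" by (auto simp: dvd_def mult.commute)
    have "c [^] m = \<one>"
      using less.prems m l p one_unit_prime_root[of "c [^] m" l]
      by (simp add: p_multiples_power_minus_one nat_pow_pow)
    moreover have "m < k" "m > 0" using m less.prems(4) prime_gt_1_nat[OF l(1)] by auto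
    ultimately show ?thesis using less by blast
  qed
qed

end

locale p_derivation_ring = p_complete_cring +
  fixes \<delta>
  assumes derivation: "p_derivation p R \<delta>"
begin

abbreviation "\<phi> \<equiv> frobenius_lift p R \<delta>"

lemma \<delta>_closed [simp]: "a \<in> carrier R \<Longrightarrow> \<delta> a \<in> carrier R"
  using derivation by (auto simp: p_derivation_def)

lemma frobenius_def: "\<phi> a = a [^] p \<oplus> [p] \<cdot> \<delta> a"
  by (simp add: frobenius_lift_def)

sublocale frob: ring_hom_ring R R \<phi>
  using derivation ring_axioms by (simp add: p_derivation_def ring_hom_ring_def ring_hom_ring_axioms_def)

lemma frobenius_minus_power:
  "a \<in> carrier R \<Longrightarrow> \<phi> a \<ominus> a [^] p = [p] \<cdot> \<delta> a"
  unfolding frobenius_def by (simp add: minus_eq a_comm[of "a [^] p"] a_assoc r_neg)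

lemma frobenius_cong: "a \<in> carrier R \<Longrightarrow> \<phi> a \<ominus> a [^] p \<in> p_multiples p R 1"
  using frobenius_minus_power p_multiples_mult_mem[of "\<delta> a" R p 1] by simp

text \<open>As p is not a zero divisor, values of \<delta> can be recognised through the Frobenius
  lift, which is a ring homomorphism whereas \<delta> is neither additive nor
  multiplicative.\<close>

lemma derivation_eq_iff:
  assumes "a \<in> carrier R" "b \<in> carrier R"
  shows "\<phi> a = a [^] p \<oplus> [p] \<cdot> b \<longleftrightarrow> \<delta> a = b"
proof
  assume "\<phi> a = a [^] p \<oplus> [p] \<cdot> b"
  then have "[p] \<cdot> \<delta> a = [p] \<cdot> b" using assms by (simp add: frobenius_def)
  then show "\<delta> a = b" using p_cancel assms by simp
qed (simp add: frobenius_def)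

lemma derivation_eq_0_iff: "a \<in> carrier R \<Longrightarrow> \<delta> a = \<zero> \<longleftrightarrow> \<phi> a = a [^] p"
  using derivation_eq_iff[of a \<zero>] by simp

lemma derivation_zero [simp]: "\<delta> \<zero> = \<zero>"
  using derivation_eq_0_iff[of \<zero>] p_gt_1 by (simp add: nat_pow_zero)

lemma derivation_one [simp]: "\<delta> \<one> = \<zero>"
  using derivation_eq_0_iff[of \<one>] by simp

text \<open>For a = w - 1 one has \<phi>(a) = w^p - 1 = p a + error. Both summands have one more
  factor p than \<open>a\<close> is known to have, and \<open>reflect\<close> carries the gain back
  to \<open>a\<close>.\<close>

lemma frobenius_power_imp_one:
  assumes "odd p" and reflect: "\<And>u k. u \<in> carrier R \<Longrightarrow> \<phi> u \<in> p_multiples p R k \<Longrightarrow> u \<in> p_multiples p R k"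
    and w: "w \<in> carrier R" "\<phi> w = w [^] p" "w \<ominus> \<one> \<in> p_multiples p R 1"
  shows "w = \<one>"
proof (rule p_multiples_all_eqI[OF w(1) one_closed w(3)])
  fix j assume j: "w \<ominus> \<one> \<in> p_multiples p R (Suc j)"
  let ?a = "w \<ominus> \<one>"
  have pa: "[p] \<cdot> ?a \<in> p_multiples p R (Suc (Suc j))" using p_multiples_add_pow[OF j, of 1] by simp
  have "\<phi> ?a = ((\<one> \<oplus> ?a) [^] p \<ominus> \<one> \<ominus> [p] \<cdot> ?a) \<oplus> [p] \<cdot> ?a"
  proof -
    have "y \<ominus> \<one> = (y \<ominus> \<one> \<ominus> x) \<oplus> x" if "x \<in> carrier R" "y \<in> carrier R" for x y
      using that one_closed by algebra
    then show ?thesis using w by (simp add: one_plus)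
  qed
  also have "\<dots> \<in> p_multiples p R (Suc (Suc j))"
    using power_one_plus_p_multiples(1)[OF j] pa by (rule p_multiples_add)
  finally show "?a \<in> p_multiples p R (Suc (Suc j))" using w(1) reflect[of ?a "Suc (Suc j)"] by simp
qed

text \<open>The power w^p is a multiple of w^2, which is more divisible by p than w is known to be;
  \<open>reflect\<close> transfers this from \<phi>(w) to w.\<close>

lemma frobenius_power_imp_zero:
  assumes reflect: "\<And>u k. u \<in> carrier R \<Longrightarrow> \<phi> u \<in> p_multiples p R k \<Longrightarrow> u \<in> p_multiples p R k"
    and w: "w \<in> carrier R" "\<phi> w = w [^] p" "w \<in> p_multiples p R 1"
  shows "w = \<zero>"
proof (rule p_multiples_all_eqI[OF w(1) zero_closed])
  show "w \<ominus> \<zero> \<in> p_multiples p R 1" using w by (simp add: minus_eq)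
  fix j assume j: "w \<ominus> \<zero> \<in> p_multiples p R (Suc j)"
  have "w \<in> p_multiples p R (Suc j)" using j w(1) by (simp add: minus_eq)
  then have "w \<otimes> w \<in> p_multiples p R (Suc (Suc j))"
    using p_multiples_antimono[OF _ p_multiples_mult[of w p "Suc j" w "Suc j"], of "Suc (Suc j)"] by simp
  moreover have "w [^] p = (w \<otimes> w) \<otimes> w [^] (p - 2)"
  proof -
    have "p = 2 + (p - 2)" using p_gt_1 by simp
    then have "w [^] p = w [^] (2 + (p - 2))" by (rule arg_cong)
    also have "\<dots> = w [^] (2::nat) \<otimes> w [^] (p - 2)" using w(1) by (rule nat_pow_mult[symmetric])
    finally show ?thesis using w(1) by (simp add: numeral_2_eq_2)
  qed
  ultimately have "\<phi> w \<in> p_multiples p R (Suc (Suc j))"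
    using p_multiples_rmult w by simp
  then show "w \<ominus> \<zero> \<in> p_multiples p R (Suc (Suc j))"
    using reflect[of w "Suc (Suc j)"] w(1) by (simp add: minus_eq)
qed

end

text \<open>Both composites contain the p-th power of \<phi>(b): one is that power plus p
  \<phi>(\<delta>'(b)), the other that power plus p \<delta>'(\<phi>(b)). The powers cancel, and
  torsion-freeness makes the quotient by p unique.\<close>

lemma curvature_eq:
  fixes R (structure)
  assumes "p_derivation_ring R p \<delta>" "p_derivation_ring R p \<delta>'" and b: "b \<in> carrier R"
  shows "curvature p R (frobenius_lift p R \<delta>) (frobenius_lift p R \<delta>') b =
    frobenius_lift p R \<delta> (\<delta>' b) \<ominus> \<delta>' (frobenius_lift p R \<delta> b)"
proof -
  interpret D: p_derivation_ring R p \<delta> by fact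
  interpret D': p_derivation_ring R p \<delta>' by fact
  note [simp] = b
  have eq: "[p] \<cdot> (D.\<phi> (\<delta>' b) \<ominus> \<delta>' (D.\<phi> b)) = D.\<phi> (D'.\<phi> b) \<ominus> D'.\<phi> (D.\<phi> b)"
  proof -
    have "D.\<phi> (D'.\<phi> b) = D.\<phi> b [^] p \<oplus> [p] \<cdot> D.\<phi> (\<delta>' b)"
      by (subst D'.frobenius_def) simp
    moreover have "D'.\<phi> (D.\<phi> b) = D.\<phi> b [^] p \<oplus> [p] \<cdot> \<delta>' (D.\<phi> b)"
      by (rule D'.frobenius_def)
    moreover have "x \<oplus> y \<ominus> (x \<oplus> z) = y \<ominus> z" if "x \<in> carrier R" "y \<in> carrier R" "z \<in> carrier R" for x y z
      using that by algebra
    ultimately show ?thesis by (simp add: D.add_pow_minus)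
  qed
  show ?thesis
    unfolding curvature_def
  proof (rule the_equality)
    show "D.\<phi> (\<delta>' b) \<ominus> \<delta>' (D.\<phi> b) \<in> carrier R \<and>
        [p] \<cdot> (D.\<phi> (\<delta>' b) \<ominus> \<delta>' (D.\<phi> b)) = D.\<phi> (D'.\<phi> b) \<ominus> D'.\<phi> (D.\<phi> b)"
      using eq by simp
    show "c = D.\<phi> (\<delta>' b) \<ominus> \<delta>' (D.\<phi> b)"
      if "c \<in> carrier R \<and> [p] \<cdot> c = D.\<phi> (D'.\<phi> b) \<ominus> D'.\<phi> (D.\<phi> b)" for c
      using that eq D.p_cancel[of c "D.\<phi> (\<delta>' b) \<ominus> \<delta>' (D.\<phi> b)"] by simp
  qed
qed

section \<open>The Frobenius lift of the base ring\<close>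

lemma ring_hom_cring_of_ring_hom:
  "cring R \<Longrightarrow> cring S \<Longrightarrow> h \<in> Ring.ring_hom R S \<Longrightarrow> ring_hom_cring R S h"
  by (simp add: ring_hom_cring_def ring_hom_cring_axioms_def)

lemma ring_hom_funpow: "h \<in> Ring.ring_hom R R \<Longrightarrow> (h ^^ k) \<in> Ring.ring_hom R R"
proof (induction k)
  case 0
  then show ?case by (simp flip: id_def)
next
  case (Suc k)
  then show ?case unfolding funpow.simps by (intro ring_hom_trans[of "h ^^ k" R R h R])
qed

text \<open>The entrywise p-th power does not respect matrix products, but it agrees modulo p with
  \<phi>, which does. Hence \<open>T\<close> is congruent to 1 and admits a binomial square root.
  Applied both to q over the completed base ring and to x^t q x over the completed coordinate
  ring.\<close>

lemma (in p_derivation_ring) matrix_frobenius: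
  assumes U: "U \<in> Units (matrix_ring n R)"
  defines "T \<equiv> inv\<^bsub>matrix_ring n R\<^esub> (map_mat \<phi> U) \<otimes>\<^bsub>matrix_ring n R\<^esub> entrywise_power R p U"
  shows "map_mat \<phi> U \<in> Units (matrix_ring n R)"
    "entrywise_power R p U \<in> carrier (matrix_ring n R)"
    "map_mat \<phi> U = entrywise_power R p U \<oplus>\<^bsub>matrix_ring n R\<^esub> [p] \<cdot>\<^bsub>matrix_ring n R\<^esub> map_mat \<delta> U"
    "map_mat \<delta> U \<in> carrier (matrix_ring n R)"
    "T \<in> carrier (matrix_ring n R)"
    "T \<ominus>\<^bsub>matrix_ring n R\<^esub> \<one>\<^bsub>matrix_ring n R\<^esub> \<in> p_multiples p (matrix_ring n R) 1"
proof -
  let ?E = "matrix_ring n R"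
  interpret E: ring ?E by (rule matrix_ring_ring)
  interpret m: ring_hom_ring ?E ?E "map_mat \<phi>" by (rule frob.matrix_hom_ring)
  have Uc: "U \<in> carrier ?E" using U by auto
  note e = matrix_ring_carrierD[OF Uc]
  show F: "map_mat \<phi> U \<in> Units ?E" by (rule m.hom_Units(1)[OF U])
  show P: "entrywise_power R p U \<in> carrier ?E"
    using e by (intro matrix_ring_carrierI) (simp_all add: entrywise_power_def)
  show D: "map_mat \<delta> U \<in> carrier ?E" using e by (intro matrix_ring_carrierI) simp_all
  show FP: "map_mat \<phi> U = entrywise_power R p U \<oplus>\<^bsub>?E\<^esub> [p] \<cdot>\<^bsub>?E\<^esub> map_mat \<delta> U"
    using e matrix_add_pow_index[OF D]
    by (intro eq_matI) (simp_all add: matrix_ring_simps(5) frobenius_def entrywise_power_def)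
  show "T \<in> carrier ?E" unfolding T_def using F P by simp
  have Fc: "map_mat \<phi> U \<in> carrier ?E" using F by auto
  have "T \<ominus>\<^bsub>?E\<^esub> \<one>\<^bsub>?E\<^esub> = inv\<^bsub>?E\<^esub> (map_mat \<phi> U) \<otimes>\<^bsub>?E\<^esub> entrywise_power R p U \<ominus>\<^bsub>?E\<^esub> inv\<^bsub>?E\<^esub> (map_mat \<phi> U) \<otimes>\<^bsub>?E\<^esub> map_mat \<phi> U"
    using F by (simp add: T_def)
  also have "\<dots> \<in> p_multiples p ?E 1"
  proof (rule E.p_multiples_mult_diff)
    have "x \<ominus>\<^bsub>?E\<^esub> (x \<oplus>\<^bsub>?E\<^esub> y) = \<ominus>\<^bsub>?E\<^esub> y" if "x \<in> carrier ?E" "y \<in> carrier ?E" for x y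
      using that by algebra
    from this[OF P E.add.nat_pow_closed[OF D, of p]]
    have "entrywise_power R p U \<ominus>\<^bsub>?E\<^esub> map_mat \<phi> U = \<ominus>\<^bsub>?E\<^esub> ([p] \<cdot>\<^bsub>?E\<^esub> map_mat \<delta> U)"
      by (simp add: FP)
    also have "\<dots> \<in> p_multiples p ?E 1"
      using p_multiples_mult_mem[OF D, of p 1] by (intro E.p_multiples_uminus) simp
    finally show "entrywise_power R p U \<ominus>\<^bsub>?E\<^esub> map_mat \<phi> U \<in> p_multiples p ?E 1" .
    show "inv\<^bsub>?E\<^esub> (map_mat \<phi> U) \<ominus>\<^bsub>?E\<^esub> inv\<^bsub>?E\<^esub> (map_mat \<phi> U) \<in> p_multiples p ?E 1"
      using F by (simp add: E.minus_eq E.r_neg)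
  qed (use F P Fc in simp_all)
  finally show "T \<ominus>\<^bsub>?E\<^esub> \<one>\<^bsub>?E\<^esub> \<in> p_multiples p ?E 1" .
qed

locale frobenius_base =
  fixes M N p :: nat and \<zeta> :: complex and A :: "complex ring" and \<delta>A :: "A_hat \<Rightarrow> A_hat"
  assumes M: "even M" "M > 0" and N: "N \<ge> 1" and \<zeta>: "primitive_root_of_unity N \<zeta>"
    and A_def: "A = base_ring M \<zeta>"
    and p: "prime p" and p_dvd: "\<not> p dvd M * N"
    and \<delta>A: "base_derivation p A \<zeta> \<delta>A"
begin

abbreviation "SA \<equiv> generate_ring class_ring {1 / of_nat M, \<zeta>}"
abbreviation "Ah \<equiv> p_completion p A"
abbreviation "\<iota> \<equiv> to_completion p A"

lemma A_eq: "A = subring_of SA"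
  by (simp add: A_def base_ring_def subring_of_def)

lemma A_simps:
  "carrier A = SA" "\<zero>\<^bsub>A\<^esub> = 0" "\<one>\<^bsub>A\<^esub> = 1" "a \<otimes>\<^bsub>A\<^esub> b = a * b" "a \<oplus>\<^bsub>A\<^esub> b = a + b"
  by (simp_all add: A_eq subring_of_simps)

lemma p_odd: "odd p"
  using p p_dvd M(1) by (metis dvd_mult2 even_mult_iff primes_dvd_imp_eq two_is_prime_nat)

sublocale SA: class_subring SA by (rule class_subring_generate)

sublocale A: p_torsion_free_cring A p
  unfolding A_eq using prime_gt_0_nat[OF p] by (intro SA.K_p_torsion_free prime_gt_1_nat[OF p]) simp

sublocale Ah: p_derivation_ring Ah p \<delta>A
proof (intro p_derivation_ring.intro p_derivation_ring_axioms.intro p_complete_cring.intro)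
  show "p_complete_ring Ah p" by (rule A.p_completion_p_complete)
  show "cring Ah" by (rule A.p_completion_cring)
  show "p_derivation p Ah \<delta>A" using \<delta>A by (simp add: base_derivation_def)
qed

sublocale \<iota>: ring_hom_cring A Ah \<iota>
  by (intro ring_hom_cring_of_ring_hom A.to_completion_hom) (rule A.cring_axioms Ah.cring_axioms)+

lemma matrix_binomial_Ah: "matrix_binomial Ah p SA \<iota>"
proof (intro matrix_binomial.intro matrix_binomial_axioms.intro)
  show "p_complete_ring Ah p" by (rule Ah.p_complete_ring_axioms)
  show "cring Ah" by (rule Ah.cring_axioms)
  show "subring SA class_ring" by (rule SA.S_subring)
  \<comment> \<open>One half is obtained as M/2 times 1/M, which is possible because M is
    even.\<close>
  have "of_nat (M div 2) * (1 / of_nat M :: complex) \<in> SA"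
    using SA.S_of_int[of "int (M div 2)"] by (intro SA.S_closed(5)) (auto intro: generate_ring.incl)
  moreover have "of_nat (M div 2) * (1 / of_nat M :: complex) = 1/2"
  proof -
    have "of_nat M = (2 * of_nat (M div 2) :: complex)" using M(1) by (metis dvd_mult_div_cancel of_nat_mult of_nat_numeral)
    then have "of_nat (M div 2) = (of_nat M / 2 :: complex)" by simp
    then show ?thesis using M(2) by (simp only:) simp
  qed
  ultimately show "1/2 \<in> SA" by (simp only:)
  show "\<iota> \<in> Ring.ring_hom (class_ring\<lparr>carrier := SA\<rparr>) Ah"
    using \<iota>.homh A_eq by (simp add: subring_of_def)
qed

lemma A_p_separated:
  assumes "\<And>k. a \<in> p_multiples p A k"
  shows "a = 0"
proof (rule cyclotomic_p_separated[of p M \<zeta> N])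
  show "\<not> p dvd M" using p_dvd by auto
  show "\<zeta> ^ N = 1" using \<zeta> by (simp add: primitive_root_of_unity_def)
  show "\<exists>b\<in>SA. a = of_nat p ^ k * b" for k
    using assms[of k] unfolding A_eq by (auto simp: p_multiples_def subring_of_simps subring_of_add_pow)
qed (use p M N in auto)

lemma \<iota>_inj: "a \<in> SA \<Longrightarrow> b \<in> SA \<Longrightarrow> \<iota> a = \<iota> b \<Longrightarrow> a = b"
  using A.to_completion_eq_iff[of a b] A_p_separated[of "a - b"] SA.K_minus[of a b]
  by (simp add: A_eq subring_of_simps)

lemma \<iota>_closed [simp]: "a \<in> SA \<Longrightarrow> \<iota> a \<in> carrier Ah"
  using \<iota>.hom_closed by (simp add: A_eq subring_of_simps)

lemma \<iota>_simps:
  "a \<in> SA \<Longrightarrow> \<iota> (a ^ k) = \<iota> a [^]\<^bsub>Ah\<^esub> k" "\<iota> 1 = \<one>\<^bsub>Ah\<^esub>" "\<iota> 0 = \<zero>\<^bsub>Ah\<^esub>"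
  using \<iota>.ring.hom_nat_pow[of a k] \<iota>.hom_one \<iota>.hom_zero
  by (simp_all add: A_eq subring_of_simps subring_of_pow)

text \<open>The value at \<zeta> is prescribed. The generator 1/M is fixed since a ring homomorphism
  fixes M and inverses are unique.\<close>

lemma frobenius_\<iota>_generators: "(Ah.\<phi> ^^ k) (\<iota> \<zeta>) = \<iota> (\<zeta> ^ (p ^ k))" "(Ah.\<phi> ^^ k) (\<iota> (1 / of_nat M)) = \<iota> (1 / of_nat M)"
proof -
  have z: "\<zeta> \<in> SA" and m: "1 / of_nat M \<in> SA" by (auto intro: generate_ring.incl)
  have "Ah.\<phi> (\<iota> \<zeta>) = \<iota> \<zeta> [^]\<^bsub>Ah\<^esub> p"
    using \<delta>A z by (simp add: base_derivation_def \<iota>_simps)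
  then have "Ah.\<phi> (\<iota> \<zeta> [^]\<^bsub>Ah\<^esub> (p ^ k)) = \<iota> \<zeta> [^]\<^bsub>Ah\<^esub> (p ^ Suc k)" for k
    using z by (simp add: Ah.nat_pow_pow mult.commute)
  then show "(Ah.\<phi> ^^ k) (\<iota> \<zeta>) = \<iota> (\<zeta> ^ (p ^ k))"
    using z by (induction k) (simp_all add: \<iota>_simps)
  let ?u = "\<iota> (1 / of_nat M)"
  have u: "?u \<in> carrier Ah" using m by simp
  have "\<iota> ([M] \<cdot>\<^bsub>A\<^esub> (1 / of_nat M)) = \<one>\<^bsub>Ah\<^esub>"
    using M(2) \<iota>_simps(2) by (simp add: A_eq subring_of_add_pow)
  then have Mu: "[M] \<cdot>\<^bsub>Ah\<^esub> ?u = \<one>\<^bsub>Ah\<^esub>"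
    using m \<iota>.ring.hom_add_pow[of "1 / of_nat M" M] by (simp add: A_eq subring_of_simps)
  then have "[M] \<cdot>\<^bsub>Ah\<^esub> Ah.\<phi> ?u = \<one>\<^bsub>Ah\<^esub>"
    using Ah.frob.hom_add_pow[OF u, of M] by simp
  \<comment> \<open>Both \<open>?u\<close> and its image are inverses of M; inserting M times the
    image exchanges one for the other.\<close>
  then have "?u = ?u \<otimes>\<^bsub>Ah\<^esub> ([M] \<cdot>\<^bsub>Ah\<^esub> Ah.\<phi> ?u)" using u by simp
  also have "\<dots> = ([M] \<cdot>\<^bsub>Ah\<^esub> ?u) \<otimes>\<^bsub>Ah\<^esub> Ah.\<phi> ?u"
    using u by (simp add: Ah.add_pow_ldistr Ah.add_pow_rdistr)
  finally have "Ah.\<phi> ?u = ?u" using Mu u by simp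
  then show "(Ah.\<phi> ^^ k) ?u = ?u" by (induction k) simp_all
qed

definition m :: nat where "m = totient N"

lemma m_pos: "m > 0" using N by (simp add: m_def)

text \<open>Since $p^m \equiv 1$ modulo $N$, the $m$-th power of the Frobenius lift fixes $\zeta$.\<close>

lemma frobenius_power_m:
  assumes "f \<in> carrier Ah"
  shows "(Ah.\<phi> ^^ m) f = f"
proof -
  have zN: "\<zeta> ^ N = 1" using \<zeta> by (simp add: primitive_root_of_unity_def)
  have "\<not> p dvd N" using p_dvd by auto
  then have "coprime p N" using p by (simp add: prime_imp_coprime)
  then have "[p ^ m = 1] (mod N)" unfolding m_def by (rule euler_theorem)
  then obtain j where j: "p ^ m = 1 + N * j"
    using prime_gt_0_nat[OF p] by (metis One_nat_def cong_to_1_nat dvdE le_add_diff_inverse Suc_leI zero_less_power cong_altdef_nat)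
  have z: "(Ah.\<phi> ^^ m) (\<iota> \<zeta>) = \<iota> \<zeta>"
    unfolding frobenius_\<iota>_generators(1) j using zN by (simp add: power_mult)
  have h: "(Ah.\<phi> ^^ m) \<in> Ring.ring_hom Ah Ah" by (rule ring_hom_funpow[OF Ah.frob.homh])
  have agree: "(Ah.\<phi> ^^ m) (\<iota> a) = \<iota> a" if "a \<in> SA" for a
  proof -
    have "((Ah.\<phi> ^^ m) \<circ> \<iota>) a = \<iota> a"
    proof (rule generate_ring_hom_eqI[OF Ah.ring_axioms _ _ _ that])
      show "(Ah.\<phi> ^^ m) \<circ> \<iota> \<in> Ring.ring_hom (subring_of SA) Ah" "\<iota> \<in> Ring.ring_hom (subring_of SA) Ah"
        using ring_hom_trans[OF \<iota>.homh h] \<iota>.homh by (simp_all add: A_eq)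
    qed (use z frobenius_\<iota>_generators(2) in auto)
    then show ?thesis by simp
  qed
  show ?thesis
    using A.completion_hom_eqI[OF h id_ring_hom Ah.p_complete_ring_axioms _ assms] agree
    by (simp add: A_eq subring_of_simps)
qed

text \<open>The inverse of \<phi> is its power with exponent m - 1, and this is again a
  homomorphism, so it preserves multiples of p^k.\<close>

lemma frobenius_reflects_p_multiples:
  assumes u: "u \<in> carrier Ah" "Ah.\<phi> u \<in> p_multiples p Ah k"
  shows "u \<in> p_multiples p Ah k"
proof -
  have "(Ah.\<phi> ^^ j) v \<in> p_multiples p Ah k" if "v \<in> p_multiples p Ah k" for j v
    using that by (induction j) (simp_all add: Ah.frob.hom_p_multiples)
  from this[OF u(2), of "m - 1"] have "(Ah.\<phi> ^^ Suc (m - 1)) u \<in> p_multiples p Ah k"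
    by (simp add: funpow_swap1)
  then show ?thesis using frobenius_power_m[OF u(1)] m_pos by simp
qed

lemma frobenius_eq_power_iff:
  assumes a: "a \<in> SA"
  shows "Ah.\<phi> (\<iota> a) = \<iota> a [^]\<^bsub>Ah\<^esub> p \<longleftrightarrow> a = 0 \<or> is_root_of_unity a"
proof
  assume f: "Ah.\<phi> (\<iota> a) = \<iota> a [^]\<^bsub>Ah\<^esub> p"
  have "(Ah.\<phi> ^^ k) (\<iota> a) = \<iota> a [^]\<^bsub>Ah\<^esub> (p ^ k)" for k
    using a f by (induction k) (simp_all add: Ah.nat_pow_pow mult.commute)
  then have "\<iota> (a ^ (p ^ m)) = \<iota> a" using a frobenius_power_m[of "\<iota> a"] by (simp add: \<iota>_simps)
  then have "a ^ (p ^ m) = a" using a by (intro \<iota>_inj SA.S_power) simp_all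
  \<comment> \<open>Writing p^m = k + 1 with positive k factors the equation as a (a^k - 1) = 0 in
    the complex numbers.\<close>
  moreover have "p ^ m > 1" by (rule one_less_power[OF prime_gt_1_nat[OF p] m_pos])
  then obtain k where "p ^ m = Suc k" "k > 0" by (cases "p ^ m") auto
  ultimately have "a * (a ^ k - 1) = 0" "k > 0" by (simp_all add: algebra_simps)
  then show "a = 0 \<or> is_root_of_unity a" by (auto simp: is_root_of_unity_def)
next
  assume "a = 0 \<or> is_root_of_unity a"
  then show "Ah.\<phi> (\<iota> a) = \<iota> a [^]\<^bsub>Ah\<^esub> p"
  proof
    assume "a = 0"
    then show ?thesis using Ah.p_gt_1 by (simp add: \<iota>_simps Ah.nat_pow_zero)
  next
    assume "is_root_of_unity a"
    then obtain k where k: "k > 0" "a ^ k = 1" by (auto simp: is_root_of_unity_def)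
    let ?u = "\<iota> a" let ?v = "\<iota> a [^]\<^bsub>Ah\<^esub> (k - 1)"
    have u: "?u \<in> carrier Ah" using a by simp
    have uk: "?u [^]\<^bsub>Ah\<^esub> k = \<one>\<^bsub>Ah\<^esub>" using a k(2) \<iota>_simps(1)[OF a, of k] by (simp add: \<iota>_simps)
    have "?u [^]\<^bsub>Ah\<^esub> Suc (k - 1) = \<one>\<^bsub>Ah\<^esub>" using uk k(1) by simp
    then have vu: "?v \<otimes>\<^bsub>Ah\<^esub> ?u = \<one>\<^bsub>Ah\<^esub>" by simp
    \<comment> \<open>Here \<open>?v\<close> is the inverse of \<open>?u\<close>, so
      \<open>c\<close> is the quotient of \<phi>(a) by a^p. Its k-th power is 1 because both factors
      are roots of unity of order dividing k.\<close>
    define c where "c = Ah.\<phi> ?u \<otimes>\<^bsub>Ah\<^esub> ?v [^]\<^bsub>Ah\<^esub> p"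
    have c: "c \<in> carrier Ah" using u by (simp add: c_def)
    have vup: "?v [^]\<^bsub>Ah\<^esub> p \<otimes>\<^bsub>Ah\<^esub> ?u [^]\<^bsub>Ah\<^esub> p = \<one>\<^bsub>Ah\<^esub>"
      using u vu by (simp flip: Ah.nat_pow_distrib)
    have "c = \<one>\<^bsub>Ah\<^esub>"
    proof (rule Ah.one_unit_root_of_unity[OF c _ _ k(1) p p_odd])
      have "Ah.\<phi> ?u \<otimes>\<^bsub>Ah\<^esub> ?v [^]\<^bsub>Ah\<^esub> p \<ominus>\<^bsub>Ah\<^esub> ?u [^]\<^bsub>Ah\<^esub> p \<otimes>\<^bsub>Ah\<^esub> ?v [^]\<^bsub>Ah\<^esub> p \<in> p_multiples p Ah 1"
        using u Ah.frobenius_cong[OF u] by (intro Ah.p_multiples_mult_diff) (simp_all add: Ah.minus_eq Ah.r_neg)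
      then show "c \<ominus>\<^bsub>Ah\<^esub> \<one>\<^bsub>Ah\<^esub> \<in> p_multiples p Ah 1"
        using vup u by (simp add: c_def Ah.m_comm)
      have "?v [^]\<^bsub>Ah\<^esub> k = \<one>\<^bsub>Ah\<^esub>"
        using uk u by (metis Ah.nat_pow_one Ah.nat_pow_pow mult.commute)
      moreover have "Ah.\<phi> ?u [^]\<^bsub>Ah\<^esub> k = \<one>\<^bsub>Ah\<^esub>"
        using Ah.frob.hom_nat_pow[OF u, of k] uk by simp
      moreover have "(?v [^]\<^bsub>Ah\<^esub> p) [^]\<^bsub>Ah\<^esub> k = (?v [^]\<^bsub>Ah\<^esub> k) [^]\<^bsub>Ah\<^esub> p"
        using u by (simp only: Ah.nat_pow_pow Ah.nat_pow_closed mult_ac)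
      ultimately show "c [^]\<^bsub>Ah\<^esub> k = \<one>\<^bsub>Ah\<^esub>"
        using u by (simp add: c_def Ah.nat_pow_distrib)
    qed
    then have "?u [^]\<^bsub>Ah\<^esub> p = c \<otimes>\<^bsub>Ah\<^esub> ?u [^]\<^bsub>Ah\<^esub> p" using u by simp
    also have "\<dots> = Ah.\<phi> ?u" using u vup by (simp add: c_def Ah.m_assoc)
    finally show ?thesis by simp
  qed
qed

end

section \<open>The curvature of the Chern connection\<close>

lemma (in ring) matrix_mult_dim1:
  assumes "U \<in> carrier (matrix_ring 1 R)" "V \<in> carrier (matrix_ring 1 R)"
  shows "(U \<otimes>\<^bsub>matrix_ring 1 R\<^esub> V) $$ (0, 0) = U $$ (0, 0) \<otimes> V $$ (0, 0)"
  using assms by (auto simp: matrix_ring_simps lessThan_Suc)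

lemma ring_hom_subring_of_mono:
  "f \<in> Ring.ring_hom (subring_of S) T \<Longrightarrow> S' \<subseteq> S \<Longrightarrow> f \<in> Ring.ring_hom (subring_of S') T"
  by (auto simp: Ring.ring_hom_def subring_of_simps Pi_def subset_iff)

locale chern_base = frobenius_base +
  fixes n :: nat and q :: "complex mat" and \<delta>p \<delta>q :: "GL_hat \<Rightarrow> GL_hat" and ev :: "GL_hat \<Rightarrow> A_hat"
  assumes q: "q \<in> Units (matrix_ring n A)"
    and chern: "chern_connection p A n \<delta>A q \<delta>p"
    and trivial: "trivial_connection p A n \<delta>A \<delta>q"
    and ev: "evaluation_at_one p A n ev"
begin

abbreviation "SG \<equiv> generate_ring class_ring
  (const_fun ` SA \<union> {coord_fun i j | i j. i < n \<and> j < n} \<union> {inverse (det (generic_matrix n))})"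
abbreviation "B \<equiv> GL_completion p A n"
abbreviation "\<gamma> \<equiv> to_completion p (GL_ring A n)"
abbreviation "s \<equiv> structure_map p A n"
abbreviation "X \<equiv> generic_matrix n"
abbreviation "x \<equiv> x_matrix p A n"
abbreviation "EA \<equiv> matrix_ring n Ah"
abbreviation "EB \<equiv> matrix_ring n B"

lemma G_eq: "GL_ring A n = subring_of SG"
  by (simp add: GL_ring_def subring_of_def A_eq)

lemma G_simps:
  "carrier (GL_ring A n) = SG" "\<zero>\<^bsub>GL_ring A n\<^esub> = 0" "\<one>\<^bsub>GL_ring A n\<^esub> = 1"
  "a \<otimes>\<^bsub>GL_ring A n\<^esub> b = a * b" "a \<oplus>\<^bsub>GL_ring A n\<^esub> b = a + b"
  unfolding G_eq by (simp_all add: subring_of_simps)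

sublocale SG: class_subring SG by (rule class_subring_generate)

sublocale G: p_torsion_free_cring "GL_ring A n" p
proof -
  have c: "of_nat p = const_fun (of_nat p)"
  proof -
    have "const_fun (of_nat k) = of_nat k" for k
      by (induction k) (simp_all add: const_fun_simps)
    then show ?thesis by simp
  qed
  \<comment> \<open>In a field, absence of p-torsion only requires that the constant p is not
    0.\<close>
  have "Poly_Mapping.single 0 (of_nat p :: complex) \<noteq> (0 :: (nat \<times> nat \<Rightarrow>\<^sub>0 nat) \<Rightarrow>\<^sub>0 complex)"
  proof
    assume z: "Poly_Mapping.single 0 (of_nat p :: complex) = (0 :: (nat \<times> nat \<Rightarrow>\<^sub>0 nat) \<Rightarrow>\<^sub>0 complex)"
    have "Poly_Mapping.lookup (Poly_Mapping.single 0 (of_nat p :: complex)) (0 :: nat \<times> nat \<Rightarrow>\<^sub>0 nat) = 0"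
      by (simp only: z lookup_zero)
    then show False unfolding lookup_single_eq using prime_gt_0_nat[OF p] by simp
  qed
  then have "const_fun (of_nat p) \<noteq> 0" unfolding const_fun_def to_fract_eq_0_iff .
  with c show "p_torsion_free_cring (GL_ring A n) p"
    unfolding G_eq by (intro SG.K_p_torsion_free prime_gt_1_nat[OF p]) simp
qed

sublocale B: p_complete_cring B p
  unfolding GL_completion_def
  by (intro p_complete_cring.intro G.p_completion_p_complete G.p_completion_cring)

sublocale BP: p_derivation_ring B p \<delta>p
  using chern by (intro p_derivation_ring.intro p_derivation_ring_axioms.intro B.p_complete_cring_axioms)
    (simp add: chern_connection_def Let_def)

sublocale BQ: p_derivation_ring B p \<delta>q
  using trivial by (intro p_derivation_ring.intro p_derivation_ring_axioms.intro B.p_complete_cring_axioms)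
    (simp add: trivial_connection_def)

sublocale const: ring_hom_cring A "GL_ring A n" const_fun
proof (intro ring_hom_cring_of_ring_hom A.cring_axioms G.cring_axioms ring_hom_memI)
  show "a \<in> carrier A \<Longrightarrow> const_fun a \<in> carrier (GL_ring A n)" for a
    by (auto simp: A_simps G_simps intro: generate_ring.incl)
qed (simp_all add: A_simps G_simps const_fun_simps)

sublocale s: ring_hom_cring Ah B s
  unfolding structure_map_def GL_completion_def
  by (intro ring_hom_cring_of_ring_hom const.completion_map_hom A.p_completion_cring G.p_completion_cring)

sublocale \<gamma>: ring_hom_cring "GL_ring A n" B \<gamma>
  unfolding GL_completion_def
  by (intro ring_hom_cring_of_ring_hom G.to_completion_hom G.cring_axioms G.p_completion_cring)

sublocale ev: ring_hom_cring B Ah ev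
  using ev B.cring_axioms Ah.cring_axioms
  by (intro ring_hom_cring_of_ring_hom) (simp_all add: evaluation_at_one_def)

sublocale EA: p_complete_ring EA p by (rule Ah.matrix_ring_p_complete)
sublocale Am: matrix_binomial Ah p SA \<iota> n by (rule matrix_binomial_Ah)
sublocale EB: p_complete_ring EB p by (rule B.matrix_ring_p_complete)
sublocale EV: ring_hom_ring EB EA "map_mat ev" by (rule ev.ring.matrix_hom_ring)
sublocale ES: ring_hom_ring EA EB "map_mat s" by (rule s.ring.matrix_hom_ring)
sublocale FA: ring_hom_ring EA EA "map_mat Ah.\<phi>" by (rule Ah.frob.matrix_hom_ring)
sublocale FQ: ring_hom_ring EB EB "map_mat BQ.\<phi>" by (rule BQ.frob.matrix_hom_ring)

sublocale Bm: matrix_binomial B p SA "s \<circ> \<iota>" n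
proof (intro matrix_binomial.intro matrix_binomial_axioms.intro)
  show "p_complete_ring B p" by (rule B.p_complete_ring_axioms)
  show "cring B" by (rule B.cring_axioms)
  show "subring SA class_ring" by (rule SA.S_subring)
  show "1/2 \<in> SA" by (rule Am.half_S)
  show "s \<circ> \<iota> \<in> Ring.ring_hom (class_ring\<lparr>carrier := SA\<rparr>) B"
    using ring_hom_trans[OF Am.c_hom s.homh] .
qed

lemma s_\<iota>: "a \<in> SA \<Longrightarrow> s (\<iota> a) = \<gamma> (const_fun a)"
  using const.completion_map_to_completion[of a p] by (simp add: structure_map_def A_simps)

lemma frobenius_s: "a \<in> carrier Ah \<Longrightarrow> BP.\<phi> (s a) = s (Ah.\<phi> a)" "a \<in> carrier Ah \<Longrightarrow> BQ.\<phi> (s a) = s (Ah.\<phi> a)"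
  using chern trivial
  by (simp_all add: chern_connection_def trivial_connection_def extends_base_frobenius_def Let_def)

lemma ev_s: "a \<in> carrier Ah \<Longrightarrow> ev (s a) = a"
  using ev by (simp add: evaluation_at_one_def)

lemma X_carrier: "X \<in> carrier_mat n n" by (simp add: generic_matrix_def)

lemma coord_SG: "i < n \<Longrightarrow> j < n \<Longrightarrow> X $$ (i, j) \<in> SG"
  by (auto simp: generic_matrix_def intro!: generate_ring.incl)

lemma X_Units: "X \<in> Units (matrix_ring n (GL_ring A n))"
  unfolding G_eq
proof (rule SG.K_matrix_Units[OF X_carrier coord_SG])
  show "inverse (det X) \<in> SG" by (intro generate_ring.incl) simp
  show "inverse (det X) * det X = 1" using det_generic_matrix_nonzero[of n] by simp
qed

lemma x_Units: "x \<in> Units EB"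
proof -
  interpret m: ring_hom_ring "matrix_ring n (GL_ring A n)" EB "map_mat \<gamma>" by (rule \<gamma>.ring.matrix_hom_ring)
  show ?thesis unfolding x_matrix_def by (rule m.hom_Units(1)[OF X_Units])
qed

lemma x_closed: "x \<in> carrier EB" using x_Units by auto

lemmas x_index = matrix_ring_carrierD[OF x_closed]

lemma x_entry: "i < n \<Longrightarrow> j < n \<Longrightarrow> x $$ (i, j) = \<gamma> (X $$ (i, j))"
  using X_carrier by (simp add: x_matrix_def)

text \<open>
  The values at $\det(x)^{-1}$ agree because inverses are unique; $\det(x)$ itself lies in the
  subring generated by the constants and the coordinates.
\<close>

lemma B_hom_eqI:
  assumes T: "p_complete_ring T p" and h: "h \<in> Ring.ring_hom B T" "h' \<in> Ring.ring_hom B T"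
    and s: "\<And>a. a \<in> carrier Ah \<Longrightarrow> h (s a) = h' (s a)"
    and x: "\<And>i j. i < n \<Longrightarrow> j < n \<Longrightarrow> h (x $$ (i, j)) = h' (x $$ (i, j))"
    and b: "b \<in> carrier B"
  shows "h b = h' b"
proof -
  interpret T: p_complete_ring T p by fact
  let ?C = "const_fun ` SA \<union> {coord_fun i j | i j. i < n \<and> j < n}"
  let ?SP = "generate_ring class_ring ?C"
  interpret SP: class_subring ?SP by (rule class_subring_generate)
  have g: "h \<circ> \<gamma> \<in> Ring.ring_hom (subring_of SG) T" "h' \<circ> \<gamma> \<in> Ring.ring_hom (subring_of SG) T"
    using ring_hom_trans[OF \<gamma>.homh h(1)] ring_hom_trans[OF \<gamma>.homh h(2)] by (simp_all add: G_eq)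
  have SP_SG: "?SP \<subseteq> SG"
    by (rule ring.generate_ring_min_subring1[OF class_ring.ring_axioms _ SG.S_subring])
      (auto intro: generate_ring.incl)
  have restrict: "f \<in> Ring.ring_hom (subring_of ?SP) T" if "f \<in> Ring.ring_hom (subring_of SG) T" for f
    by (rule ring_hom_subring_of_mono[OF that SP_SG])
  have C: "(h \<circ> \<gamma>) g = (h' \<circ> \<gamma>) g" if "g \<in> ?C" for g
  proof -
    from that consider a where "a \<in> SA" "g = const_fun a" | i j where "i < n" "j < n" "g = coord_fun i j"
      by blast
    then show ?thesis
    proof cases
      case 1
      then show ?thesis using s[of "\<iota> a"] by (simp add: s_\<iota>)
    next
      case 2
      then show ?thesis using x[of i j] by (simp add: x_entry generic_matrix_def)
    qed
  qed
  have SP_eq: "(h \<circ> \<gamma>) g = (h' \<circ> \<gamma>) g" if "g \<in> ?SP" for g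
    by (rule generate_ring_hom_eqI[OF T.ring_axioms restrict[OF g(1)] restrict[OF g(2)] C that])
  have "coord_fun i j \<in> ?SP" if "i < n" "j < n" for i j using that by (auto intro!: generate_ring.incl)
  then have det: "det X \<in> ?SP" by (intro SP.S_det[OF X_carrier]) (simp add: generic_matrix_def)
  have inv: "(h \<circ> \<gamma>) (inverse (det X)) = (h' \<circ> \<gamma>) (inverse (det X))"
  proof -
    have SG: "det X \<in> SG" "inverse (det X) \<in> SG" using det SP_SG by (auto intro: generate_ring.incl)
    have one: "det X * inverse (det X) = 1" "inverse (det X) * det X = 1"
      using det_generic_matrix_nonzero[of n] by simp_all
    have c: "f (inverse (det X)) \<in> carrier T" "f (det X) \<in> carrier T"
      "f (det X) \<otimes>\<^bsub>T\<^esub> f (inverse (det X)) = \<one>\<^bsub>T\<^esub>" "f (inverse (det X)) \<otimes>\<^bsub>T\<^esub> f (det X) = \<one>\<^bsub>T\<^esub>"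
      if "f \<in> Ring.ring_hom (subring_of SG) T" for f
      using ring_hom_closed[OF that] ring_hom_mult[OF that, of "det X" "inverse (det X)"]
        ring_hom_mult[OF that, of "inverse (det X)" "det X"] ring_hom_one[OF that] SG one
      by (simp_all add: subring_of_simps)
    show ?thesis
      using c[OF g(1)] c[OF g(2)] SP_eq[OF det] T.inv_unique by metis
  qed
  have "h (\<gamma> g) = h' (\<gamma> g)" if "g \<in> SG" for g
    using generate_ring_hom_eqI[OF T.ring_axioms g _ that] C inv by auto
  then show ?thesis
    using G.completion_hom_eqI[of h T h' b] T h b by (simp add: GL_completion_def G_simps)
qed

lemma \<delta>q_x: "i < n \<Longrightarrow> j < n \<Longrightarrow> \<delta>q (x $$ (i, j)) = \<zero>\<^bsub>B\<^esub>"
proof -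
  assume ij: "i < n" "j < n"
  have "map_mat \<delta>q x = \<zero>\<^bsub>EB\<^esub>" using trivial by (simp add: trivial_connection_def)
  then have "map_mat \<delta>q x $$ (i, j) = \<zero>\<^bsub>EB\<^esub> $$ (i, j)" by simp
  then show "\<delta>q (x $$ (i, j)) = \<zero>\<^bsub>B\<^esub>" using ij x_index by (simp add: matrix_ring_simps)
qed

lemma \<phi>q_x: "i < n \<Longrightarrow> j < n \<Longrightarrow> BQ.\<phi> (x $$ (i, j)) = x $$ (i, j) [^]\<^bsub>B\<^esub> p"
  using BQ.derivation_eq_0_iff[OF x_index(4)] \<delta>q_x by simp

abbreviation "xp \<equiv> entrywise_power B p x"

lemma xp_eq: "xp = map_mat BQ.\<phi> x"
  using x_index \<phi>q_x by (intro eq_matI) (simp_all add: entrywise_power_def)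

lemma ev_x: "map_mat ev x = \<one>\<^bsub>EA\<^esub>"
  using ev by (simp add: evaluation_at_one_def)

text \<open>Both sides are homomorphisms that agree on constants. On x they agree because the
  entries of the identity matrix are 0 and 1, which are fixed both by \<phi> and by p-th
  powers.\<close>

lemma ev_\<phi>q: "b \<in> carrier B \<Longrightarrow> ev (BQ.\<phi> b) = Ah.\<phi> (ev b)"
proof -
  have "(ev \<circ> BQ.\<phi>) b = (Ah.\<phi> \<circ> ev) b" if b: "b \<in> carrier B" for b
  proof (rule B_hom_eqI[OF Ah.p_complete_ring_axioms _ _ _ _ b])
    show "ev \<circ> BQ.\<phi> \<in> Ring.ring_hom B Ah" by (rule ring_hom_trans[OF BQ.frob.homh ev.homh])
    show "Ah.\<phi> \<circ> ev \<in> Ring.ring_hom B Ah" by (rule ring_hom_trans[OF ev.homh Ah.frob.homh])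
    show "(ev \<circ> BQ.\<phi>) (s a) = (Ah.\<phi> \<circ> ev) (s a)" if "a \<in> carrier Ah" for a
      using that by (simp add: frobenius_s ev_s)
    show "(ev \<circ> BQ.\<phi>) (x $$ (i, j)) = (Ah.\<phi> \<circ> ev) (x $$ (i, j))" if ij: "i < n" "j < n" for i j
    proof -
      have "ev (x $$ (i, j)) = map_mat ev x $$ (i, j)" using ij x_index by simp
      then have e: "ev (x $$ (i, j)) = (if i = j then \<one>\<^bsub>Ah\<^esub> else \<zero>\<^bsub>Ah\<^esub>)"
        using ij by (simp add: ev_x matrix_ring_simps)
      have "ev (BQ.\<phi> (x $$ (i, j))) = ev (x $$ (i, j)) [^]\<^bsub>Ah\<^esub> p"
        using ij x_index(4) by (simp add: \<phi>q_x)
      also have "\<dots> = Ah.\<phi> (ev (x $$ (i, j)))"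
        unfolding e using Ah.p_gt_1 by (simp add: Ah.nat_pow_zero)
      finally show ?thesis by simp
    qed
  qed
  then show "b \<in> carrier B \<Longrightarrow> ev (BQ.\<phi> b) = Ah.\<phi> (ev b)" by simp
qed

lemma ev_\<delta>q:
  assumes b: "b \<in> carrier B"
  shows "ev (\<delta>q b) = \<delta>A (ev b)"
proof -
  have "Ah.\<phi> (ev b) = ev (BQ.\<phi> b)" using ev_\<phi>q[OF b] by simp
  also have "\<dots> = ev b [^]\<^bsub>Ah\<^esub> p \<oplus>\<^bsub>Ah\<^esub> [p] \<cdot>\<^bsub>Ah\<^esub> ev (\<delta>q b)"
    unfolding BQ.frobenius_def using b by simp
  finally show ?thesis using Ah.derivation_eq_iff[of "ev b" "ev (\<delta>q b)"] b by simp
qed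

definition "qA = map_mat \<iota> q"
text \<open>The matrix x^t q x. Its image under the Frobenius lift of the trivial connection is
  x^{(p)t} \<phi>(q) x^{(p)}, so \<open>V\<close> is precisely the matrix under the square root in
  the Chern connection. At x = 1 it specialises to \<open>T\<close>.\<close>

definition "Q = transpose_mat x \<otimes>\<^bsub>EB\<^esub> map_mat s qA \<otimes>\<^bsub>EB\<^esub> x"
definition "V = inv\<^bsub>EB\<^esub> (map_mat BQ.\<phi> Q) \<otimes>\<^bsub>EB\<^esub> entrywise_power B p Q"
definition "S = matrix_binomial_power p B n (s \<circ> \<iota>) (1/2) V"
definition "T = inv\<^bsub>EA\<^esub> (map_mat Ah.\<phi> qA) \<otimes>\<^bsub>EA\<^esub> entrywise_power Ah p qA"
definition "W = map_mat ev S"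

lemma q_entry: "i < n \<Longrightarrow> j < n \<Longrightarrow> q $$ (i, j) \<in> SA"
  and q_carrier: "q \<in> carrier_mat n n"
  using q by (auto simp: Units_def matrix_ring_simps A_simps)

lemma qA_Units: "qA \<in> Units EA"
proof -
  interpret m: ring_hom_ring "matrix_ring n A" EA "map_mat \<iota>" by (rule \<iota>.ring.matrix_hom_ring)
  show ?thesis unfolding qA_def by (rule m.hom_Units(1)[OF q])
qed

lemma qA_closed: "qA \<in> carrier EA" using qA_Units by auto

lemma Q_Units: "Q \<in> Units EB"
  unfolding Q_def
  by (intro EB.Units_m_closed B.matrix_transpose_Units x_Units ES.hom_Units(1)[OF qA_Units])

lemma Q_closed: "Q \<in> carrier EB" using Q_Units by auto

lemma frobenius_Q:
  "map_mat BQ.\<phi> Q = transpose_mat xp \<otimes>\<^bsub>EB\<^esub> map_mat s (map_mat Ah.\<phi> qA) \<otimes>\<^bsub>EB\<^esub> xp"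
proof -
  have c: "transpose_mat x \<in> carrier EB" "map_mat s qA \<in> carrier EB"
    using B.matrix_transpose_closed[OF x_closed] ES.hom_closed[OF qA_closed] by auto
  have "map_mat BQ.\<phi> (map_mat s qA) = map_mat s (map_mat Ah.\<phi> qA)"
    using matrix_ring_carrierD[OF qA_closed] by (intro eq_matI) (simp_all add: frobenius_s)
  moreover have "map_mat BQ.\<phi> (transpose_mat x) = transpose_mat xp"
    using x_index by (intro eq_matI) (simp_all add: xp_eq)
  ultimately show ?thesis
    unfolding Q_def using c x_closed by (simp add: FQ.hom_mult xp_eq)
qed

lemma chern_frobenius: "map_mat BP.\<phi> x = xp \<otimes>\<^bsub>EB\<^esub> S"
proof -
  have 1: "map_mat (s \<circ> \<iota>) q = map_mat s qA"
    "map_mat (s \<circ> Ah.\<phi> \<circ> \<iota>) q = map_mat s (map_mat Ah.\<phi> qA)"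
    by (auto simp: qA_def intro!: eq_matI)
  show ?thesis
    using chern unfolding chern_connection_def Let_def 1 S_def V_def frobenius_Q by (simp add: Q_def)
qed

lemma V: "V \<in> carrier EB" "V \<ominus>\<^bsub>EB\<^esub> \<one>\<^bsub>EB\<^esub> \<in> p_multiples p EB 1"
  unfolding V_def using BQ.matrix_frobenius(5,6)[OF Q_Units] by simp_all

lemma S: "S \<in> carrier EB" "S \<ominus>\<^bsub>EB\<^esub> \<one>\<^bsub>EB\<^esub> \<in> p_multiples p EB 1" "S \<otimes>\<^bsub>EB\<^esub> S = V"
  unfolding S_def using Bm.matrix_binomial_power_closed[OF V, of "1/2"] Bm.matrix_binomial_power_half[OF V] by simp_all

lemma ev_Q: "map_mat ev Q = qA"
proof -
  have "map_mat ev (transpose_mat x) = transpose_mat (map_mat ev x)"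
    using x_index by (intro eq_matI) simp_all
  also have "\<dots> = \<one>\<^bsub>EA\<^esub>" unfolding ev_x by (intro eq_matI) (auto simp: matrix_ring_simps)
  finally have 1: "map_mat ev (transpose_mat x) = \<one>\<^bsub>EA\<^esub>" .
  have 2: "map_mat ev (map_mat s qA) = qA"
    using matrix_ring_carrierD[OF qA_closed] by (intro eq_matI) (simp_all add: ev_s)
  show ?thesis
    unfolding Q_def using B.matrix_transpose_closed[OF x_closed] ES.hom_closed[OF qA_closed] x_closed qA_closed
    by (simp add: EV.hom_mult 1 2 ev_x)
qed

lemma ev_V: "map_mat ev V = T"
proof -
  have F: "map_mat ev (map_mat BQ.\<phi> Q) = map_mat Ah.\<phi> qA"
  proof -
    have "map_mat ev (map_mat BQ.\<phi> Q) = map_mat Ah.\<phi> (map_mat ev Q)"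
      using matrix_ring_carrierD[OF Q_closed] by (intro eq_matI) (simp_all add: ev_\<phi>q)
    then show ?thesis by (simp add: ev_Q)
  qed
  have P: "map_mat ev (entrywise_power B p Q) = entrywise_power Ah p qA"
  proof -
    have "map_mat ev (entrywise_power B p Q) = entrywise_power Ah p (map_mat ev Q)"
      using matrix_ring_carrierD[OF Q_closed] by (intro eq_matI) (simp_all add: entrywise_power_def)
    then show ?thesis by (simp add: ev_Q)
  qed
  note m = BQ.matrix_frobenius[OF Q_Units]
  show ?thesis
    unfolding V_def T_def using m(1,2) EV.hom_Units(2)[OF m(1)]
    by (simp add: F P)
qed

lemma W: "W \<in> carrier EA" "W \<ominus>\<^bsub>EA\<^esub> \<one>\<^bsub>EA\<^esub> \<in> p_multiples p EA 1" "W \<otimes>\<^bsub>EA\<^esub> W = T"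
  using EV.hom_closed[OF S(1)] EV.hom_p_multiples[OF S(2)] EV.hom_mult[OF S(1) S(1)] S ev_V
  by (simp_all add: W_def)

lemmas T = Ah.matrix_frobenius(5,6)[OF qA_Units, folded T_def]
lemmas qA_frobenius = Ah.matrix_frobenius(1-4)[OF qA_Units]

lemma frobenius_mult_T: "map_mat Ah.\<phi> qA \<otimes>\<^bsub>EA\<^esub> T = entrywise_power Ah p qA"
proof -
  have "map_mat Ah.\<phi> qA \<otimes>\<^bsub>EA\<^esub> T =
      (map_mat Ah.\<phi> qA \<otimes>\<^bsub>EA\<^esub> inv\<^bsub>EA\<^esub> (map_mat Ah.\<phi> qA)) \<otimes>\<^bsub>EA\<^esub> entrywise_power Ah p qA"
    unfolding T_def
    by (rule EA.m_assoc[symmetric, OF EA.Units_closed[OF qA_frobenius(1)]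
          EA.Units_inv_closed[OF qA_frobenius(1)] qA_frobenius(2)])
  then show ?thesis using qA_frobenius(1,2) by simp
qed

text \<open>Invertibility of q does not pass directly to its entrywise powers. It follows from the
  factorisation into \<phi>(q) and \<open>T\<close>, where \<open>T\<close> is invertible as it is
  congruent to 1 modulo p.\<close>

lemma qp_Units: "entrywise_power Ah p qA \<in> Units EA"
  using EA.Units_m_closed[OF qA_frobenius(1) Am.V_Units[OF T]] by (simp add: frobenius_mult_T)

lemma ev_x\<phi>: "map_mat ev (map_mat BP.\<phi> x) = W"
proof -
  have xp: "xp \<in> carrier EB" unfolding xp_eq using x_closed by simp
  have "map_mat ev xp = map_mat Ah.\<phi> (map_mat ev x)"
    unfolding xp_eq using x_index by (intro eq_matI) (simp_all add: ev_\<phi>q)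
  also have "\<dots> = \<one>\<^bsub>EA\<^esub>" by (simp add: ev_x)
  finally show ?thesis
    unfolding chern_frobenius using xp S(1) W(1) by (simp add: W_def)
qed

lemma curvature_x:
  assumes "i < n" "j < n"
  shows "curvature p B BP.\<phi> BQ.\<phi> (x $$ (i, j)) = \<ominus>\<^bsub>B\<^esub> \<delta>q (BP.\<phi> (x $$ (i, j)))"
  using curvature_eq[OF BP.p_derivation_ring_axioms BQ.p_derivation_ring_axioms x_index(4)[OF assms]]
    \<delta>q_x[OF assms] x_index(4)[OF assms] by (simp add: B.minus_eq)

abbreviation "\<Phi> \<equiv> map_mat (curvature p B BP.\<phi> BQ.\<phi>) x"
abbreviation "\<Phi>1 \<equiv> map_mat ev \<Phi>"

lemma \<Phi>1_index:
  assumes "i < n" "j < n"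
  shows "\<Phi>1 $$ (i, j) = \<ominus>\<^bsub>Ah\<^esub> \<delta>A (W $$ (i, j))"
proof -
  have "W $$ (i, j) = ev (BP.\<phi> (x $$ (i, j)))"
    unfolding ev_x\<phi>[symmetric] using assms x_index by simp
  then show ?thesis
    using assms x_index by (simp add: curvature_x ev_\<delta>q)
qed

lemma \<delta>W_closed: "map_mat \<delta>A W \<in> carrier EA"
  using matrix_ring_carrierD[OF W(1)] by (intro matrix_ring_carrierI) simp_all

lemma \<Phi>1_eq: "\<Phi>1 = \<ominus>\<^bsub>EA\<^esub> map_mat \<delta>A W"
proof (rule eq_matI)
  note m = matrix_ring_carrierD[OF EA.a_inv_closed[OF \<delta>W_closed]]
  fix i j assume "i < dim_row (\<ominus>\<^bsub>EA\<^esub> map_mat \<delta>A W)" "j < dim_col (\<ominus>\<^bsub>EA\<^esub> map_mat \<delta>A W)"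
  then have ij: "i < n" "j < n" using m by simp_all
  show "\<Phi>1 $$ (i, j) = (\<ominus>\<^bsub>EA\<^esub> map_mat \<delta>A W) $$ (i, j)"
    unfolding \<Phi>1_index[OF ij] Ah.matrix_a_inv_index[OF \<delta>W_closed ij]
    using ij matrix_ring_carrierD[OF W(1)] by simp
qed (use x_index matrix_ring_carrierD[OF EA.a_inv_closed[OF \<delta>W_closed]] in simp_all)

text \<open>The matrix raised to the power -1/2 in the first assertion; it is the inverse of
  \<open>T\<close>.\<close>

definition "V' = \<one>\<^bsub>EA\<^esub> \<oplus>\<^bsub>EA\<^esub> [p] \<cdot>\<^bsub>EA\<^esub> (inv\<^bsub>EA\<^esub> (entrywise_power Ah p qA) \<otimes>\<^bsub>EA\<^esub> map_mat \<delta>A qA)"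

lemma W_eq: "W = matrix_binomial_power p Ah n \<iota> (- 1/2) V'"
proof -
  let ?P = "entrywise_power Ah p qA" and ?F = "map_mat Ah.\<phi> qA" and ?D = "map_mat \<delta>A qA"
  let ?W = "matrix_binomial_power p Ah n \<iota> (- 1/2) V'"
  have c: "?P \<in> carrier EA" "?D \<in> carrier EA" "inv\<^bsub>EA\<^esub> ?P \<in> carrier EA" "?F \<in> carrier EA" "inv\<^bsub>EA\<^esub> ?F \<in> carrier EA"
    using qA_frobenius qp_Units by auto
  have V': "V' = inv\<^bsub>EA\<^esub> ?P \<otimes>\<^bsub>EA\<^esub> ?F"
    unfolding V'_def qA_frobenius(3) using c qp_Units by (simp add: EA.r_distr EA.add_pow_rdistr)
  have V'c: "V' \<in> carrier EA" unfolding V' using c by simp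
  have "V' \<ominus>\<^bsub>EA\<^esub> \<one>\<^bsub>EA\<^esub> = [p] \<cdot>\<^bsub>EA\<^esub> (inv\<^bsub>EA\<^esub> ?P \<otimes>\<^bsub>EA\<^esub> ?D)"
  proof -
    have "\<one>\<^bsub>EA\<^esub> \<oplus>\<^bsub>EA\<^esub> y \<ominus>\<^bsub>EA\<^esub> \<one>\<^bsub>EA\<^esub> = y" if "y \<in> carrier EA" for y
      using that EA.one_closed by algebra
    then show ?thesis unfolding V'_def using c by simp
  qed
  then have V'1: "V' \<ominus>\<^bsub>EA\<^esub> \<one>\<^bsub>EA\<^esub> \<in> p_multiples p EA 1"
    using p_multiples_mult_mem[of "inv\<^bsub>EA\<^esub> ?P \<otimes>\<^bsub>EA\<^esub> ?D" EA p 1] c by simp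
  have W': "?W \<in> carrier EA" "?W \<ominus>\<^bsub>EA\<^esub> \<one>\<^bsub>EA\<^esub> \<in> p_multiples p EA 1"
    using Am.matrix_binomial_power_closed[OF V'c V'1, of "-1/2"] by simp_all
  have "V' \<otimes>\<^bsub>EA\<^esub> T = inv\<^bsub>EA\<^esub> ?P \<otimes>\<^bsub>EA\<^esub> (?F \<otimes>\<^bsub>EA\<^esub> T)"
    unfolding V' using c T(1) by (simp add: EA.m_assoc)
  then have VT: "V' \<otimes>\<^bsub>EA\<^esub> T = \<one>\<^bsub>EA\<^esub>" using qp_Units by (simp add: frobenius_mult_T)
  \<comment> \<open>Inserting the product of \<open>V'\<close> and \<open>T\<close>, which is 1,
    leaves \<open>T\<close> after cancelling the square of \<open>?W\<close> against
    \<open>V'\<close>.\<close>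
  have "?W \<otimes>\<^bsub>EA\<^esub> ?W = (?W \<otimes>\<^bsub>EA\<^esub> ?W) \<otimes>\<^bsub>EA\<^esub> (V' \<otimes>\<^bsub>EA\<^esub> T)" using VT W' by simp
  also have "\<dots> = (?W \<otimes>\<^bsub>EA\<^esub> ?W \<otimes>\<^bsub>EA\<^esub> V') \<otimes>\<^bsub>EA\<^esub> T" using W' V'c T(1) by (simp add: EA.m_assoc)
  also have "\<dots> = T" using Am.V_inverse_square(1)[OF V'c V'1] T(1) by simp
  finally show ?thesis using EA.square_root_unique[OF p_odd W(1) W'(1) W(2) W'(2)] W(3) by simp
qed

text \<open>If \<open>T\<close> is 1, then 1 and \<open>W\<close> are both square roots of it
  congruent to 1 modulo p. And \<open>T\<close> is 1 exactly when \<phi> acts on the entries of q as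
  the p-th power.\<close>

lemma W_eq_one_iff:
  "W = \<one>\<^bsub>EA\<^esub> \<longleftrightarrow> (\<forall>i<n. \<forall>j<n. q $$ (i, j) = 0 \<or> is_root_of_unity (q $$ (i, j)))"
proof -
  have "W = \<one>\<^bsub>EA\<^esub> \<longleftrightarrow> T = \<one>\<^bsub>EA\<^esub>"
    using W EA.square_root_unique[OF p_odd W(1) EA.one_closed W(2)] by (auto simp: EA.minus_eq EA.r_neg)
  also have "\<dots> \<longleftrightarrow> map_mat Ah.\<phi> qA = entrywise_power Ah p qA"
    using frobenius_mult_T qA_frobenius(1) by (auto simp: T_def)
  also have "\<dots> \<longleftrightarrow> (\<forall>i<n. \<forall>j<n. Ah.\<phi> (\<iota> (q $$ (i, j))) = \<iota> (q $$ (i, j)) [^]\<^bsub>Ah\<^esub> p)"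
    using q_carrier by (auto simp: mat_eq_iff qA_def entrywise_power_def)
  also have "\<dots> \<longleftrightarrow> (\<forall>i<n. \<forall>j<n. q $$ (i, j) = 0 \<or> is_root_of_unity (q $$ (i, j)))"
    using frobenius_eq_power_iff[OF q_entry] by simp
  finally show ?thesis .
qed

lemma \<Phi>1_eq_zero_iff:
  "\<Phi>1 = \<zero>\<^bsub>EA\<^esub> \<longleftrightarrow> (\<forall>i<n. \<forall>j<n. q $$ (i, j) = 0 \<or> is_root_of_unity (q $$ (i, j)))"
proof -
  note w = matrix_ring_carrierD[OF W(1)]
  have "\<Phi>1 = \<zero>\<^bsub>EA\<^esub> \<longleftrightarrow> map_mat \<delta>A W = \<zero>\<^bsub>EA\<^esub>"
    unfolding \<Phi>1_eq using \<delta>W_closed by (metis EA.minus_minus EA.minus_zero)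
  also have "\<dots> \<longleftrightarrow> (\<forall>i<n. \<forall>j<n. \<delta>A (W $$ (i, j)) = \<zero>\<^bsub>Ah\<^esub>)"
    using w by (auto simp: mat_eq_iff matrix_ring_simps)
  also have "\<dots> \<longleftrightarrow> W = \<one>\<^bsub>EA\<^esub>"
  proof
    assume d: "\<forall>i<n. \<forall>j<n. \<delta>A (W $$ (i, j)) = \<zero>\<^bsub>Ah\<^esub>"
    show "W = \<one>\<^bsub>EA\<^esub>"
    proof (rule matrix_ring_eqI[OF W(1) EA.one_closed])
      fix i j assume ij: "i < n" "j < n"
      have f: "Ah.\<phi> (W $$ (i, j)) = W $$ (i, j) [^]\<^bsub>Ah\<^esub> p"
        using Ah.derivation_eq_0_iff[OF w(4)[OF ij]] d ij by simp
      \<comment> \<open>Diagonal entries are thus congruent to 1 and all others to 0 modulo p, which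
        decides between the two rigidity lemmas.\<close>
      have "W $$ (i, j) \<ominus>\<^bsub>Ah\<^esub> \<one>\<^bsub>EA\<^esub> $$ (i, j) \<in> p_multiples p Ah 1"
        unfolding Ah.matrix_minus_index[OF W(1) EA.one_closed ij, symmetric]
        using W(2) ij by (simp add: Ah.p_multiples_matrix_ring)
      then show "W $$ (i, j) = \<one>\<^bsub>EA\<^esub> $$ (i, j)"
        using ij w(4)[OF ij] f Ah.frobenius_power_imp_one[OF p_odd frobenius_reflects_p_multiples, of "W $$ (i, j)"]
          Ah.frobenius_power_imp_zero[OF frobenius_reflects_p_multiples, of "W $$ (i, j)"]
        by (simp add: matrix_ring_simps Ah.minus_eq split: if_splits)
    qed
  qed (auto simp: matrix_ring_simps)
  finally show ?thesis using W_eq_one_iff by simp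
qed

section \<open>The case n = 1\<close>

context
  assumes n1: "n = 1"
begin

lemma n_pos: "0 < n" using n1 by simp

lemma xp_closed: "xp \<in> carrier EB"
  unfolding xp_eq using x_closed by simp

text \<open>For one variable, \<phi>(x^t q x) = x^{2p} \<phi>(q) and the p-th power of x^t q x is
  x^{2p} q^p. The powers of x cancel in \<open>V\<close>, which is therefore constant, and
  uniqueness of the root makes \<open>S\<close> constant.\<close>

lemma S_dim1: "S = map_mat s W"
proof (rule EB.square_root_unique[OF p_odd S(1) _ S(2)])
  let ?F = "map_mat s (map_mat Ah.\<phi> qA)" and ?T = "map_mat s T" and ?P = "entrywise_power B p Q"
  show "map_mat s W \<in> carrier EB" using W(1) by (rule ES.hom_closed)
  show "map_mat s W \<ominus>\<^bsub>EB\<^esub> \<one>\<^bsub>EB\<^esub> \<in> p_multiples p EB 1"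
    using ES.hom_p_multiples[OF W(2)] W(1) by simp
  have W2: "map_mat s W \<otimes>\<^bsub>EB\<^esub> map_mat s W = ?T" using W ES.hom_mult[OF W(1) W(1)] by simp
  note FQ = BQ.matrix_frobenius[OF Q_Units]
  have F: "map_mat Ah.\<phi> qA \<in> carrier EA" using qA_frobenius(1) by auto
  have c: "?F \<in> carrier EB" "?T \<in> carrier EB" "map_mat s qA \<in> carrier EB"
    "transpose_mat x \<in> carrier EB" "transpose_mat xp \<in> carrier EB" "?P \<in> carrier EB"
    using ES.hom_closed[OF F] ES.hom_closed[OF T(1)] ES.hom_closed[OF qA_closed]
      B.matrix_transpose_closed[OF x_closed] B.matrix_transpose_closed[OF xp_closed] FQ(2) by auto
  have fc: "map_mat BQ.\<phi> Q \<in> carrier EB" using FQ(1) by auto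
  note mult = B.matrix_mult_dim1[folded n1]
  note e = c[THEN matrix_ring_carrierD(4), OF n_pos n_pos] x_index(4)[OF n_pos n_pos]
  have xp0: "xp $$ (0, 0) = x $$ (0, 0) [^]\<^bsub>B\<^esub> p" using x_index n_pos by (simp add: entrywise_power_def)
  have t0: "transpose_mat xp $$ (0, 0) = xp $$ (0, 0)" "transpose_mat x $$ (0, 0) = x $$ (0, 0)"
    using matrix_ring_carrierD[OF xp_closed] x_index n_pos by simp_all
  have FT: "?F $$ (0, 0) \<otimes>\<^bsub>B\<^esub> ?T $$ (0, 0) = map_mat s qA $$ (0, 0) [^]\<^bsub>B\<^esub> p"
  proof -
    have "?F $$ (0, 0) \<otimes>\<^bsub>B\<^esub> ?T $$ (0, 0) = (?F \<otimes>\<^bsub>EB\<^esub> ?T) $$ (0, 0)" using mult[OF c(1,2)] by simp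
    also have "?F \<otimes>\<^bsub>EB\<^esub> ?T = map_mat s (entrywise_power Ah p qA)"
      using ES.hom_mult[OF F T(1)] by (simp add: frobenius_mult_T)
    finally show ?thesis
      using matrix_ring_carrierD[OF qA_closed] n_pos by (simp add: entrywise_power_def)
  qed
  \<comment> \<open>Multiplying out instead of inverting keeps the computation inside commutative
    ring identities; the inverse enters only afterwards.\<close>
  have "map_mat BQ.\<phi> Q \<otimes>\<^bsub>EB\<^esub> ?T = ?P"
  proof (rule matrix_ring_eqI[OF EB.m_closed[OF fc c(2)] c(6)])
    fix i j assume "i < n" "j < n"
    then have ij: "i = 0" "j = 0" using n1 by auto
    have "(map_mat BQ.\<phi> Q \<otimes>\<^bsub>EB\<^esub> ?T) $$ (0, 0) =
        x $$ (0, 0) [^]\<^bsub>B\<^esub> p \<otimes>\<^bsub>B\<^esub> ?F $$ (0, 0) \<otimes>\<^bsub>B\<^esub> x $$ (0, 0) [^]\<^bsub>B\<^esub> p \<otimes>\<^bsub>B\<^esub> ?T $$ (0, 0)"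
      unfolding frobenius_Q using c xp_closed by (simp only: mult EB.m_closed xp0 t0)
    also have "\<dots> = x $$ (0, 0) [^]\<^bsub>B\<^esub> p \<otimes>\<^bsub>B\<^esub> (?F $$ (0, 0) \<otimes>\<^bsub>B\<^esub> ?T $$ (0, 0)) \<otimes>\<^bsub>B\<^esub> x $$ (0, 0) [^]\<^bsub>B\<^esub> p"
      using e by (simp add: B.m_ac)
    also have "\<dots> = (x $$ (0, 0) \<otimes>\<^bsub>B\<^esub> map_mat s qA $$ (0, 0) \<otimes>\<^bsub>B\<^esub> x $$ (0, 0)) [^]\<^bsub>B\<^esub> p"
      unfolding FT using e by (simp add: B.nat_pow_distrib)
    also have "\<dots> = ?P $$ (0, 0)"
    proof -
      have "Q $$ (0, 0) = x $$ (0, 0) \<otimes>\<^bsub>B\<^esub> map_mat s qA $$ (0, 0) \<otimes>\<^bsub>B\<^esub> x $$ (0, 0)"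
        unfolding Q_def using c x_closed by (simp only: mult EB.m_closed t0)
      then show ?thesis using matrix_ring_carrierD[OF Q_closed] n_pos by (simp add: entrywise_power_def)
    qed
    finally show "(map_mat BQ.\<phi> Q \<otimes>\<^bsub>EB\<^esub> ?T) $$ (i, j) = ?P $$ (i, j)" by (simp add: ij)
  qed
  then have "V = inv\<^bsub>EB\<^esub> (map_mat BQ.\<phi> Q) \<otimes>\<^bsub>EB\<^esub> (map_mat BQ.\<phi> Q \<otimes>\<^bsub>EB\<^esub> ?T)"
    by (simp add: V_def)
  also have "\<dots> = (inv\<^bsub>EB\<^esub> (map_mat BQ.\<phi> Q) \<otimes>\<^bsub>EB\<^esub> map_mat BQ.\<phi> Q) \<otimes>\<^bsub>EB\<^esub> ?T"
    by (rule EB.m_assoc[symmetric, OF EB.Units_inv_closed[OF FQ(1)] fc c(2)])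
  also have "\<dots> = ?T" using FQ(1) c(2) by simp
  finally show "S \<otimes>\<^bsub>EB\<^esub> S = map_mat s W \<otimes>\<^bsub>EB\<^esub> map_mat s W" using S(3) W2 by simp
qed

lemma frobenius_x_dim1: "BP.\<phi> (x $$ (0, 0)) = x $$ (0, 0) [^]\<^bsub>B\<^esub> p \<otimes>\<^bsub>B\<^esub> s (W $$ (0, 0))"
proof -
  have "BP.\<phi> (x $$ (0, 0)) = map_mat BP.\<phi> x $$ (0, 0)" using x_index n_pos by simp
  also have "\<dots> = xp $$ (0, 0) \<otimes>\<^bsub>B\<^esub> S $$ (0, 0)"
    unfolding chern_frobenius by (rule B.matrix_mult_dim1[folded n1, OF xp_closed S(1)])
  finally show ?thesis
    using x_index matrix_ring_carrierD[OF W(1)] n_pos by (simp add: S_dim1 entrywise_power_def)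
qed

text \<open>The trivial lift sends x^p w to x^{p^2} \<phi>(w) = (x^p w)^p + p x^{p^2} \<delta>(w).
  Hence the value of the trivial derivation at x^p w is x^{p^2} \<delta>(w), and up to sign this is
  the curvature.\<close>

lemma \<Phi>_dim1:
  "\<Phi> $$ (0, 0) = s (\<Phi>1 $$ (0, 0)) \<otimes>\<^bsub>B\<^esub> x $$ (0, 0) [^]\<^bsub>B\<^esub> (p ^ 2)"
proof -
  let ?x = "x $$ (0, 0)" and ?w = "W $$ (0, 0)"
  have x0: "?x \<in> carrier B" using x_index(4) n_pos by simp
  have w: "?w \<in> carrier Ah" using matrix_ring_carrierD(4)[OF W(1)] n_pos by simp
  let ?y = "?x [^]\<^bsub>B\<^esub> p \<otimes>\<^bsub>B\<^esub> s ?w" and ?z = "(?x [^]\<^bsub>B\<^esub> p) [^]\<^bsub>B\<^esub> p \<otimes>\<^bsub>B\<^esub> s (\<delta>A ?w)"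
  have "BQ.\<phi> ?y = (?x [^]\<^bsub>B\<^esub> p) [^]\<^bsub>B\<^esub> p \<otimes>\<^bsub>B\<^esub> s (Ah.\<phi> ?w)"
    using x0 w n_pos by (simp add: frobenius_s \<phi>q_x)
  also have "\<dots> = ?y [^]\<^bsub>B\<^esub> p \<oplus>\<^bsub>B\<^esub> [p] \<cdot>\<^bsub>B\<^esub> ?z"
    unfolding Ah.frobenius_def using x0 w by (simp add: B.r_distr B.nat_pow_distrib B.add_pow_rdistr)
  finally have "\<delta>q ?y = ?z" using BQ.derivation_eq_iff[of ?y ?z] x0 w by simp
  then have "\<Phi> $$ (0, 0) = \<ominus>\<^bsub>B\<^esub> ?z"
    using x_index n_pos curvature_x[of 0 0] by (simp add: frobenius_x_dim1)
  also have "\<dots> = s (\<ominus>\<^bsub>Ah\<^esub> \<delta>A ?w) \<otimes>\<^bsub>B\<^esub> ?x [^]\<^bsub>B\<^esub> (p ^ 2)"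
    using x0 w by (simp add: B.nat_pow_pow power2_eq_square B.l_minus B.r_minus B.m_comm)
  finally show ?thesis using \<Phi>1_index[of 0 0] n_pos by simp
qed

text \<open>Vanishing on x already forces q to be 0 or a root of unity, and 0 is not invertible.
  Conversely, for a root of unity the Chern lift sends x to x^p, so it is the trivial lift, and a
  map commutes with itself.\<close>

lemma curvature_zero_iff:
  "(\<forall>b\<in>carrier B. curvature p B BP.\<phi> BQ.\<phi> b = \<zero>\<^bsub>B\<^esub>) \<longleftrightarrow> is_root_of_unity (q $$ (0, 0))"
proof
  assume z: "\<forall>b\<in>carrier B. curvature p B BP.\<phi> BQ.\<phi> b = \<zero>\<^bsub>B\<^esub>"
  have "\<Phi>1 = \<zero>\<^bsub>EA\<^esub>"
    using x_index z by (intro eq_matI) (simp_all add: matrix_ring_simps)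
  then have "q $$ (0, 0) = 0 \<or> is_root_of_unity (q $$ (0, 0))" using \<Phi>1_eq_zero_iff n_pos by blast
  moreover have "q $$ (0, 0) \<noteq> 0"
  proof
    assume q0: "q $$ (0, 0) = 0"
    interpret E: ring "matrix_ring 1 A" by (rule A.matrix_ring_ring)
    have qE: "q \<in> Units (matrix_ring 1 A)" using q unfolding n1 .
    have "(q \<otimes>\<^bsub>matrix_ring 1 A\<^esub> inv\<^bsub>matrix_ring 1 A\<^esub> q) $$ (0, 0) = 0"
      using A.matrix_mult_dim1[OF E.Units_closed[OF qE] E.Units_inv_closed[OF qE]] q0
      by (simp add: A_simps)
    then have "\<one>\<^bsub>matrix_ring 1 A\<^esub> $$ (0, 0) = 0" unfolding E.Units_r_inv[OF qE] .
    then show False by (simp add: matrix_ring_simps A_simps)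
  qed
  ultimately show "is_root_of_unity (q $$ (0, 0))" by simp
next
  assume "is_root_of_unity (q $$ (0, 0))"
  then have W1: "W = \<one>\<^bsub>EA\<^esub>" using W_eq_one_iff n1 by auto
  have eq: "BP.\<phi> b = BQ.\<phi> b" if b: "b \<in> carrier B" for b
  proof (rule B_hom_eqI[OF B.p_complete_ring_axioms BP.frob.homh BQ.frob.homh _ _ b])
    show "BP.\<phi> (s a) = BQ.\<phi> (s a)" if "a \<in> carrier Ah" for a using that by (simp add: frobenius_s)
    show "BP.\<phi> (x $$ (i, j)) = BQ.\<phi> (x $$ (i, j))" if "i < n" "j < n" for i j
    proof -
      have ij: "i = 0" "j = 0" using that n1 by auto
      have "x $$ (0, 0) \<in> carrier B" using x_index(4) n_pos by simp
      then show ?thesis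
        using frobenius_x_dim1 n_pos by (simp add: ij W1 \<phi>q_x matrix_ring_simps)
    qed
  qed
  show "\<forall>b\<in>carrier B. curvature p B BP.\<phi> BQ.\<phi> b = \<zero>\<^bsub>B\<^esub>"
  proof
    fix b assume b: "b \<in> carrier B"
    have "BP.\<phi> (BQ.\<phi> b) = BQ.\<phi> (BP.\<phi> b)" using b by (simp add: eq)
    then have "BP.\<phi> b [^]\<^bsub>B\<^esub> p \<oplus>\<^bsub>B\<^esub> [p] \<cdot>\<^bsub>B\<^esub> BP.\<phi> (\<delta>q b) = BQ.\<phi> (BP.\<phi> b)"
      unfolding BQ.frobenius_def[of b] using b by simp
    then have "\<delta>q (BP.\<phi> b) = BP.\<phi> (\<delta>q b)"
      using BQ.derivation_eq_iff[of "BP.\<phi> b" "BP.\<phi> (\<delta>q b)"] b by simp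
    then show "curvature p B BP.\<phi> BQ.\<phi> b = \<zero>\<^bsub>B\<^esub>"
      using curvature_eq[OF BP.p_derivation_ring_axioms BQ.p_derivation_ring_axioms b] b
      by (simp add: B.minus_eq B.r_neg)
  qed
qed

end

end

theorem theorem5p1:
  fixes M N n p :: nat and \<zeta> :: complex and q :: "complex mat"
    and A :: "complex ring"
    and \<delta>A :: "A_hat \<Rightarrow> A_hat" and \<delta>p \<delta>pbar :: "GL_hat \<Rightarrow> GL_hat" and ev :: "GL_hat \<Rightarrow> A_hat"
  assumes "even M" and "M > 0" and "N \<ge> 1" and "primitive_root_of_unity N \<zeta>"
    and "A = base_ring M \<zeta>"
    and "n \<ge> 1"
    and "prime p" and "\<not> p dvd M * N"
    and "q \<in> Units (matrix_ring n A)" and "transpose_mat q = q \<or> transpose_mat q = - q"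
    and "base_derivation p A \<zeta> \<delta>A"
    and "chern_connection p A n \<delta>A q \<delta>p"
    and "trivial_connection p A n \<delta>A \<delta>pbar"
    and "evaluation_at_one p A n ev"
  shows
    "let Ah = p_completion p A;
         B = GL_completion p A n;
         E = matrix_ring n Ah;
         x = x_matrix p A n;
         qA = map_mat (to_completion p A) q;
         \<phi> = curvature p B (frobenius_lift p B \<delta>p) (frobenius_lift p B \<delta>pbar);
         \<Phi> = map_mat \<phi> x;
         \<Phi>1 = map_mat ev \<Phi>
     in \<Phi>1 = \<ominus>\<^bsub>E\<^esub> map_mat \<delta>A
                (matrix_binomial_power p Ah n (to_completion p A) (- 1/2)
                  (\<one>\<^bsub>E\<^esub> \<oplus>\<^bsub>E\<^esub> [p] \<cdot>\<^bsub>E\<^esub> (inv\<^bsub>E\<^esub> (entrywise_power Ah p qA) \<otimes>\<^bsub>E\<^esub> map_mat \<delta>A qA)))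
        \<and> (n = 1 \<longrightarrow>
             \<Phi> $$ (0, 0) = structure_map p A n (\<Phi>1 $$ (0, 0)) \<otimes>\<^bsub>B\<^esub> x $$ (0, 0) [^]\<^bsub>B\<^esub> (p ^ 2))
        \<and> (\<Phi>1 = \<zero>\<^bsub>E\<^esub> \<longleftrightarrow> (\<forall>i<n. \<forall>j<n. q $$ (i, j) = 0 \<or> is_root_of_unity (q $$ (i, j))))
        \<and> (n = 1 \<longrightarrow>
             ((\<forall>b\<in>carrier B. \<phi> b = \<zero>\<^bsub>B\<^esub>) \<longleftrightarrow> is_root_of_unity (q $$ (0, 0))))"
proof -
  interpret chern_base M N p \<zeta> A \<delta>A n q \<delta>p \<delta>pbar ev
    using assms by unfold_locales
  have "\<Phi>1 = \<ominus>\<^bsub>EA\<^esub> map_mat \<delta>A (matrix_binomial_power p Ah n \<iota> (- 1/2) V')"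
    unfolding W_eq[symmetric] by (rule \<Phi>1_eq)
  then show ?thesis
    unfolding Let_def using \<Phi>_dim1 \<Phi>1_eq_zero_iff curvature_zero_iff
    by (simp add: V'_def qA_def)
qed

end
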